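(* Let $d\ge1$ and $k\ge1$ be integers, let $c\in[0,\tfrac12)$, and let $\mathcal{A}$ be the set of all randomized algorithms whose outputs lie in $[c,1-c]^d$. Then for all $\alpha>1$ and $\varepsilon\ge0$, \[ \mathrm{post}_{\mathcal{A},\alpha,k}(\varepsilon)=\sup_{\substack{P,Q\in\mathcal{C}_d\\ R_\alpha(P,Q)\le\varepsilon,\ R_\alpha(Q,P)\le\varepsilon}} R_\alpha(\mathrm{Bern}_k(P),\mathrm{Bern}_k(Q)). \]
   Context: For distributions $P,Q$ on a set $\Theta$ and $\alpha>1$, the Rényi divergence of order $\alpha$ is $R_\alpha(P,Q)=\frac{1}{\alpha-1}\log\int (dP/dQ)^\alpha dQ$. Datasets are related by a symmetric binary neighboring relation $D\sim D'$. A randomized algorithm $A$ maps each dataset $D$ to a distribution $A(D)$ on its output space; $\varepsilon_A(\alpha)=\sup_{D\sim D'}R_\alpha(A(D),A(D'))$. For $x\in[0,1]^d$, $\mathrm{Bern}(x)$ is the random vector in $\{0,1\}^d$ with $\Pr[\mathrm{Bern}(x)=(b_1,\dots,b_d)]=\prod_{i=1}^d x_i^{b_i}(1-x_i)^{1-b_i}$, and $\mathrm{Bern}_k(x)$ denotes $k$ independent runs of $\mathrm{Bern}(x)$ (a random element of $(\{0,1\}^d)^k$). For a distribution $P$ on $[0,1]^d$, $\mathrm{Bern}_k(P)$ is the distribution of $\mathrm{Bern}_k(X)$ with $X\sim P$ (one draw of $X$, then $k$ independent samples given $X$), and $\mathrm{Bern}_k(A)$ is the algorithm $D\mapsto\mathrm{Bern}_k(A(D))$.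 For a family $\mathcal{A}$ of algorithms with outputs in $[0,1]^d$, $\mathrm{post}_{\mathcal{A},\alpha,k}(\varepsilon)=\sup_{A\in\mathcal{A},\ \varepsilon_A(\alpha)\le\varepsilon}\varepsilon_{\mathrm{Bern}_k(A)}(\alpha)$. $\mathcal{C}_d$ is the set of probability distributions supported on $\{c,1-c\}^d$. *)

theory Defs
  imports "HOL-Probability.Probability"
begin

definition renyi :: "real \<Rightarrow> 'a measure \<Rightarrow> 'a measure \<Rightarrow> ereal" where
  "renyi \<alpha> P Q =
    (if absolutely_continuous Q P then
       (let I = (\<integral>\<^sup>+ x. ennreal ((enn2real (RN_deriv Q P x)) powr \<alpha>) \<partial>Q) in
        if I = \<infinity> then \<infinity> else ereal (ln (enn2real I) / (\<alpha> - 1)))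
     else \<infinity>)"

text \<open>Bern_k(P): draw X from P (a distribution on [0,1]^d, d = CARD('n)), then k = CARD('k)
  independent samples of Bern(X); outcome is an element of ({0,1}^d)^k, encoded as
  a function 'k => 'n => bool.\<close>
definition bern_k :: "(real^'n) measure \<Rightarrow> ('k::finite \<Rightarrow> 'n \<Rightarrow> bool) measure" where
  "bern_k P = density (count_space UNIV)
     (\<lambda>\<omega>. \<integral>\<^sup>+ x. ennreal (\<Prod>j\<in>UNIV. \<Prod>i\<in>UNIV. if \<omega> j i then x $ i else 1 - x $ i) \<partial>P)"

definition eps_alg :: "('d \<Rightarrow> 'd \<Rightarrow> bool) \<Rightarrow> real \<Rightarrow> ('d \<Rightarrow> 'a measure) \<Rightarrow> ereal" where
  "eps_alg nb \<alpha> A = (SUP DD' \<in> {(D, D'). nb D D'}. renyi \<alpha> (A (fst DD')) (A (snd DD')))"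

definition box_alg :: "real \<Rightarrow> ('d \<Rightarrow> (real^'n) measure) \<Rightarrow> bool" where
  "box_alg c A = (\<forall>D. prob_space (A D) \<and> sets (A D) = sets borel \<and>
      (AE x in A D. \<forall>i. c \<le> x $ i \<and> x $ i \<le> 1 - c))"

definition in_C :: "real \<Rightarrow> (real^'n) measure \<Rightarrow> bool" where
  "in_C c P = (prob_space P \<and> sets P = sets borel \<and>
      (AE x in P. \<forall>i. x $ i = c \<or> x $ i = 1 - c))"

end

theory Submission
  imports Defs
begin

text \<open>
  Let \<open>P = g Q\<close>. The quantity \<open>exp ((\<alpha> - 1) R_\<alpha>)\<close> of the outputs is the integral of a functional that is
  linear in \<open>(g, Q)\<close> once the output likelihood ratios are fixed, so Lagrangian duality for the two
  constraints \<open>\<integral> g powr \<alpha> dQ \<le> M\<close> and \<open>\<integral> g powr (1 - \<alpha>) dQ \<le> M\<close> can be checked on pairs of points \<open>x, x'\<close> of the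
  box. By data processing (coordinate by coordinate) such a pair is dominated by the two opposite
  corners \<open>(c, ..., c)\<close> and \<open>(1 - c, ..., 1 - c)\<close>, and pairing each outcome with its complement makes
  the corner experiment a mixture of binary symmetric channels.

  It remains to see that among all binary pairs with divergence at most \<open>\<epsilon>\<close> in both directions the
  symmetric pair \<open>((1 + t) / 2, (1 - t) / 2)\<close> is the worst one for every binary symmetric channel. The
  derivative of this claim in the channel parameter is a Lagrangian inequality; in log-odds
  coordinates the Lagrangian has a unique critical point, namely the symmetric one. Integrating over
  the channel parameter, with explicit integrating factors, gives multipliers that do not depend
  on the pair, so that the inequalities for the different channels can be averaged.
\<close>

section \<open>Monotonicity of hyperbolic quotients\<close>

text \<open>For one fixed channel the stationarity equations of the Lagrangian would couple the pair
  (x, y) with its shrunk image, and the log-odds of the two are unrelated. Differentiating in the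
  channel parameter leaves \<open>aff\<close> and \<open>dis\<close> at a single pair, where both
  are elementary in hyperbolic coordinates; this is why an infinitesimal inequality is proved and
  integrated. The excess over the symmetric pair and the excess of the reversed pair obey coupled
  differential inequalities that are invariant under exchanging the two. Sum and difference
  diagonalise this system, and it is solved by a 2 x 2 matrix with eigenvalues \<open>qs\<close> and
  \<open>qd\<close>. Its entries are the finite multipliers, so the sign of the off-diagonal one
  becomes the condition \<open>qd \<le> qs\<close>. The parameter n = 2\<alpha> - 1 is the gap
  between the exponents \<alpha> and 1 - \<alpha>: the symmetric pair (tanh z, - tanh z) has
  \<open>aff\<close> equal to cosh (n z) / cosh z. Uniqueness of the critical point rests on the
  monotonicity in z of quotients of hyperbolic functions of z and n z.\<close>

lemma sinh_scale_less:
  fixes n x :: real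
  assumes "1 < n" "0 < x"
  shows "n * sinh x < sinh (n * x)"
proof -
  have "\<exists>\<xi>>0. \<xi> < x \<and> (sinh (n * x) - n * sinh x) - (sinh (n * 0) - n * sinh 0)
          = (x - 0) * (n * cosh (n * \<xi>) - n * cosh \<xi>)"
    by (rule MVT2) (use assms in \<open>auto intro!: derivative_eq_intros\<close>)
  then obtain \<xi> where \<xi>: "0 < \<xi>" "\<xi> < x"
    "sinh (n * x) - n * sinh x = x * (n * cosh (n * \<xi>) - n * cosh \<xi>)" by auto
  have "\<xi> < n * \<xi>" using \<xi> assms by simp
  then have "cosh \<xi> < cosh (n * \<xi>)"
    using \<xi>(1) cosh_real_strict_mono[of \<xi> "n * \<xi>"] by simp
  then have "0 < x * (n * cosh (n * \<xi>) - n * cosh \<xi>)" using assms by simp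
  then show ?thesis using \<xi>(3) by linarith
qed

text \<open>The monotone form of l'Hopital's rule. By Cauchy's mean value theorem
  \<open>f x / g x\<close> equals the quotient of derivatives at an earlier point, hence lies below
  \<open>f' x / g' x\<close>, and this decides the sign of the derivative of the quotient.\<close>

lemma quotient_strict_mono:
  fixes f g f' g' :: "real \<Rightarrow> real"
  assumes f: "\<And>x. 0 \<le> x \<Longrightarrow> (f has_real_derivative f' x) (at x)"
    and g: "\<And>x. 0 \<le> x \<Longrightarrow> (g has_real_derivative g' x) (at x)"
    and z: "f 0 = 0" "g 0 = 0"
    and pos: "\<And>x. 0 < x \<Longrightarrow> 0 < g' x"
    and mono: "\<And>x y. 0 < x \<Longrightarrow> x < y \<Longrightarrow> f' x / g' x < f' y / g' y"
    and ab: "0 < a" "a < b"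
  shows "f a / g a < f b / g b"
proof -
  have gpos: "0 < g x" if x: "0 < x" for x
  proof -
    have "\<exists>\<xi>>0. \<xi> < x \<and> g x - g 0 = (x - 0) * g' \<xi>"
      by (rule MVT2) (use x g in auto)
    then obtain \<xi> where "\<xi> > 0" "g x = x * g' \<xi>" using z by auto
    then show ?thesis using pos[of \<xi>] x by simp
  qed
  have key: "f x * g' x < f' x * g x" if x: "0 < x" for x
  proof -
    have "\<exists>g'c f'c c. (g has_real_derivative g'c) (at c) \<and> (f has_real_derivative f'c) (at c) \<and>
        0 < c \<and> c < x \<and> (f x - f 0) * g'c = (g x - g 0) * f'c"
    proof (rule GMVT)
      show "\<forall>y. 0 \<le> y \<and> y \<le> x \<longrightarrow> isCont f y" using f DERIV_isCont by blast
      show "\<forall>y. 0 \<le> y \<and> y \<le> x \<longrightarrow> isCont g y" using g DERIV_isCont by blast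
      show "\<forall>y. 0 < y \<and> y < x \<longrightarrow> f differentiable (at y)"
        using f real_differentiable_def less_imp_le by blast
      show "\<forall>y. 0 < y \<and> y < x \<longrightarrow> g differentiable (at y)"
        using g real_differentiable_def less_imp_le by blast
    qed (use x in simp)
    then obtain g'c f'c c where c: "(g has_real_derivative g'c) (at c)"
      "(f has_real_derivative f'c) (at c)" "0 < c" "c < x" "f x * g'c = g x * f'c"
      using z by auto
    have "g'c = g' c" "f'c = f' c"
      using c f[of c] g[of c] DERIV_unique by (auto intro: DERIV_unique)
    then have "f x = g x * (f' c / g' c)" using c pos[of c] by (simp add: field_simps)
    also have "\<dots> < g x * (f' x / g' x)" using mono[OF c(3,4)] gpos[OF x] by (rule mult_strict_left_mono)
    finally show ?thesis using pos[OF x] by (simp add: field_simps)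
  qed
  have "\<exists>\<xi>>a. \<xi> < b \<and> f b / g b - f a / g a
       = (b - a) * ((f' \<xi> * g \<xi> - f \<xi> * g' \<xi>) / (g \<xi> * g \<xi>))"
  proof (rule MVT2)
    fix x assume "a \<le> x" "x \<le> b"
    then have x: "0 < x" using ab by simp
    show "((\<lambda>x. f x / g x) has_real_derivative (f' x * g x - f x * g' x) / (g x * g x)) (at x)"
      by (rule DERIV_divide) (use x f g gpos[OF x] in auto)
  qed (use ab in auto)
  then obtain \<xi> where \<xi>: "\<xi> > a" "f b / g b - f a / g a
       = (b - a) * ((f' \<xi> * g \<xi> - f \<xi> * g' \<xi>) / (g \<xi> * g \<xi>))" by auto
  have "0 < (f' \<xi> * g \<xi> - f \<xi> * g' \<xi>) / (g \<xi> * g \<xi>)"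
    using key[of \<xi>] gpos[of \<xi>] \<xi> ab by simp
  then have "0 < f b / g b - f a / g a" unfolding \<xi>(2) using ab by (intro mult_pos_pos) auto
  then show ?thesis by simp
qed

text \<open>\<open>N1\<close> and \<open>N2\<close> are the Wronskians of sinh z, sinh (n z) and of
  cosh z, cosh (n z). The two members of each pair satisfy y'' = k^2 y with k = 1 and k = n, so the
  derivatives reduce to n^2 - 1 times a product. Both return as coefficients of the stationarity
  equations and as integrating factors.\<close>

definition N1 :: "real \<Rightarrow> real \<Rightarrow> real" where
  "N1 n z = n * sinh z * cosh (n * z) - cosh z * sinh (n * z)"
definition N2 :: "real \<Rightarrow> real \<Rightarrow> real" where
  "N2 n z = n * cosh z * sinh (n * z) - sinh z * cosh (n * z)"

lemma N1_0 [simp]: "N1 n 0 = 0"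
  by (simp add: N1_def)

lemma N1_deriv: "(N1 n has_real_derivative (n\<^sup>2 - 1) * sinh z * sinh (n * z)) (at z)"
  unfolding N1_def [abs_def]
  by (auto intro!: derivative_eq_intros simp: algebra_simps power2_eq_square)

lemma N2_deriv: "(N2 n has_real_derivative (n\<^sup>2 - 1) * cosh z * cosh (n * z)) (at z)"
  unfolding N2_def [abs_def]
  by (auto intro!: derivative_eq_intros simp: algebra_simps power2_eq_square)

lemma N1_pos: assumes "1 < n" "0 < z" shows "0 < N1 n z"
proof -
  have "\<exists>\<xi>>0. \<xi> < z \<and> N1 n z - N1 n 0 = (z - 0) * ((n\<^sup>2 - 1) * sinh \<xi> * sinh (n * \<xi>))"
    by (rule MVT2) (use assms N1_deriv in auto)
  then obtain \<xi> where "\<xi> > 0" "N1 n z = z * ((n\<^sup>2 - 1) * sinh \<xi> * sinh (n * \<xi>))"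
    by (auto simp: N1_def)
  then show ?thesis using assms by (simp add: power2_eq_square mult_less_cancel_right less_1_mult)
qed

lemma N2_pos: assumes "1 < n" "0 < z" shows "0 < N2 n z"
proof -
  have "\<exists>\<xi>>0. \<xi> < z \<and> N2 n z - N2 n 0 = (z - 0) * ((n\<^sup>2 - 1) * cosh \<xi> * cosh (n * \<xi>))"
    by (rule MVT2) (use assms N2_deriv in auto)
  then obtain \<xi> where "\<xi> > 0" "N2 n z = z * ((n\<^sup>2 - 1) * cosh \<xi> * cosh (n * \<xi>))"
    by (auto simp: N2_def)
  then show ?thesis using assms by (simp add: power2_eq_square less_1_mult)
qed

lemma one_minus_tanh_square: "1 - tanh (y::real)^2 = 1 / cosh y^2"
proof -
  have "1 - tanh y^2 = (cosh y^2 - sinh y^2) / cosh y^2"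
    by (simp add: tanh_def power_divide diff_divide_distrib)
  then show ?thesis by (simp add: cosh_square_eq)
qed

text \<open>The logarithmic derivative is n / (sinh (n x) cosh (n x)) - 1 / (sinh x cosh x), which
  is negative by \<open>sinh_scale_less\<close> at the doubled angle \<open>2 * x\<close>.\<close>

lemma tanh_ratio_strict_antimono:
  fixes n :: real
  assumes n: "1 < n" and ab: "0 < a" "a < b"
  shows "tanh (n * b) / tanh b < tanh (n * a) / tanh a"
proof -
  have "\<exists>\<xi>>a. \<xi> < b \<and> tanh (n * b) / tanh b - tanh (n * a) / tanh a
       = (b - a) * ((n * (1 - tanh (n * \<xi>)^2) * tanh \<xi> - tanh (n * \<xi>) * (1 - tanh \<xi>^2)) / (tanh \<xi> * tanh \<xi>))"
  proof (rule MVT2)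
    fix x assume "a \<le> x" "x \<le> b"
    then have x: "0 < x" using ab by simp
    then have "x \<noteq> 0" and [simp]: "tanh x \<noteq> 0" "cosh x \<noteq> 0" "cosh (n*x) \<noteq> 0" by simp_all
    show "((\<lambda>x. tanh (n * x) / tanh x) has_real_derivative
       (n * (1 - tanh (n * x)^2) * tanh x - tanh (n * x) * (1 - tanh x^2)) / (tanh x * tanh x)) (at x)"
      using \<open>x \<noteq> 0\<close> by (auto intro!: derivative_eq_intros simp: field_simps)
  qed (use ab in auto)
  then obtain x where x: "x > a" "tanh (n * b) / tanh b - tanh (n * a) / tanh a
       = (b - a) * ((n * (1 - tanh (n * x)^2) * tanh x - tanh (n * x) * (1 - tanh x^2)) / (tanh x * tanh x))"
    by auto
  have x0: "0 < x" using x ab by simp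
  have "n * sinh (2 * x) < sinh (n * (2 * x))" using n x0 by (intro sinh_scale_less) auto
  then have "n * (sinh x * cosh x) < sinh (n * x) * cosh (n * x)"
    using sinh_double[of x] sinh_double[of "n*x"] by (simp add: algebra_simps)
  then have "n * (1 - tanh (n * x)^2) * tanh x - tanh (n * x) * (1 - tanh x^2) < 0"
    unfolding one_minus_tanh_square by (simp add: tanh_def field_simps power2_eq_square)
  then have "(n * (1 - tanh (n * x)^2) * tanh x - tanh (n * x) * (1 - tanh x^2)) / (tanh x * tanh x) < 0"
    using x0 by (intro divide_neg_pos) auto
  then have "tanh (n * b) / tanh b - tanh (n * a) / tanh a < 0"
    unfolding x(2) using ab by (intro mult_pos_neg) auto
  then show ?thesis by simp
qed

text \<open>Half of \<open>dlt n z \<plusminus> sgm n z\<close> are the Lagrange multipliers of the symmetric pair \<open>(tanh z, - tanh z)\<close>, where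
  \<open>n = 2 * \<alpha> - 1\<close>, and \<open>psi n z\<close> is their ratio.\<close>
definition sgm :: "real \<Rightarrow> real \<Rightarrow> real" where
  "sgm n z = (n\<^sup>2 - 1) * sinh z * cosh z ^ 2 * cosh (n * z) / N2 n z"
definition dlt :: "real \<Rightarrow> real \<Rightarrow> real" where
  "dlt n z = (n\<^sup>2 - 1) * sinh z ^ 2 * cosh z * sinh (n * z) / N1 n z"

section \<open>Positivity and monotonicity of the multipliers of the symmetric pair\<close>

lemma n2_pos: "1 < n \<Longrightarrow> 0 < n\<^sup>2 - (1::real)"
  by (simp add: power2_eq_square less_1_mult)

lemma sgm_pos: "1 < n \<Longrightarrow> 0 < z \<Longrightarrow> 0 < sgm n z"
  unfolding sgm_def using N2_pos[of n z] n2_pos[of n] by simp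

text \<open>This makes the multiplier (dlt - sgm) / 2 of the reversed constraint positive. After
  cross-multiplication, cosh^2 - sinh^2 = 1 leaves only \<open>sinh_scale_less\<close> at
  \<open>2 * z\<close>.\<close>

lemma sgm_less_dlt: assumes "1 < n" "0 < z" shows "sgm n z < dlt n z"
proof -
  have "n * sinh (2 * z) < sinh (n * (2 * z))" using assms by (intro sinh_scale_less) auto
  then have 1: "n * (sinh z * cosh z) < sinh (n * z) * cosh (n * z)"
    using sinh_double[of z] sinh_double[of "n*z"] by (simp add: algebra_simps)
  have "sinh z * sinh (n*z) * N2 n z - cosh z * cosh (n*z) * N1 n z
     = sinh (n*z) * cosh (n*z) * (cosh z^2 - sinh z^2) - n * (sinh z * cosh z) * (cosh (n*z)^2 - sinh (n*z)^2)"
    unfolding N1_def N2_def by (simp add: algebra_simps power2_eq_square)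
  also have "\<dots> > 0" using 1 by (simp add: cosh_square_eq)
  finally have 2: "cosh z * cosh (n*z) * N1 n z < sinh z * sinh (n*z) * N2 n z" by simp
  have "0 < (n\<^sup>2 - 1) * sinh z * cosh z" using assms n2_pos[of n] by simp
  from mult_strict_left_mono[OF 2 this] show ?thesis
    unfolding sgm_def dlt_def using N1_pos[OF assms] N2_pos[OF assms]
    by (simp add: field_simps power2_eq_square)
qed

text \<open>Divided by sinh z cosh (n z), the denominator \<open>N2\<close> becomes n tanh (n z) /
  tanh z - 1, which decreases and stays positive, while the remaining numerator grows like cosh^2
  z.\<close>

lemma sgm_strict_mono:
  assumes n: "1 < n" and ab: "0 < a" "a < b"
  shows "sgm n a < sgm n b"
proof -
  have eq: "sgm n z = (n\<^sup>2 - 1) * cosh z ^ 2 / (n * (tanh (n * z) / tanh z) - 1)" if "0 < z" for z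
  proof -
    have "N2 n z = sinh z * cosh (n * z) * (n * (tanh (n * z) / tanh z) - 1)"
      using that unfolding N2_def tanh_def by (simp add: field_simps)
    then show ?thesis using that unfolding sgm_def by simp
  qed
  have den: "0 < n * (tanh (n * z) / tanh z) - 1" if "0 < z" for z
  proof -
    have "tanh z \<le> tanh (n * z)" using that n by simp
    then have "1 \<le> tanh (n * z) / tanh z" using that by simp
    then have "n * 1 \<le> n * (tanh (n * z) / tanh z)" using n by (intro mult_left_mono) auto
    then show ?thesis using n by linarith
  qed
  have c: "cosh a ^ 2 < cosh b ^ 2"
    using ab cosh_real_strict_mono[of a b] by (intro power_strict_mono) auto
  have r: "n * (tanh (n * b) / tanh b) - 1 < n * (tanh (n * a) / tanh a) - 1"
    using mult_strict_left_mono[OF tanh_ratio_strict_antimono[OF n ab], of n] n by linarith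
  show ?thesis unfolding eq[OF ab(1)] eq[OF less_trans[OF ab]]
    using den[OF ab(1)] den[OF less_trans[OF ab]] r c n2_pos[OF n]
    by (intro frac_less) auto
qed

text \<open>Numerator and denominator vanish at 0, so \<open>quotient_strict_mono\<close> applies.
  The quotient of their derivatives is \<open>q z\<close> over n^2 - 1; its sinh^2 term supplies
  strictness, and \<open>sc\<close> shows that the term with coth (n z) does not decrease.\<close>

lemma dlt_strict_mono:
  assumes n: "1 < n" and ab: "0 < a" "a < b"
  shows "dlt n a < dlt n b"
proof -
  define q where "q z = (3 * sinh z ^ 2 + 2 + n * sinh z * cosh z * (cosh (n * z) / sinh (n * z)))" for z
  have sc: "sinh x * cosh x * (cosh (n*x) / sinh (n*x)) \<le> sinh y * cosh y * (cosh (n*y) / sinh (n*y))"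
    if "0 < x" "x < y" for x y
  proof (rule DERIV_nonneg_imp_nondecreasing[where f = "\<lambda>x. sinh x * cosh x * (cosh (n*x) / sinh (n*x))"])
    fix w assume "x \<le> w" "w \<le> y"
    then have w: "0 < w" using that by simp
    have "n * sinh (2 * w) < sinh (n * (2 * w))" using n w by (intro sinh_scale_less) auto
    then have 1: "n * (sinh w * cosh w) < sinh (n * w) * cosh (n * w)"
      using sinh_double[of w] sinh_double[of "n*w"] by (simp add: algebra_simps)
    let ?d = "((cosh w^2 + sinh w^2) * (cosh (n*w) * sinh (n*w)) - n * (sinh w * cosh w)) / sinh (n*w)^2"
    have s0: "sinh (n*w) \<noteq> 0" using w n by simp
    have h: "cosh (n*w) * cosh (n*w) = 1 + sinh (n*w) * sinh (n*w)"
      using cosh_square_eq[of "n*w"] by (simp add: power2_eq_square)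
    have "((\<lambda>x. sinh x * cosh x * (cosh (n*x) / sinh (n*x))) has_real_derivative ?d) (at w)"
      apply (rule derivative_eq_intros refl s0)+
      using s0 h by (simp add: field_simps power2_eq_square)
    moreover have "0 \<le> ?d"
    proof -
      have "1 * (cosh (n*w) * sinh (n*w)) \<le> (cosh w^2 + sinh w^2) * (cosh (n*w) * sinh (n*w))"
        using w n cosh_real_ge_1[of w] by (intro mult_right_mono) (auto intro: add_increasing2)
      then have "n * (sinh w * cosh w) \<le> (cosh w^2 + sinh w^2) * (cosh (n*w) * sinh (n*w))"
        using 1 by (simp only: mult.commute[of "cosh (n*w)"] mult_1)
      then show ?thesis by simp
    qed
    ultimately show "\<exists>d. ((\<lambda>x. sinh x * cosh x * (cosh (n*x) / sinh (n*x))) has_real_derivative d) (at w) \<and> 0 \<le> d"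
      by blast
  qed (use that in simp)
  have "sinh a ^ 2 * cosh a * sinh (n * a) / N1 n a < sinh b ^ 2 * cosh b * sinh (n * b) / N1 n b"
  proof (rule quotient_strict_mono[where
      f' = "\<lambda>z. sinh z * sinh (n * z) * (2 * cosh z^2 + sinh z^2) + n * sinh z^2 * cosh z * cosh (n*z)"
      and g' = "\<lambda>z. (n\<^sup>2 - 1) * sinh z * sinh (n * z)"])
    fix x :: real
    show "((\<lambda>a. sinh a ^ 2 * cosh a * sinh (n * a)) has_real_derivative
      sinh x * sinh (n * x) * (2 * cosh x^2 + sinh x^2) + n * sinh x^2 * cosh x * cosh (n*x)) (at x)"
      by (auto intro!: derivative_eq_intros simp: algebra_simps power2_eq_square)
  next
    fix x y :: real assume xy: "0 < x" "x < y"
    have e: "(sinh z * sinh (n * z) * (2 * cosh z^2 + sinh z^2) + n * sinh z^2 * cosh z * cosh (n*z)) /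
        ((n\<^sup>2 - 1) * sinh z * sinh (n * z)) = q z / (n\<^sup>2 - 1)" if "0 < z" for z
      using that n n2_pos[OF n] cosh_square_eq[of z] unfolding q_def
      by (simp add: field_simps power2_eq_square)
    have "sinh x ^ 2 < sinh y ^ 2" using xy by (intro power_strict_mono) auto
    then have "q x < q y" using mult_left_mono[OF sc[OF xy], of n] n unfolding q_def
      by (simp add: mult.assoc)
    then show "(sinh x * sinh (n * x) * (2 * cosh x^2 + sinh x^2) + n * sinh x^2 * cosh x * cosh (n*x)) /
        ((n\<^sup>2 - 1) * sinh x * sinh (n * x)) < (sinh y * sinh (n * y) * (2 * cosh y^2 + sinh y^2)
            + n * sinh y^2 * cosh y * cosh (n*y)) /
        ((n\<^sup>2 - 1) * sinh y * sinh (n * y))"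
      unfolding e[OF xy(1)] e[OF less_trans[OF xy]] using n2_pos[OF n] by (intro divide_strict_right_mono)
  qed (use ab n n2_pos[OF n] N1_deriv in auto)
  then show ?thesis unfolding dlt_def using n2_pos[OF n]
    by (simp add: mult.assoc mult_strict_left_mono flip: times_divide_eq_right)
qed

definition psi :: "real \<Rightarrow> real \<Rightarrow> real" where
  "psi n z = (dlt n z - sgm n z) / (dlt n z + sgm n z)"

text \<open>Double-angle formulas merge the products with \<open>N1\<close> and \<open>N2\<close>
  into one quotient whose numerator and denominator both vanish at 0, the shape that
  \<open>quotient_strict_mono\<close> asks for.\<close>

lemma psi_eq: assumes "1 < n" "0 < z"
  shows "psi n z = (sinh (n * (2 * z)) - n * sinh (2 * z)) / N1 n (2 * z)"
proof -
  let ?k = "(n\<^sup>2 - 1) * sinh z * cosh z"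
  note p = N1_pos[OF assms] N2_pos[OF assms]
  have k: "0 < ?k" using assms n2_pos[of n] by simp
  have d: "dlt n z = ?k * (sinh z * sinh (n*z) * N2 n z) / (N1 n z * N2 n z)"
    unfolding dlt_def using p by (simp add: field_simps power2_eq_square)
  have s: "sgm n z = ?k * (cosh z * cosh (n*z) * N1 n z) / (N1 n z * N2 n z)"
    unfolding sgm_def using p by (simp add: field_simps power2_eq_square)
  have n2z: "n * (2 * z) = 2 * (n * z)" by simp
  have e1: "2 * (sinh z * sinh (n*z) * N2 n z - cosh z * cosh (n*z) * N1 n z) = sinh (n * (2 * z)) - n * sinh (2 * z)"
  proof -
    have "sinh z * sinh (n*z) * N2 n z - cosh z * cosh (n*z) * N1 n z
     = sinh (n*z) * cosh (n*z) * (cosh z^2 - sinh z^2) - n * (sinh z * cosh z) * (cosh (n*z)^2 - sinh (n*z)^2)"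
      unfolding N1_def N2_def by (simp add: algebra_simps power2_eq_square)
    then show ?thesis unfolding n2z sinh_double by (simp add: cosh_square_eq)
  qed
  have e2: "2 * (sinh z * sinh (n*z) * N2 n z + cosh z * cosh (n*z) * N1 n z) = N1 n (2 * z)"
  proof -
    have "2 * (sinh z * sinh (n*z) * N2 n z + cosh z * cosh (n*z) * N1 n z)
     = n * (2 * sinh z * cosh z) * (cosh (n*z)^2 + sinh (n*z)^2) - (cosh z^2 + sinh z^2) * (2 * sinh (n*z) * cosh (n*z))"
      unfolding N1_def N2_def by (simp add: algebra_simps power2_eq_square)
    then show ?thesis unfolding N1_def n2z sinh_double cosh_double by simp
  qed
  have "psi n z = (?k * (sinh z * sinh (n*z) * N2 n z - cosh z * cosh (n*z) * N1 n z))
     / (?k * (sinh z * sinh (n*z) * N2 n z + cosh z * cosh (n*z) * N1 n z))"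
    unfolding psi_def d s diff_divide_distrib[symmetric] add_divide_distrib[symmetric]
      right_diff_distrib[symmetric] distrib_left[symmetric]
    using p by simp
  also have "\<dots> = (2 * (sinh z * sinh (n*z) * N2 n z - cosh z * cosh (n*z) * N1 n z))
     / (2 * (sinh z * sinh (n*z) * N2 n z + cosh z * cosh (n*z) * N1 n z))"
    using k by (subst (1 2) mult_divide_mult_cancel_left) auto
  finally show ?thesis unfolding e1 e2 .
qed

text \<open>With r the ratio tanh (n w) / tanh w at the half angle w = z / 2, the quotient of the
  derivatives in \<open>psi_eq\<close>, with its sign reversed, is a positive multiple of 1 / r - r.
  It increases because r decreases.\<close>

lemma psi_strict_antimono:
  assumes n: "1 < n" and ab: "0 < a" "a < b"
  shows "psi n b < psi n a"
proof -
  have sq: "cosh (w::real) ^ 2 = sinh w ^ 2 + 1" for w by (rule cosh_square_eq)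
  have "(n * sinh (2*a) - sinh (n * (2*a))) / N1 n (2*a) < (n * sinh (2*b) - sinh (n * (2*b))) / N1 n (2*b)"
  proof (rule quotient_strict_mono[where f' = "\<lambda>z. n * cosh z - n * cosh (n * z)"
      and g' = "\<lambda>z. (n\<^sup>2 - 1) * sinh z * sinh (n * z)"])
    fix x y :: real assume xy: "0 < x" "x < y"
    have e: "(n * cosh z - n * cosh (n * z)) / ((n\<^sup>2 - 1) * sinh z * sinh (n * z))
       = n / (2 * (n\<^sup>2 - 1)) * (inverse (tanh (n * (z/2)) / tanh (z/2)) - tanh (n * (z/2)) / tanh (z/2))" if z: "0 < z" for z
    proof -
      define w where "w = z/2"
      have zw: "z = 2 * w" "n * z = 2 * (n * w)" "w > 0" using z by (auto simp: w_def)
      have ne: "sinh w \<noteq> 0" "sinh (n*w) \<noteq> 0" "cosh w \<noteq> 0" "cosh (n*w) \<noteq> 0" "n\<^sup>2 - 1 \<noteq> 0"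
        using zw n n2_pos[OF n] by (simp_all del: right_minus_eq add: less_imp_neq[symmetric])
      have A: "cosh z - cosh (n * z) = 2 * (sinh w^2 * cosh (n*w)^2 - cosh w^2 * sinh (n*w)^2)"
        unfolding zw(2) unfolding zw(1) cosh_double sq by (simp add: algebra_simps)
      have B: "sinh z * sinh (n*z) = 4 * (sinh w * cosh w * (sinh (n*w) * cosh (n*w)))"
        unfolding zw(2) unfolding zw(1) sinh_double by simp
      have "(n * cosh z - n * cosh (n * z)) / ((n\<^sup>2 - 1) * sinh z * sinh (n * z))
        = n / (n\<^sup>2 - 1) * ((cosh z - cosh (n * z)) / (sinh z * sinh (n*z)))"
        by (simp only: times_divide_times_eq right_diff_distrib mult.assoc)
      also have "(cosh z - cosh (n * z)) / (sinh z * sinh (n*z))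
         = (inverse (tanh (n * w) / tanh w) - tanh (n * w) / tanh w) / 2"
        unfolding A B tanh_def using ne by (simp add: field_simps power2_eq_square)
      finally show ?thesis by (simp add: w_def)
    qed
    let ?r = "\<lambda>z. tanh (n * (z/2)) / tanh (z/2)"
    have r: "?r y < ?r x" using tanh_ratio_strict_antimono[OF n, of "x/2" "y/2"] xy by simp
    have "0 < ?r y" using xy n by simp
    then have "inverse (?r x) < inverse (?r y)" using r by (rule less_imp_inverse_less[rotated])
    then have "inverse (?r x) - ?r x < inverse (?r y) - ?r y" using r by simp
    then show "(n * cosh x - n * cosh (n * x)) / ((n\<^sup>2 - 1) * sinh x * sinh (n * x))
      < (n * cosh y - n * cosh (n * y)) / ((n\<^sup>2 - 1) * sinh y * sinh (n * y))"
      unfolding e[OF xy(1)] e[OF less_trans[OF xy]] using n n2_pos[OF n]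
      by (intro mult_strict_left_mono) auto
  next
    fix x :: real
    show "((\<lambda>x. n * sinh x - sinh (n * x)) has_real_derivative n * cosh x - n * cosh (n * x)) (at x)"
      by (auto intro!: derivative_eq_intros)
  qed (use ab n n2_pos[OF n] N1_deriv in auto)
  moreover have "psi n z = - ((n * sinh (2*z) - sinh (n * (2*z))) / N1 n (2*z))" if "0 < z" for z
    using psi_eq[OF n that] by (simp add: minus_divide_left)
  ultimately show ?thesis using ab by simp
qed

section \<open>The power affinity of two biased coins\<close>

text \<open>The function a^\<alpha> b^(1 - \<alpha>) is convex and homogeneous of degree one; the
  left side is its tangent plane along the ray a = h b, with equality there. Fixing h makes the
  functionals below linear in (a, b).\<close>

lemma Young_powr:
  fixes a b h \<alpha> :: real
  assumes "1 < \<alpha>" "0 \<le> a" "0 < b" "0 \<le> h"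
  shows "\<alpha> * h powr (\<alpha> - 1) * a - (\<alpha> - 1) * h powr \<alpha> * b \<le> a powr \<alpha> * b powr (1 - \<alpha>)"
proof (cases "h = 0")
  case False
  then have h: "0 < h" using assms by simp
  have "(a / b) * h powr (\<alpha> - 1) \<le> (a / b) powr \<alpha> / \<alpha> + (h powr (\<alpha> - 1)) powr (\<alpha> / (\<alpha> - 1)) / (\<alpha> / (\<alpha> - 1))"
    by (rule Youngs_inequality) (use assms in \<open>auto simp: field_simps\<close>)
  also have "(h powr (\<alpha> - 1)) powr (\<alpha> / (\<alpha> - 1)) = h powr \<alpha>"
    using assms by (simp add: powr_powr)
  finally have "\<alpha> * b * ((a / b) * h powr (\<alpha> - 1)) \<le> \<alpha> * b * ((a / b) powr \<alpha> / \<alpha> + h powr \<alpha> / (\<alpha> / (\<alpha> - 1)))"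
    using assms by (intro mult_left_mono) auto
  moreover have "\<alpha> * b * ((a / b) * h powr (\<alpha> - 1)) = \<alpha> * h powr (\<alpha> - 1) * a"
    using assms by simp
  moreover have "\<alpha> * b * ((a / b) powr \<alpha> / \<alpha> + h powr \<alpha> / (\<alpha> / (\<alpha> - 1)))
      = b * (a / b) powr \<alpha> + (\<alpha> - 1) * h powr \<alpha> * b"
    using assms by (simp add: field_simps)
  moreover have "b * (a / b) powr \<alpha> = a powr \<alpha> * b powr (1 - \<alpha>)"
    using assms by (simp add: powr_divide powr_diff)
  ultimately show ?thesis by linarith
qed (use assms in auto)

text \<open>\<open>aff \<alpha> x y\<close> is \<open>exp ((\<alpha> - 1) R_\<alpha>)\<close> for coins of bias \<open>(1 + x) / 2\<close> and \<open>(1 + y) / 2\<close>. Passing both through a binary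
  symmetric channel scales \<open>x\<close> and \<open>y\<close> by the same factor, and \<open>dis\<close> is, up to the term \<open>aff\<close> itself, the derivative
  in the logarithm of that factor.\<close>
definition aff :: "real \<Rightarrow> real \<Rightarrow> real \<Rightarrow> real" where
  "aff \<alpha> x y = ((1 + x) powr \<alpha> * (1 + y) powr (1 - \<alpha>) + (1 - x) powr \<alpha> * (1 - y) powr (1 - \<alpha>)) / 2"

definition dis1 :: "real \<Rightarrow> real \<Rightarrow> real" where
  "dis1 \<alpha> g = (\<alpha> - 1) * g powr \<alpha> - \<alpha> * g powr (\<alpha> - 1)"

definition dis :: "real \<Rightarrow> real \<Rightarrow> real \<Rightarrow> real" where
  "dis \<alpha> x y = (dis1 \<alpha> ((1 + x) / (1 + y)) + dis1 \<alpha> ((1 - x) / (1 - y))) / 2"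

lemma aff_ratio:
  assumes "\<bar>x\<bar> < 1" "\<bar>y\<bar> < 1"
  shows "aff \<alpha> x y = ((1 + y) * ((1 + x) / (1 + y)) powr \<alpha> + (1 - y) * ((1 - x) / (1 - y)) powr \<alpha>) / 2"
proof -
  have "b * (a / b) powr \<alpha> = a powr \<alpha> * b powr (1 - \<alpha>)" if "0 < a" "0 < b" for a b :: real
    using that by (simp add: powr_divide powr_diff)
  then show ?thesis unfolding aff_def using assms by (simp add: abs_less_iff)
qed

section \<open>Partial derivatives of \<open>aff\<close> and \<open>dis\<close>\<close>

definition affx :: "real \<Rightarrow> real \<Rightarrow> real \<Rightarrow> real" where
  "affx \<alpha> x y = \<alpha> / 2 * (((1 + x) / (1 + y)) powr (\<alpha> - 1) - ((1 - x) / (1 - y)) powr (\<alpha> - 1))"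
definition affy :: "real \<Rightarrow> real \<Rightarrow> real \<Rightarrow> real" where
  "affy \<alpha> x y = (1 - \<alpha>) / 2 * (((1 + x) / (1 + y)) powr \<alpha> - ((1 - x) / (1 - y)) powr \<alpha>)"

lemma aff_deriv:
  assumes a: "(a has_real_derivative a') (at r)" and b: "(b has_real_derivative b') (at r)"
    and ab: "\<bar>a r\<bar> < 1" "\<bar>b r\<bar> < 1"
  shows "((\<lambda>r. aff \<alpha> (a r) (b r)) has_real_derivative a' * affx \<alpha> (a r) (b r) + b' * affy \<alpha> (a r) (b r)) (at r)"
proof -
  have 1: "((\<lambda>r. (u r) powr \<alpha> * (v r) powr (1 - \<alpha>)) has_real_derivative
      u' * (\<alpha> * (u r / v r) powr (\<alpha> - 1)) + v' * ((1 - \<alpha>) * (u r / v r) powr \<alpha>)) (at r)"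
    if "(u has_real_derivative u') (at r)" "(v has_real_derivative v') (at r)" "0 < u r" "0 < v r" for u v u' v'
  proof -
    have "((\<lambda>r. (u r) powr \<alpha> * (v r) powr (1 - \<alpha>)) has_real_derivative
      (\<alpha> * u r powr (\<alpha> - of_nat 1) * u') * v r powr (1 - \<alpha>) + ((1 - \<alpha>) * v r powr (1 - \<alpha>
          - of_nat 1) * v') * u r powr \<alpha>) (at r)"
      by (rule DERIV_mult DERIV_fun_powr that)+
    moreover have "v r powr (1 - \<alpha> - of_nat 1) * u r powr \<alpha> = (u r / v r) powr \<alpha>"
      using that by (simp add: powr_divide powr_minus field_simps)
    moreover have "u r powr (\<alpha> - of_nat 1) * v r powr (1 - \<alpha>) = (u r / v r) powr (\<alpha> - 1)"
      using that powr_minus[of "v r" "\<alpha> - 1"] by (simp add: powr_divide field_simps)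
    ultimately show ?thesis by (simp add: algebra_simps)
  qed
  have p: "0 < 1 + a r" "0 < 1 - a r" "0 < 1 + b r" "0 < 1 - b r" using ab by auto
  have "((\<lambda>r. aff \<alpha> (a r) (b r)) has_real_derivative
      ((a' * (\<alpha> * ((1 + a r) / (1 + b r)) powr (\<alpha> - 1)) + b' * ((1 - \<alpha>) * ((1 + a r) / (1 + b r)) powr \<alpha>)) +
       ((- a') * (\<alpha> * ((1 - a r) / (1 - b r)) powr (\<alpha> - 1)) + (- b') * ((1 - \<alpha>) * ((1 - a r) / (1
           - b r)) powr \<alpha>))) / 2) (at r)"
    unfolding aff_def
    by (intro DERIV_cdivide DERIV_add 1) (use a b p in \<open>auto intro!: derivative_eq_intros\<close>)
  then show ?thesis
    by (rule DERIV_cong) (simp add: affx_def affy_def field_simps)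
qed

text \<open>Each summand of \<open>aff\<close> is homogeneous of degree one in (1 + x, 1 + y) or (1
  - x, 1 - y). Writing x = (1 + x) - 1, Euler's relation reproduces \<open>aff\<close> from the
  first part; the constant part is minus the tangent plane of \<open>Young_powr\<close> at a = b =
  1, which is \<open>dis1\<close> of the ratio.\<close>

lemma aff_euler:
  assumes "\<bar>x\<bar> < 1" "\<bar>y\<bar> < 1"
  shows "x * affx \<alpha> x y + y * affy \<alpha> x y = aff \<alpha> x y + dis \<alpha> x y"
proof -
  define g1 where "g1 = (1 + x) / (1 + y)"
  define g2 where "g2 = (1 - x) / (1 - y)"
  have p: "0 < 1 + x" "0 < 1 - x" "0 < 1 + y" "0 < 1 - y" using assms by auto
  have g: "0 < g1" "0 < g2" using p by (auto simp: g1_def g2_def)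
  have x: "x = (1 + y) * g1 - 1" "x = 1 - (1 - y) * g2" using p by (auto simp: g1_def g2_def)
  have pw: "g1 powr \<alpha> = g1 * g1 powr (\<alpha> - 1)" "g2 powr \<alpha> = g2 * g2 powr (\<alpha> - 1)"
    using g by (auto simp: powr_diff)
  have "x * affx \<alpha> x y + y * affy \<alpha> x y =
     (\<alpha> * (x * g1 powr (\<alpha> - 1)) - \<alpha> * (x * g2 powr (\<alpha> - 1)) + y * (1 - \<alpha>) * g1 powr \<alpha> - y * (1 - \<alpha>) * g2 powr \<alpha>) / 2"
    unfolding affx_def affy_def g1_def g2_def by (simp add: field_simps)
  also have "x * g1 powr (\<alpha> - 1) = (1 + y) * g1 powr \<alpha> - g1 powr (\<alpha> - 1)"
    by (subst x(1)) (simp add: pw algebra_simps)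
  also have "x * g2 powr (\<alpha> - 1) = g2 powr (\<alpha> - 1) - (1 - y) * g2 powr \<alpha>"
    by (subst x(2)) (simp add: pw algebra_simps)
  finally show ?thesis
    unfolding aff_ratio[OF assms] dis_def dis1_def g1_def[symmetric] g2_def[symmetric]
    by (simp add: field_simps)
qed

definition disx :: "real \<Rightarrow> real \<Rightarrow> real \<Rightarrow> real" where
  "disx \<alpha> x y = \<alpha> * (\<alpha> - 1) / 2 *
     ((((1 + x) / (1 + y)) powr (\<alpha> - 1) - ((1 + x) / (1 + y)) powr (\<alpha> - 2)) / (1 + y)
    - (((1 - x) / (1 - y)) powr (\<alpha> - 1) - ((1 - x) / (1 - y)) powr (\<alpha> - 2)) / (1 - y))"
definition disy :: "real \<Rightarrow> real \<Rightarrow> real \<Rightarrow> real" where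
  "disy \<alpha> x y = \<alpha> * (\<alpha> - 1) / 2 *
     ((((1 - x) / (1 - y)) powr \<alpha> - ((1 - x) / (1 - y)) powr (\<alpha> - 1)) / (1 - y)
    - (((1 + x) / (1 + y)) powr \<alpha> - ((1 + x) / (1 + y)) powr (\<alpha> - 1)) / (1 + y))"

lemma dis_deriv:
  assumes a: "(a has_real_derivative a') (at r)" and b: "(b has_real_derivative b') (at r)"
    and ab: "\<bar>a r\<bar> < 1" "\<bar>b r\<bar> < 1"
  shows "((\<lambda>r. dis \<alpha> (a r) (b r)) has_real_derivative a' * disx \<alpha> (a r) (b r) + b' * disy \<alpha> (a r) (b r)) (at r)"
proof -
  have 1: "((\<lambda>r. dis1 \<alpha> (u r / v r)) has_real_derivative
      u' * (\<alpha> * (\<alpha> - 1) * ((u r / v r) powr (\<alpha> - 1) - (u r / v r) powr (\<alpha> - 2)) / v r) +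
      v' * (- \<alpha> * (\<alpha> - 1) * ((u r / v r) powr \<alpha> - (u r / v r) powr (\<alpha> - 1)) / v r)) (at r)"
    if uv: "(u has_real_derivative u') (at r)" "(v has_real_derivative v') (at r)" "0 < u r" "0 < v r" for u v u' v'
  proof -
    let ?g = "u r / v r"
    let ?g' = "(u' * v r - u r * v') / (v r * v r)"
    have g: "((\<lambda>r. u r / v r) has_real_derivative ?g') (at r)"
      by (rule DERIV_divide) (use uv in auto)
    have gp: "0 < ?g" using uv by simp
    have "((\<lambda>r. dis1 \<alpha> (u r / v r)) has_real_derivative
       (\<alpha> - 1) * (\<alpha> * ?g powr (\<alpha> - of_nat 1) * ?g') - \<alpha> * ((\<alpha> - 1) * ?g powr (\<alpha> - 1 - of_nat 1) * ?g')) (at r)"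
      unfolding dis1_def by (intro DERIV_diff DERIV_cmult DERIV_fun_powr g gp)
    moreover have "?g' = u' / v r - v' * ?g / v r" using uv by (simp add: field_simps)
    moreover have "?g powr \<alpha> = ?g * ?g powr (\<alpha> - 1)" "?g powr (\<alpha> - 1) = ?g * ?g powr (\<alpha> - 2)"
      using gp by (auto simp: powr_mult_base simp del: times_divide_eq_left)
    ultimately show ?thesis by (simp add: algebra_simps diff_divide_distrib add_divide_distrib)
  qed
  have p: "0 < 1 + a r" "0 < 1 - a r" "0 < 1 + b r" "0 < 1 - b r" using ab by auto
  have d: "((\<lambda>r. 1 + a r) has_real_derivative a') (at r)" "((\<lambda>r. 1 - a r) has_real_derivative - a') (at r)"
     "((\<lambda>r. 1 + b r) has_real_derivative b') (at r)" "((\<lambda>r. 1 - b r) has_real_derivative - b') (at r)"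
    using a b by (auto intro!: derivative_eq_intros)
  have "((\<lambda>r. dis \<alpha> (a r) (b r)) has_real_derivative
     ((a' * (\<alpha> * (\<alpha> - 1) * (((1 + a r) / (1 + b r)) powr (\<alpha> - 1) - ((1 + a r) / (1 + b r)) powr (\<alpha> - 2)) / (1 + b r)) +
      b' * (- \<alpha> * (\<alpha> - 1) * (((1 + a r) / (1 + b r)) powr \<alpha> - ((1 + a r) / (1 + b r)) powr (\<alpha> - 1)) / (1 + b r))) +
     ((- a') * (\<alpha> * (\<alpha> - 1) * (((1 - a r) / (1 - b r)) powr (\<alpha> - 1) - ((1 - a r) / (1 - b r)) powr (\<alpha> - 2)) / (1 - b r)) +
      (- b') * (- \<alpha> * (\<alpha> - 1) * (((1 - a r) / (1 - b r)) powr \<alpha> - ((1 - a r) / (1 - b r)) powr (\<alpha> - 1)) / (1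
          - b r)))) / 2) (at r)"
    unfolding dis_def by (intro DERIV_cdivide DERIV_add 1 d p)
  then show ?thesis
    by (rule DERIV_cong) (simp add: disx_def disy_def algebra_simps diff_divide_distrib add_divide_distrib)
qed

section \<open>Hyperbolic coordinates for a pair of biases\<close>

lemma tanh_surj: assumes "\<bar>x\<bar> < (1::real)" obtains u where "x = tanh u"
proof
  let ?u = "ln ((1 + x) / (1 - x)) / 2"
  have "exp (2 * ?u) = (1 + x) / (1 - x)" using assms by simp
  moreover have "tanh ?u = (exp (2 * ?u) - 1) / (exp (2 * ?u) + 1)"
  proof -
    have "tanh ?u = (exp ?u * (exp ?u - exp (- ?u))) / (exp ?u * (exp ?u + exp (- ?u)))"
      unfolding tanh_altdef by simp
    then show ?thesis by (simp only: distrib_left right_diff_distrib flip: exp_add) simp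
  qed
  moreover have "(1 + x) / (1 - x) - 1 = 2 * x / (1 - x)" "(1 + x) / (1 - x) + 1 = 2 / (1 - x)"
    using assms by (auto simp: field_simps)
  ultimately show "x = tanh ?u" using assms by simp
qed

lemma one_plus_tanh: "1 + tanh u = exp u / cosh (u::real)"
  and one_minus_tanh: "1 - tanh u = exp (- u) / cosh u"
proof -
  have "1 + tanh u = (cosh u + sinh u) / cosh u" "1 - tanh u = (cosh u - sinh u) / cosh u"
    by (simp_all add: tanh_def add_divide_distrib diff_divide_distrib)
  then show "1 + tanh u = exp u / cosh (u::real)" "1 - tanh u = exp (- u) / cosh u"
    unfolding cosh_plus_sinh cosh_minus_sinh .
qed

text \<open>Log-odds coordinates: the two likelihood ratios are \<open>exp (L \<plusminus> 2z)\<close>.\<close>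
context
  fixes \<eta> z L x y :: real
  defines "x \<equiv> tanh (\<eta> + z)" and "y \<equiv> tanh (\<eta> - z)" and "L \<equiv> ln (cosh (\<eta> - z) / cosh (\<eta> + z))"
begin

lemma expL: "exp L = cosh (\<eta> - z) / cosh (\<eta> + z)"
  unfolding L_def by (rule exp_ln) simp

lemma hyp_abs: "\<bar>x\<bar> < 1" "\<bar>y\<bar> < 1"
  using tanh_real_bounds[of "\<eta> + z"] tanh_real_bounds[of "\<eta> - z"] by (auto simp: x_def y_def)

lemma hyp_ratio1: "(1 + x) / (1 + y) = exp (L + 2 * z)"
proof -
  have "(1 + x) / (1 + y) = exp (\<eta> + z) / exp (\<eta> - z) * exp L"
    unfolding x_def y_def one_plus_tanh expL by simp
  also have "\<dots> = exp (L + 2 * z)" by (simp flip: exp_add exp_diff)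
  finally show ?thesis .
qed

lemma hyp_ratio2: "(1 - x) / (1 - y) = exp (L - 2 * z)"
proof -
  have "(1 - x) / (1 - y) = exp (- (\<eta> + z)) / exp (- (\<eta> - z)) * exp L"
    unfolding x_def y_def one_minus_tanh expL by simp
  also have "\<dots> = exp (L - 2 * z)" by (simp flip: exp_add exp_diff)
  finally show ?thesis .
qed

lemma exp_powr: "exp (a::real) powr p = exp (p * a)"
  by (simp add: powr_def)

lemma exp_pm: "exp (p * (L + 2 * z)) - exp (p * (L - 2 * z)) = 2 * exp (p * L) * sinh (2 * p * z)"
  "exp (p * (L + 2 * z)) + exp (p * (L - 2 * z)) = 2 * exp (p * L) * cosh (2 * p * z)"
  by (simp_all add: sinh_def cosh_def algebra_simps flip: exp_add)

lemma exp_pm_neg: "exp (p * - (L + 2 * z)) - exp (p * - (L - 2 * z)) = - 2 * exp (- p * L) * sinh (2 * p * z)"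
  by (simp add: sinh_def algebra_simps flip: exp_add)

lemma affx_hyp: "affx \<alpha> x y = \<alpha> * exp ((\<alpha> - 1) * L) * sinh (2 * (\<alpha> - 1) * z)"
  unfolding affx_def hyp_ratio1 hyp_ratio2 exp_powr exp_pm by simp

lemma affy_hyp: "affy \<alpha> x y = (1 - \<alpha>) * exp (\<alpha> * L) * sinh (2 * \<alpha> * z)"
  unfolding affy_def hyp_ratio1 hyp_ratio2 exp_powr exp_pm by simp

lemma hyp_ratio_swap: "(1 + y) / (1 + x) = exp (- (L + 2 * z))" "(1 - y) / (1 - x) = exp (- (L - 2 * z))"
  unfolding exp_minus hyp_ratio1[symmetric] hyp_ratio2[symmetric] by simp_all

lemma affx_swap_hyp: "affx \<alpha> y x = - \<alpha> * exp ((1 - \<alpha>) * L) * sinh (2 * (\<alpha> - 1) * z)"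
  unfolding affx_def hyp_ratio_swap exp_powr exp_pm_neg by simp

lemma affy_swap_hyp: "affy \<alpha> y x = (\<alpha> - 1) * exp (- \<alpha> * L) * sinh (2 * \<alpha> * z)"
  unfolding affy_def hyp_ratio_swap exp_powr exp_pm_neg by (simp add: field_simps)

lemma hyp_diff: "x - y = sinh (2 * z) / (cosh (\<eta> + z) * cosh (\<eta> - z))"
proof -
  have "2 * z = (\<eta> + z) - (\<eta> - z)" by simp
  then have "sinh (2 * z) = sinh (\<eta> + z) * cosh (\<eta> - z) - cosh (\<eta> + z) * sinh (\<eta> - z)"
    by (simp only: sinh_diff)
  then show ?thesis unfolding x_def y_def tanh_def by (simp add: field_simps)
qed

lemma hyp_quot1: "(exp (L + 2 * z) - 1) / (1 + y) = sinh (2 * z) * exp (L - 2 * (\<eta> - z))"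
proof -
  have y1: "1 + y \<noteq> 0" using hyp_abs by auto
  have "(exp (L + 2 * z) - 1) / (1 + y) = (x - y) / (1 + y)^2"
    unfolding hyp_ratio1[symmetric] using y1 by (simp add: field_simps power2_eq_square)
  also have "\<dots> = sinh (2 * z) * (cosh (\<eta> - z) / cosh (\<eta> + z)) / exp (\<eta> - z) ^ 2"
    unfolding hyp_diff unfolding y_def one_plus_tanh by (simp add: field_simps power2_eq_square)
  also have "\<dots> = sinh (2 * z) * (exp L / exp (2 * (\<eta> - z)))"
    unfolding expL exp_double by simp
  finally show ?thesis by (simp flip: exp_diff)
qed

lemma hyp_quot2: "(exp (L - 2 * z) - 1) / (1 - y) = - sinh (2 * z) * exp (L + 2 * (\<eta> - z))"
proof -
  have y1: "1 - y \<noteq> 0" using hyp_abs by auto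
  have "(exp (L - 2 * z) - 1) / (1 - y) = (y - x) / (1 - y)^2"
    unfolding hyp_ratio2[symmetric] using y1 by (simp add: field_simps power2_eq_square)
  also have "\<dots> = - ((x - y) / (1 - y)^2)"
    by (metis minus_diff_eq minus_divide_left)
  also have "\<dots> = - (sinh (2 * z) * (cosh (\<eta> - z) / cosh (\<eta> + z)) / exp (- (\<eta> - z)) ^ 2)"
    unfolding hyp_diff unfolding y_def one_minus_tanh by (simp add: field_simps power2_eq_square)
  also have "\<dots> = - (sinh (2 * z) * (exp L / exp (2 * (- (\<eta> - z)))))"
    unfolding expL exp_double by simp
  finally show ?thesis by (simp flip: exp_diff)
qed

text \<open>Here \<eta> enters the derivatives of \<open>dis\<close> through a shift by 2\<eta> and
  otherwise, as in those of \<open>aff\<close>, only through L. Hence the stationarity equations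
  become linear in la and nu exp (- n L), with coefficients depending on z and \<alpha>
  alone.\<close>

lemma disx_hyp: "disx \<alpha> x y = \<alpha> * (\<alpha> - 1) * sinh (2 * z) * exp ((\<alpha> - 1) * L) * cosh (2 * (\<alpha> - 1) * z - 2 * \<eta>)"
proof -
  have f: "exp (p * a) - exp ((p - 1) * a) = exp ((p - 1) * a) * (exp a - 1)" for p a :: real
    by (simp add: algebra_simps flip: exp_add)
  have "disx \<alpha> x y = \<alpha> * (\<alpha> - 1) / 2 *
     (exp ((\<alpha> - 2) * (L + 2 * z)) * ((exp (L + 2 * z) - 1) / (1 + y))
    - exp ((\<alpha> - 2) * (L - 2 * z)) * ((exp (L - 2 * z) - 1) / (1 - y)))"
    using f[of "\<alpha> - 1"] unfolding disx_def hyp_ratio1 hyp_ratio2 exp_powr by simp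
  also have "\<dots> = \<alpha> * (\<alpha> - 1) * sinh (2 * z) / 2 *
     (exp ((\<alpha> - 2) * (L + 2 * z)) * exp (L - 2 * (\<eta> - z))
    + exp ((\<alpha> - 2) * (L - 2 * z)) * exp (L + 2 * (\<eta> - z)))"
    unfolding hyp_quot1 hyp_quot2 by (simp add: algebra_simps)
  also have "exp ((\<alpha> - 2) * (L + 2 * z)) * exp (L - 2 * (\<eta> - z))
    + exp ((\<alpha> - 2) * (L - 2 * z)) * exp (L + 2 * (\<eta> - z))
     = 2 * exp ((\<alpha> - 1) * L) * cosh (2 * (\<alpha> - 1) * z - 2 * \<eta>)"
    by (simp add: cosh_def algebra_simps flip: exp_add)
  finally show ?thesis by simp
qed

lemma disy_hyp: "disy \<alpha> x y = - \<alpha> * (\<alpha> - 1) * sinh (2 * z) * exp (\<alpha> * L) * cosh (2 * \<alpha> * z - 2 * \<eta>)"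
proof -
  have f: "exp (p * a) - exp ((p - 1) * a) = exp ((p - 1) * a) * (exp a - 1)" for p a :: real
    by (simp add: algebra_simps flip: exp_add)
  have "disy \<alpha> x y = \<alpha> * (\<alpha> - 1) / 2 *
     (exp ((\<alpha> - 1) * (L - 2 * z)) * ((exp (L - 2 * z) - 1) / (1 - y))
    - exp ((\<alpha> - 1) * (L + 2 * z)) * ((exp (L + 2 * z) - 1) / (1 + y)))"
    unfolding disy_def hyp_ratio1 hyp_ratio2 exp_powr f by simp
  also have "\<dots> = - \<alpha> * (\<alpha> - 1) * sinh (2 * z) / 2 *
     (exp ((\<alpha> - 1) * (L - 2 * z)) * exp (L + 2 * (\<eta> - z))
    + exp ((\<alpha> - 1) * (L + 2 * z)) * exp (L - 2 * (\<eta> - z)))"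
    unfolding hyp_quot1 hyp_quot2 by (simp add: field_simps)
  also have "exp ((\<alpha> - 1) * (L - 2 * z)) * exp (L + 2 * (\<eta> - z))
    + exp ((\<alpha> - 1) * (L + 2 * z)) * exp (L - 2 * (\<eta> - z))
     = 2 * exp (\<alpha> * L) * cosh (2 * \<alpha> * z - 2 * \<eta>)"
    by (simp add: cosh_def algebra_simps flip: exp_add)
  finally show ?thesis by simp
qed

text \<open>The stationarity equations of the Lagrangian, solved for the multipliers.\<close>
lemma critical_point:
  fixes \<alpha> la nu :: real
  assumes \<alpha>: "1 < \<alpha>" and z: "0 < z"
    and cx: "disx \<alpha> x y = la * affx \<alpha> x y - nu * affy \<alpha> y x"
    and cy: "disy \<alpha> x y = la * affy \<alpha> x y - nu * affx \<alpha> y x"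
  defines "n \<equiv> 2 * \<alpha> - 1"
  shows "la - nu * exp (- n * L) = sgm n z * (cosh (n * z - 2 * \<eta>) / cosh (n * z))"
    and "la + nu * exp (- n * L) = dlt n z * (sinh (n * z - 2 * \<eta>) / sinh (n * z))"
proof -
  have n: "1 < n" using \<alpha> by (simp add: n_def)
  let ?E = "exp (- n * L)"
  let ?a = "2 * \<alpha> * z" and ?b = "2 * (\<alpha> - 1) * z"
  \<comment> \<open>Dividing each equation by its own power of exp L leaves L only in
    \<open>?E\<close>.\<close>
  have e1: "exp (- \<alpha> * L) = exp ((\<alpha> - 1) * L) * ?E" "exp ((1 - \<alpha>) * L) = exp (\<alpha> * L) * ?E"
    by (simp_all add: n_def algebra_simps flip: exp_add)
  have "exp ((\<alpha> - 1) * L) * (\<alpha> * (\<alpha> - 1) * sinh (2 * z) * cosh (?b - 2 * \<eta>))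
     = exp ((\<alpha> - 1) * L) * (la * \<alpha> * sinh ?b - nu * ?E * (\<alpha> - 1) * sinh ?a)"
    using cx unfolding disx_hyp affx_hyp affy_swap_hyp e1 by (simp add: algebra_simps)
  then have 1: "\<alpha> * (\<alpha> - 1) * sinh (2 * z) * cosh (?b - 2 * \<eta>) = la * \<alpha> * sinh ?b - nu * ?E * (\<alpha> - 1) * sinh ?a"
    by (metis exp_not_eq_zero mult_left_cancel)
  have "exp (\<alpha> * L) * (\<alpha> * (\<alpha> - 1) * sinh (2 * z) * cosh (?a - 2 * \<eta>))
     = exp (\<alpha> * L) * (la * (\<alpha> - 1) * sinh ?a - nu * ?E * \<alpha> * sinh ?b)"
    using cy unfolding disy_hyp affy_hyp affx_swap_hyp e1 by (simp add: algebra_simps)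
  then have 2: "\<alpha> * (\<alpha> - 1) * sinh (2 * z) * cosh (?a - 2 * \<eta>) = la * (\<alpha> - 1) * sinh ?a - nu * ?E * \<alpha> * sinh ?b"
    by (metis exp_not_eq_zero mult_left_cancel)
  have ab: "?a = n * z + z" "?b = n * z - z" by (auto simp: n_def algebra_simps)
  have ab': "?a - 2 * \<eta> = (n * z - 2 * \<eta>) + z" "?b - 2 * \<eta> = (n * z - 2 * \<eta>) - z" by (auto simp: n_def algebra_simps)
  have al: "\<alpha> = (n + 1) / 2" by (simp add: n_def)
  have k: "\<alpha> * (\<alpha> - 1) = (n\<^sup>2 - 1) / 4" unfolding al by (simp add: field_simps power2_eq_square)
  have s1: "\<alpha> * sinh ?b + (\<alpha> - 1) * sinh ?a = N2 n z"
    unfolding ab sinh_add sinh_diff N2_def by (simp add: al field_simps)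
  have s2: "(\<alpha> - 1) * sinh ?a - \<alpha> * sinh ?b = N1 n z"
    unfolding ab sinh_add sinh_diff N1_def by (simp add: al field_simps)
  \<comment> \<open>Adding the two equations isolates \<open>la - nu * ?E\<close> with coefficient
    \<open>N2\<close>; subtracting them isolates \<open>la + nu * ?E\<close> with coefficient
    \<open>N1\<close>.\<close>
  have "(la - nu * ?E) * N2 n z = \<alpha> * (\<alpha> - 1) * sinh (2 * z) * (cosh (?a - 2 * \<eta>) + cosh (?b - 2 * \<eta>))"
    unfolding s1[symmetric] using 1 2 by (simp add: algebra_simps)
  also have "\<dots> = (n\<^sup>2 - 1) * sinh z * cosh z^2 * cosh (n * z - 2 * \<eta>)"
    unfolding ab' cosh_add cosh_diff k sinh_double by (simp add: field_simps power2_eq_square)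
  finally have "la - nu * ?E = (n\<^sup>2 - 1) * sinh z * cosh z^2 * cosh (n * z - 2 * \<eta>) / N2 n z"
    using N2_pos[OF n z] by (simp add: eq_divide_eq)
  then show "la - nu * ?E = sgm n z * (cosh (n * z - 2 * \<eta>) / cosh (n * z))"
    by (simp add: sgm_def)
  have "(la + nu * ?E) * N1 n z = \<alpha> * (\<alpha> - 1) * sinh (2 * z) * (cosh (?a - 2 * \<eta>) - cosh (?b - 2 * \<eta>))"
    unfolding s2[symmetric] using 1 2 by (simp add: algebra_simps)
  also have "\<dots> = (n\<^sup>2 - 1) * sinh z^2 * cosh z * sinh (n * z - 2 * \<eta>)"
    unfolding ab' cosh_add cosh_diff k sinh_double by (simp add: field_simps power2_eq_square)
  finally have "la + nu * ?E = (n\<^sup>2 - 1) * sinh z^2 * cosh z * sinh (n * z - 2 * \<eta>) / N1 n z"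
    using N1_pos[OF n z] by (simp add: eq_divide_eq)
  then show "la + nu * ?E = dlt n z * (sinh (n * z - 2 * \<eta>) / sinh (n * z))"
    using n z by (simp add: dlt_def)
qed

end

section \<open>The Lagrangian inequality\<close>

lemma aff_minus: "aff \<alpha> (- x) (- y) = aff \<alpha> x y"
  by (simp add: aff_def add.commute)
lemma dis_minus: "dis \<alpha> (- x) (- y) = dis \<alpha> x y"
  by (simp add: dis_def add.commute)

lemma aff_diag: "\<bar>x\<bar> < 1 \<Longrightarrow> aff \<alpha> x x = 1"
  by (simp add: aff_ratio abs_less_iff)
lemma dis_diag: "\<bar>x\<bar> < 1 \<Longrightarrow> dis \<alpha> x x = - 1"
  by (simp add: dis_def dis1_def abs_less_iff)

text \<open>The tangent plane of \<open>Young_powr\<close> at (1, 1) lies below the convex function,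
  which equals 1 there.\<close>

lemma dis1_ge: assumes "1 < \<alpha>" "0 < g" shows "- 1 \<le> dis1 \<alpha> g"
  using Young_powr[of \<alpha> 1 1 g] assms by (simp add: dis1_def)

lemma dis_ge: assumes "1 < \<alpha>" "\<bar>x\<bar> < 1" "\<bar>y\<bar> < 1" shows "- 1 \<le> dis \<alpha> x y"
proof -
  have "- 1 \<le> dis1 \<alpha> ((1 + x) / (1 + y))" "- 1 \<le> dis1 \<alpha> ((1 - x) / (1 - y))"
    using assms by (auto intro!: dis1_ge)
  moreover have "- 1 \<le> (a + b) / 2" if "- 1 \<le> a" "- 1 \<le> b" for a b :: real
    using that by simp
  ultimately show ?thesis unfolding dis_def by blast
qed

lemma aff_ge_1: assumes "1 < \<alpha>" "\<bar>x\<bar> < 1" "\<bar>y\<bar> < 1" shows "1 \<le> aff \<alpha> x y"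
proof -
  have "\<alpha> * (1 + x) - (\<alpha> - 1) * (1 + y) \<le> (1 + x) powr \<alpha> * (1 + y) powr (1 - \<alpha>)"
       "\<alpha> * (1 - x) - (\<alpha> - 1) * (1 - y) \<le> (1 - x) powr \<alpha> * (1 - y) powr (1 - \<alpha>)"
    using Young_powr[of \<alpha> "1 + x" "1 + y" 1] Young_powr[of \<alpha> "1 - x" "1 - y" 1] assms by auto
  then show ?thesis unfolding aff_def by (simp add: algebra_simps)
qed

text \<open>Only the outcome with likelihood ratio at least 1 can make \<open>aff\<close> large; the
  other ratio is at most 1 when y \<le> x.\<close>

lemma aff_le: assumes "1 < \<alpha>" "\<bar>x\<bar> < 1" "\<bar>y\<bar> < 1" "y \<le> x"
  shows "aff \<alpha> x y \<le> 1 + (1 + y) / 2 * (((1 + x) / (1 + y)) powr \<alpha> - 1)"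
proof -
  have "((1 - x) / (1 - y)) powr \<alpha> \<le> 1"
    using assms by (intro powr_le1) (auto simp: abs_less_iff)
  then have "(1 - y) * ((1 - x) / (1 - y)) powr \<alpha> \<le> (1 - y) * 1"
    using assms by (intro mult_left_mono) auto
  then show ?thesis unfolding aff_ratio[OF assms(2,3)] by (simp add: field_simps)
qed

lemma aff_sym: "aff \<alpha> (tanh z) (- tanh z) = cosh ((2 * \<alpha> - 1) * z) / cosh z"
proof -
  have c: "cosh z powr \<alpha> * cosh z powr (1 - \<alpha>) = cosh z"
    by (simp flip: powr_add)
  have "aff \<alpha> (tanh z) (- tanh z) = ((exp z / cosh z) powr \<alpha> * (exp (- z) / cosh z) powr (1 - \<alpha>)
     + (exp (- z) / cosh z) powr \<alpha> * (exp z / cosh z) powr (1 - \<alpha>)) / 2"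
    unfolding aff_def using one_plus_tanh[of z] one_minus_tanh[of z] by simp
  also have "\<dots> = ((exp (\<alpha> * z) * exp ((1 - \<alpha>) * - z)) / cosh z + (exp (\<alpha> * - z) * exp ((1 - \<alpha>) * z)) / cosh z) / 2"
    by (simp add: powr_divide exp_powr c times_divide_times_eq del: mult_minus_right)
  also have "exp (\<alpha> * z) * exp ((1 - \<alpha>) * - z) = exp ((2 * \<alpha> - 1) * z)"
    by (simp add: algebra_simps flip: exp_add)
  also have "exp (\<alpha> * - z) * exp ((1 - \<alpha>) * z) = exp (- ((2 * \<alpha> - 1) * z))"
    by (simp add: algebra_simps flip: exp_add)
  also have "(exp ((2 * \<alpha> - 1) * z) / cosh z + exp (- ((2 * \<alpha> - 1) * z)) / cosh z) / 2 = cosh ((2 * \<alpha> - 1) * z) / cosh z"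
    unfolding cosh_def[of "(2 * \<alpha> - 1) * z"] by (simp add: add_divide_distrib)
  finally show ?thesis .
qed

lemma dis_sym: "dis \<alpha> (tanh z) (- tanh z) = (\<alpha> - 1) * cosh (2 * \<alpha> * z) - \<alpha> * cosh (2 * (\<alpha> - 1) * z)"
proof -
  have "(1 + tanh z) / (1 - tanh z) = exp (2 * z)" "(1 - tanh z) / (1 + tanh z) = exp (- (2 * z))"
    unfolding one_plus_tanh one_minus_tanh by (simp_all flip: exp_diff)
  then show ?thesis unfolding dis_def dis1_def
    by (simp add: exp_powr cosh_def field_simps)
qed

text \<open>Suppose \<eta> > 0. Then L < 0 and \<open>nu' > nu\<close>. Comparing la + nu' with
  \<open>dlt n z0\<close> forces z > z0, because the quotient \<open>?c2\<close> of the sinh terms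
  is below 1. Comparing nu' / la with \<open>psi n z0\<close> forces z < z0, because
  \<open>?c2\<close> is also below the quotient \<open>?c1\<close> of the cosh terms. For \<eta> < 0
  all signs flip, and for \<eta> = 0 the sum alone gives z = z0.\<close>

lemma critical_point_unique:
  fixes \<alpha> z0 z \<eta> :: real
  assumes \<alpha>: "1 < \<alpha>" and z0: "0 < z0" and z: "0 < z"
  defines "n \<equiv> 2 * \<alpha> - 1"
  defines "la \<equiv> (sgm n z0 + dlt n z0) / 2" and "nu \<equiv> (dlt n z0 - sgm n z0) / 2"
  defines "x \<equiv> tanh (\<eta> + z)" and "y \<equiv> tanh (\<eta> - z)"
  assumes cx: "disx \<alpha> x y = la * affx \<alpha> x y - nu * affy \<alpha> y x"
    and cy: "disy \<alpha> x y = la * affy \<alpha> x y - nu * affx \<alpha> y x"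
  shows "\<eta> = 0 \<and> z = z0"
proof -
  have n: "1 < n" using \<alpha> by (simp add: n_def)
  define L where "L = ln (cosh (\<eta> - z) / cosh (\<eta> + z))"
  define nu' where "nu' = nu * exp (- n * L)"
  have eqs: "la - nu' = sgm n z * (cosh (n * z - 2 * \<eta>) / cosh (n * z))"
     "la + nu' = dlt n z * (sinh (n * z - 2 * \<eta>) / sinh (n * z))"
    using critical_point[OF \<alpha> z cx[unfolded x_def y_def] cy[unfolded x_def y_def]]
    unfolding nu'_def L_def n_def by simp_all
  have s: "0 < sgm n z" "sgm n z < dlt n z" "0 < sgm n z0" "sgm n z0 < dlt n z0"
    using sgm_pos[OF n] sgm_less_dlt[OF n] z z0 by auto
  have nu: "0 < nu" "0 < la" using s by (auto simp: nu_def la_def)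
  have nz: "0 < n * z" using n z by simp
  have psi0: "psi n z0 = nu / la" unfolding psi_def nu_def la_def using s by (simp add: field_simps)
  have Lsgn: "L < 0 \<longleftrightarrow> 0 < \<eta>" "0 < L \<longleftrightarrow> \<eta> < 0"
  proof -
    have "cosh (\<eta> - z) < cosh (\<eta> + z) \<longleftrightarrow> 0 < sinh \<eta> * sinh z" "cosh (\<eta> + z) < cosh (\<eta> - z) \<longleftrightarrow> sinh \<eta> * sinh z < 0"
      unfolding cosh_add cosh_diff by auto
    then show "L < 0 \<longleftrightarrow> 0 < \<eta>" "0 < L \<longleftrightarrow> \<eta> < 0"
      using z unfolding L_def by (auto simp: zero_less_mult_iff mult_less_0_iff)
  qed
  have sum: "la + nu = dlt n z0" by (simp add: la_def nu_def field_simps)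
  have nu'p: "0 < nu'" using nu by (simp add: nu'_def)
  have cp: "0 < cosh (n * z)" "0 < sinh (n * z)" using nz by auto
  have sp: "0 < sinh (n * z - 2 * \<eta>)"
  proof -
    have "0 < dlt n z * (sinh (n * z - 2 * \<eta>) / sinh (n * z))" using eqs nu nu'p by linarith
    moreover have "0 < dlt n z" using s by linarith
    ultimately have "0 < sinh (n * z - 2 * \<eta>) / sinh (n * z)" by (rule zero_less_mult_pos)
    then show ?thesis using cp(2) by (metis less_asym zero_less_divide_iff)
  qed
  let ?c1 = "cosh (n * z - 2 * \<eta>) / cosh (n * z)" and ?c2 = "sinh (n * z - 2 * \<eta>) / sinh (n * z)"
  have c12: "?c2 < ?c1 \<longleftrightarrow> 0 < \<eta>" "?c1 < ?c2 \<longleftrightarrow> \<eta> < 0"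
  proof -
    have "sinh (n * z) * cosh (n * z - 2 * \<eta>) - cosh (n * z) * sinh (n * z - 2 * \<eta>) = sinh (2 * \<eta>)"
      using sinh_diff[of "n * z" "n * z - 2 * \<eta>"] by simp
    moreover have "0 < sinh (2 * \<eta>) \<longleftrightarrow> 0 < \<eta>" "sinh (2 * \<eta>) < 0 \<longleftrightarrow> \<eta> < 0" by simp_all
    ultimately have "cosh (n * z) * sinh (n * z - 2 * \<eta>) < sinh (n * z) * cosh (n * z - 2 * \<eta>) \<longleftrightarrow> 0 < \<eta>"
      "sinh (n * z) * cosh (n * z - 2 * \<eta>) < cosh (n * z) * sinh (n * z - 2 * \<eta>) \<longleftrightarrow> \<eta> < 0"
      by linarith+
    then show "?c2 < ?c1 \<longleftrightarrow> 0 < \<eta>" "?c1 < ?c2 \<longleftrightarrow> \<eta> < 0"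
      using cp by (simp_all add: divide_less_eq less_divide_eq mult_ac)
  qed
  have c2p: "0 < ?c2" "0 < ?c1" using cp sp by auto
  have c2: "?c2 < 1 \<longleftrightarrow> 0 < \<eta>" "1 < ?c2 \<longleftrightarrow> \<eta> < 0"
    using cp by (auto simp: divide_less_eq less_divide_eq)
  have ratio: "nu' / la = (dlt n z * ?c2 - sgm n z * ?c1) / (dlt n z * ?c2 + sgm n z * ?c1)"
    unfolding eqs[symmetric] by simp
  have cmp: "nu' / la < psi n z \<longleftrightarrow> ?c2 < ?c1" "psi n z < nu' / la \<longleftrightarrow> ?c1 < ?c2"
  proof -
    define S where "S = sgm n z" define d where "d = dlt n z"
    define c1 where "c1 = ?c1" define c2 where "c2 = ?c2"
    have p: "0 < S" "0 < d" "0 < c1" "0 < c2" using s c2p by (auto simp: S_def d_def c1_def c2_def)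
    then have q: "0 < d * c2 + S * c1" "0 < d + S" by (auto intro: add_pos_pos)
    have e: "(d * c2 - S * c1) * (d + S) - (d - S) * (d * c2 + S * c1) = 2 * S * d * (c2 - c1)"
      by (simp add: algebra_simps)
    have "nu' / la < psi n z \<longleftrightarrow> (d * c2 - S * c1) * (d + S) < (d - S) * (d * c2 + S * c1)"
      unfolding ratio psi_def S_def[symmetric] d_def[symmetric] c1_def[symmetric] c2_def[symmetric]
      using q by (simp add: divide_less_eq less_divide_eq)
    also have "\<dots> \<longleftrightarrow> 2 * S * d * (c2 - c1) < 0" using e by linarith
    also have "\<dots> \<longleftrightarrow> c2 < c1" using p by (auto simp: mult_less_0_iff zero_less_mult_iff)
    finally show "nu' / la < psi n z \<longleftrightarrow> ?c2 < ?c1" by (simp add: c1_def c2_def)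
    have "psi n z < nu' / la \<longleftrightarrow> (d - S) * (d * c2 + S * c1) < (d * c2 - S * c1) * (d + S)"
      unfolding ratio psi_def S_def[symmetric] d_def[symmetric] c1_def[symmetric] c2_def[symmetric]
      using q by (simp add: divide_less_eq less_divide_eq)
    also have "\<dots> \<longleftrightarrow> 0 < 2 * S * d * (c2 - c1)" using e by linarith
    also have "\<dots> \<longleftrightarrow> c1 < c2" using p by (auto simp: mult_less_0_iff zero_less_mult_iff)
    finally show "psi n z < nu' / la \<longleftrightarrow> ?c1 < ?c2" by (simp add: c1_def c2_def)
  qed
  have dmono: "dlt n a < dlt n b \<longleftrightarrow> a < b" if "0 < a" "0 < b" for a b
    using dlt_strict_mono[OF n, of a b] dlt_strict_mono[OF n, of b a] that by (cases a b rule: linorder_cases) auto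
  have pmono: "psi n a < psi n b \<longleftrightarrow> b < a" if "0 < a" "0 < b" for a b
    using psi_strict_antimono[OF n, of a b] psi_strict_antimono[OF n, of b a] that by (cases a b rule: linorder_cases) auto
  consider "\<eta> = 0" | "0 < \<eta>" | "\<eta> < 0" by linarith
  then show ?thesis
  proof cases
    case 1
    then have "L = 0" by (simp add: L_def)
    then have "nu' = nu" by (simp add: nu'_def)
    moreover have "?c2 = 1" using 1 n z by simp
    ultimately have "dlt n z0 = dlt n z" using eqs sum by simp
    then have "z = z0" using dmono[OF z z0] dmono[OF z0 z] by auto
    then show ?thesis using 1 by simp
  next
    case 2
    then have "1 < exp (- n * L)" using Lsgn n by (simp add: mult_pos_neg)
    then have le: "nu < nu'" using nu by (simp add: nu'_def)
    have "dlt n z0 < dlt n z * ?c2" using sum le eqs by linarith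
    also have "\<dots> < dlt n z * 1" using c2 2 s by (intro mult_strict_left_mono) auto
    finally have a: "z0 < z" using dmono[OF z0 z] by simp
    have "nu / la < nu' / la" using le nu by (intro divide_strict_right_mono)
    also have "\<dots> < psi n z" using cmp c12 2 by simp
    finally have "z < z0" using pmono[OF z0 z] psi0 by simp
    then show ?thesis using a by simp
  next
    case 3
    then have "0 < n * L" using Lsgn n by simp
    then have "exp (- n * L) < 1" by simp
    then have le: "nu' < nu" using nu by (simp add: nu'_def)
    have "dlt n z * 1 < dlt n z * ?c2" using c2 3 s by (intro mult_strict_left_mono) auto
    also have "\<dots> < dlt n z0" using sum le eqs by linarith
    finally have a: "z < z0" using dmono[OF z z0] by simp
    have "psi n z < nu' / la" using cmp c12 3 by simp
    also have "\<dots> < nu / la" using le nu by (intro divide_strict_right_mono)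
    finally have "z0 < z" using pmono[OF z z0] psi0 by simp
    then show ?thesis using a by simp
  qed
qed

text \<open>Along the symmetric pairs (tanh z, - tanh z) the derivative of \<open>dis\<close> minus
  \<open>sgm n z0\<close> times \<open>aff\<close> is a positive multiple of
  \<open>sgm n z - sgm n z0\<close>, hence negative for z < z0. The right side is the value at the
  trivial pair z = 0, so the gap makes the Lagrangian strictly positive on the diagonal.\<close>

lemma sym_gap:
  assumes \<alpha>: "1 < \<alpha>" and z0: "0 < z0"
  defines "n \<equiv> 2 * \<alpha> - 1"
  shows "dis \<alpha> (tanh z0) (- tanh z0) - sgm n z0 * aff \<alpha> (tanh z0) (- tanh z0) < - 1 - sgm n z0"
proof -
  have n: "1 < n" using \<alpha> by (simp add: n_def)
  let ?j = "\<lambda>z. (\<alpha> - 1) * cosh (2 * \<alpha> * z) - \<alpha> * cosh (2 * (\<alpha> - 1) * z) - sgm n z0 * (cosh (n * z) / cosh z)"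
  have "\<exists>\<xi>>0. \<xi> < z0 \<and> ?j z0 - ?j 0 = (z0 - 0) * ((n\<^sup>2 - 1) * cosh (n * \<xi>) * sinh \<xi> - sgm n z0 * (N2 n \<xi> / cosh \<xi> ^ 2))"
  proof (rule MVT2)
    fix z :: real
    have e: "2 * \<alpha> * z = n * z + z" "2 * (\<alpha> - 1) * z = n * z - z" by (auto simp: n_def algebra_simps)
    have d: "(n\<^sup>2 - 1) * cosh (n * z) * sinh z = 2 * \<alpha> * (\<alpha> - 1) * (sinh (2 * \<alpha> * z) - sinh (2 * (\<alpha> - 1) * z))"
      unfolding e sinh_add sinh_diff by (simp add: n_def algebra_simps power2_eq_square)
    have c0: "cosh z \<noteq> 0" by simp
    have "((\<lambda>z. cosh (n * z) / cosh z) has_real_derivative N2 n z / cosh z ^ 2) (at z)"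
      by (auto intro!: derivative_eq_intros simp: N2_def field_simps power2_eq_square)
    moreover have "((\<lambda>z. (\<alpha> - 1) * cosh (2 * \<alpha> * z) - \<alpha> * cosh (2 * (\<alpha> - 1) * z)) has_real_derivative (n\<^sup>2
        - 1) * cosh (n * z) * sinh z) (at z)"
      unfolding d by (auto intro!: derivative_eq_intros simp: algebra_simps)
    ultimately show "(?j has_real_derivative (n\<^sup>2 - 1) * cosh (n * z) * sinh z - sgm n z0 * (N2 n z / cosh z ^ 2)) (at z)"
      by (intro DERIV_diff DERIV_cmult)
  qed (use z0 in auto)
  then obtain \<xi> where \<xi>: "0 < \<xi>" "\<xi> < z0"
    "?j z0 - ?j 0 = z0 * ((n\<^sup>2 - 1) * cosh (n * \<xi>) * sinh \<xi> - sgm n z0 * (N2 n \<xi> / cosh \<xi> ^ 2))" by auto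
  have "(n\<^sup>2 - 1) * cosh (n * \<xi>) * sinh \<xi> = sgm n \<xi> * (N2 n \<xi> / cosh \<xi> ^ 2)"
    unfolding sgm_def using N2_pos[OF n \<xi>(1)] by simp
  moreover have "sgm n \<xi> < sgm n z0" by (rule sgm_strict_mono[OF n \<xi>(1,2)])
  moreover have "0 < N2 n \<xi> / cosh \<xi> ^ 2" using N2_pos[OF n \<xi>(1)] by simp
  ultimately have "(n\<^sup>2 - 1) * cosh (n * \<xi>) * sinh \<xi> - sgm n z0 * (N2 n \<xi> / cosh \<xi> ^ 2) < 0"
    using mult_strict_right_mono[of "sgm n \<xi>" "sgm n z0" "N2 n \<xi> / cosh \<xi> ^ 2"] by linarith
  then have "?j z0 - ?j 0 < 0" unfolding \<xi>(3) using z0 by (rule mult_pos_neg[rotated])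
  then show ?thesis unfolding aff_sym dis_sym by (simp add: n_def)
qed

text \<open>The minimum over the open square exists because the Lagrangian is nonnegative near its
  boundary; the unique interior critical point is the symmetric one.\<close>
lemma lagrangian_nonneg_le:
  fixes \<alpha> z0 :: real
  assumes \<alpha>: "1 < \<alpha>" and z0: "0 < z0" and xy: "\<bar>x1\<bar> < 1" "\<bar>y1\<bar> < 1" "y1 \<le> x1"
  defines "n \<equiv> 2 * \<alpha> - 1" and "t \<equiv> tanh z0"
  defines "la \<equiv> (sgm n z0 + dlt n z0) / 2" and "nu \<equiv> (dlt n z0 - sgm n z0) / 2"
  shows "dis \<alpha> t (- t) + la * (aff \<alpha> x1 y1 - aff \<alpha> t (- t)) - nu * (aff \<alpha> y1 x1 - aff \<alpha> t (- t)) \<le> dis \<alpha> x1 y1"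
proof (rule ccontr)
  assume neg: "\<not> ?thesis"
  have n: "1 < n" using \<alpha> by (simp add: n_def)
  have nu: "0 < nu" "0 < la" using sgm_pos[OF n z0] sgm_less_dlt[OF n z0] by (auto simp: nu_def la_def)
  \<comment> \<open>Normalised so that \<open>J\<close> vanishes at (t, - t); \<open>J\<close> is
    then the difference of the two sides of the claim.\<close>
  define l1 where "l1 = (la - nu) * aff \<alpha> t (- t) - dis \<alpha> t (- t)"
  define J where "J x y = dis \<alpha> x y - la * aff \<alpha> x y + nu * aff \<alpha> y x + l1" for x y
  have J1: "J x1 y1 < 0" using neg by (simp add: J_def l1_def algebra_simps)
  \<comment> \<open>The constant value of \<open>J\<close> on the diagonal x = y.\<close>
  define \<iota> where "\<iota> = l1 - 1 - (la - nu)"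
  have sg: "la - nu = sgm n z0" by (simp add: la_def nu_def field_simps)
  have \<iota>: "0 < \<iota>" using sym_gap[OF \<alpha> z0] unfolding \<iota>_def l1_def sg t_def n_def by simp
  have Jge: "(dis1 \<alpha> ((1 + x) / (1 + y)) + 1) / 2 - la * ((1 + y) / 2 * (((1 + x) / (1 + y)) powr \<alpha> - 1)) + \<iota> \<le> J x y"
    if "\<bar>x\<bar> < 1" "\<bar>y\<bar> < 1" "y \<le> x" for x y
  proof -
    define W where "W = (1 + y) / 2 * (((1 + x) / (1 + y)) powr \<alpha> - 1)"
    have "- 1 \<le> dis1 \<alpha> ((1 - x) / (1 - y))" using that \<alpha> by (intro dis1_ge) auto
    then have "(dis1 \<alpha> ((1 + x) / (1 + y)) - 1) / 2 \<le> dis \<alpha> x y" unfolding dis_def by simp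
    moreover have "la * aff \<alpha> x y \<le> la * (1 + (1 + y) / 2 * (((1 + x) / (1 + y)) powr \<alpha> - 1))"
      using aff_le[OF \<alpha> that] nu by (intro mult_left_mono) auto
    then have "la * aff \<alpha> x y \<le> la + la * W"
      unfolding W_def[symmetric] by (simp only: distrib_left mult_1_right)
    moreover have "nu * 1 \<le> nu * aff \<alpha> y x" using aff_ge_1[OF \<alpha> that(2,1)] nu by (intro mult_left_mono) auto
    ultimately show ?thesis unfolding J_def \<iota>_def W_def[symmetric] by (simp add: field_simps)
  qed
  \<comment> \<open>Two regimes for 1 + y at most \<open>e1\<close>. If
    \<open>g powr \<alpha>\<close> exceeds \<open>G\<close>, at least half of the leading term of
    \<open>dis1\<close> survives and absorbs the loss caused by \<open>aff\<close>; otherwise the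
    loss is at most \<iota>.\<close>
  define G where "G = (2 * \<alpha> / (\<alpha> - 1)) powr \<alpha>"
  define e1 where "e1 = min (min ((\<alpha> - 1) / (2 * la)) (2 * \<iota> / (la * G))) 1"
  have Gp: "0 < G" using \<alpha> by (simp add: G_def)
  have e1: "0 < e1" "la * e1 \<le> (\<alpha> - 1) / 2" "la * e1 * G \<le> 2 * \<iota>" "e1 \<le> 1"
  proof -
    show "0 < e1" using \<alpha> nu \<iota> Gp by (simp add: e1_def)
    have "e1 \<le> (\<alpha> - 1) / (2 * la)" "e1 \<le> 2 * \<iota> / (la * G)" by (auto simp: e1_def)
    then show "la * e1 \<le> (\<alpha> - 1) / 2" "la * e1 * G \<le> 2 * \<iota>"
      using nu Gp by (simp_all add: pos_le_divide_eq mult_ac)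
    show "e1 \<le> 1" by (simp add: e1_def)
  qed
  have b1: "0 \<le> J x y" if "\<bar>x\<bar> < 1" "\<bar>y\<bar> < 1" "y \<le> x" "1 + y \<le> e1" for x y
  proof -
    define g where "g = (1 + x) / (1 + y)"
    have g: "1 \<le> g" using that by (simp add: g_def)
    have d: "- 1 \<le> dis1 \<alpha> g" using g \<alpha> by (intro dis1_ge) auto
    have ga: "0 \<le> g powr \<alpha>" "1 \<le> g powr \<alpha>" using g \<alpha> by (auto intro: ge_one_powr_ge_zero)
    have ly: "la * (1 + y) \<le> la * e1" using that nu by (intro mult_left_mono) auto
    have "(1 + y) / 2 * (g powr \<alpha> - 1) \<le> (1 + y) / 2 * g powr \<alpha>" using that by (intro mult_left_mono) auto
    then have A: "la * ((1 + y) / 2 * (g powr \<alpha> - 1)) \<le> la * ((1 + y) / 2 * g powr \<alpha>)"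
      by (rule mult_left_mono) (use nu in simp)
    define P where "P = la * ((1 + y) / 2 * (g powr \<alpha> - 1))"
    define T where "T = la * e1 * g powr \<alpha>"
    have "la * ((1 + y) / 2 * g powr \<alpha>) = la * (1 + y) * g powr \<alpha> / 2" by simp
    moreover have "la * (1 + y) * g powr \<alpha> \<le> T" unfolding T_def using ly ga by (intro mult_right_mono) auto
    ultimately have PT: "P \<le> T / 2" using A unfolding P_def by linarith
    have "P \<le> (dis1 \<alpha> g + 1) / 2 + \<iota>"
    proof (cases "g powr \<alpha> \<le> G")
      case True
      then have "T \<le> la * e1 * G" unfolding T_def using nu e1 by (intro mult_left_mono) auto
      then have "T \<le> 2 * \<iota>" using e1(3) by (rule order_trans)
      moreover have "0 \<le> (dis1 \<alpha> g + 1) / 2" using d by simp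
      ultimately show ?thesis using PT by linarith
    next
      case False
      have gg: "2 * \<alpha> / (\<alpha> - 1) \<le> g"
      proof (rule ccontr)
        assume "\<not> ?thesis"
        then have "g powr \<alpha> \<le> (2 * \<alpha> / (\<alpha> - 1)) powr \<alpha>" using g \<alpha> by (intro powr_mono2) auto
        then show False using False by (simp add: G_def)
      qed
      have "g powr \<alpha> = g * g powr (\<alpha> - 1)" using g by (simp add: powr_mult_base)
      also have "\<dots> \<ge> 2 * \<alpha> / (\<alpha> - 1) * g powr (\<alpha> - 1)" using gg by (intro mult_right_mono) auto
      finally have "\<alpha> * g powr (\<alpha> - 1) \<le> (\<alpha> - 1) / 2 * g powr \<alpha>" using \<alpha> by (simp add: field_simps)
      then have "(\<alpha> - 1) / 2 * g powr \<alpha> \<le> dis1 \<alpha> g" unfolding dis1_def by (simp add: field_simps)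
      moreover have "T \<le> (\<alpha> - 1) / 2 * g powr \<alpha>" unfolding T_def using e1(2) ga by (intro mult_right_mono) auto
      ultimately have "T \<le> dis1 \<alpha> g" by (rule order_trans[rotated])
      then show ?thesis using PT \<iota> add_divide_distrib[of "dis1 \<alpha> g" 1 2] by linarith
    qed
    then show ?thesis using Jge[OF that(1-3)] unfolding P_def g_def by linarith
  qed
  \<comment> \<open>The ratio g is at most 2 / (1 + y). At the ratio \<open>c1\<close> the bound la
    (g^\<alpha> - 1) for the loss equals \<iota>, and \<open>ym\<close> is the y with 2 / (1 + y) =
    c1.\<close>
  define c1 where "c1 = (1 + \<iota> / la) powr (1 / \<alpha>)"
  define ym where "ym = 2 / c1 - 1"
  have c1: "1 < c1" "c1 powr \<alpha> = 1 + \<iota> / la"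
  proof -
    have "1 powr (1 / \<alpha>) < (1 + \<iota> / la) powr (1 / \<alpha>)" using \<iota> nu \<alpha> by (intro powr_less_mono2) auto
    then show "1 < c1" by (simp add: c1_def)
    show "c1 powr \<alpha> = 1 + \<iota> / la" using \<alpha> \<iota> nu by (simp add: c1_def powr_powr add_nonneg_nonneg)
  qed
  have ym: "ym < 1" "- 1 < ym" using c1 by (auto simp: ym_def pos_divide_less_eq)
  have b2: "0 \<le> J x y" if "\<bar>x\<bar> < 1" "\<bar>y\<bar> < 1" "y \<le> x" "ym \<le> y" for x y
  proof -
    define g where "g = (1 + x) / (1 + y)"
    have g: "1 \<le> g" using that by (simp add: g_def)
    have d: "- 1 \<le> dis1 \<alpha> g" using g \<alpha> by (intro dis1_ge) auto
    have "g \<le> 2 / (1 + y)" using that unfolding g_def by (intro divide_right_mono) auto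
    also have "\<dots> \<le> c1" using that c1 by (simp add: ym_def field_simps)
    finally have "g powr \<alpha> \<le> c1 powr \<alpha>" using g \<alpha> by (intro powr_mono2) auto
    then have ga: "0 \<le> g powr \<alpha> - 1" "g powr \<alpha> - 1 \<le> \<iota> / la"
      using c1 g \<alpha> by (auto intro: ge_one_powr_ge_zero)
    have "(1 + y) / 2 * (g powr \<alpha> - 1) \<le> 1 * (\<iota> / la)" using that ga by (intro mult_mono) auto
    then have "la * ((1 + y) / 2 * (g powr \<alpha> - 1)) \<le> la * (1 * (\<iota> / la))" using nu by (intro mult_left_mono) auto
    then have *: "la * ((1 + y) / 2 * (g powr \<alpha> - 1)) \<le> \<iota>" using nu by simp
    define P where "P = la * ((1 + y) / 2 * (g powr \<alpha> - 1))"
    have "0 \<le> (dis1 \<alpha> g + 1) / 2" using d by simp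
    then show ?thesis using Jge[OF that(1-3)] * unfolding g_def[symmetric] P_def[symmetric] by linarith
  qed
  \<comment> \<open>For y away from both ends, \<open>la * aff \<alpha> x y\<close> is at most
    \<open>la * Fm\<close>, while \<open>aff \<alpha> y x\<close> blows up as x approaches 1;
    \<open>e3\<close> is the distance 1 - x at which the lower bound for nu times the latter reaches
    \<open>B\<close>, enough to pay for all other terms.\<close>
  define Fm where "Fm = 1 + (2 / e1) powr \<alpha>"
  define B where "B = 1 + la * Fm + \<bar>l1\<bar>"
  have Bp: "0 < B" using nu by (auto simp: B_def Fm_def intro!: add_pos_nonneg mult_nonneg_nonneg)
  define e3 where "e3 = (2 * B / (nu * (1 - ym) powr \<alpha>)) powr (- 1 / (\<alpha> - 1))"
  have den: "0 < nu * (1 - ym) powr \<alpha>" using nu ym by simp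
  have e3: "0 < e3" using Bp den nu ym by (simp add: e3_def)
  have e3p: "e3 powr (1 - \<alpha>) = 2 * B / (nu * (1 - ym) powr \<alpha>)"
  proof -
    have "0 < 2 * B / (nu * (1 - ym) powr \<alpha>)" using Bp den by (intro divide_pos_pos) auto
    moreover have "- 1 / (\<alpha> - 1) * (1 - \<alpha>) = 1" using \<alpha> by (simp add: field_simps)
    ultimately show ?thesis unfolding e3_def powr_powr by (metis less_imp_le powr_one)
  qed
  have b3: "0 \<le> J x y" if "\<bar>x\<bar> < 1" "\<bar>y\<bar> < 1" "y \<le> x" "e1 \<le> 1 + y" "y \<le> ym" "1 - x \<le> e3" for x y
  proof -
    define g where "g = (1 + x) / (1 + y)"
    have g: "1 \<le> g" using that by (simp add: g_def)
    have "g \<le> 2 / e1" using that e1 unfolding g_def by (intro frac_le) auto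
    then have "g powr \<alpha> \<le> (2 / e1) powr \<alpha>" using g \<alpha> by (intro powr_mono2) auto
    moreover have "0 \<le> g powr \<alpha> - 1" using g \<alpha> by (auto intro: ge_one_powr_ge_zero)
    ultimately have "(1 + y) / 2 * (g powr \<alpha> - 1) \<le> 1 * ((2 / e1) powr \<alpha>)" using that by (intro mult_mono) auto
    then have "aff \<alpha> x y \<le> Fm" using aff_le[OF \<alpha> that(1-3)] unfolding Fm_def g_def by linarith
    then have F: "la * aff \<alpha> x y \<le> la * Fm" using nu by (intro mult_left_mono) auto
    have "(1 - ym) powr \<alpha> * e3 powr (1 - \<alpha>) \<le> (1 - y) powr \<alpha> * (1 - x) powr (1 - \<alpha>)"
      using that ym \<alpha> e3 by (intro mult_mono powr_mono2 powr_mono2') auto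
    moreover have "(1 - ym) powr \<alpha> * e3 powr (1 - \<alpha>) = 2 * (B / nu)" unfolding e3p using den nu ym by simp
    moreover have "0 \<le> (1 + y) powr \<alpha> * (1 + x) powr (1 - \<alpha>)" by simp
    ultimately have "2 * (B / nu) \<le> (1 + y) powr \<alpha> * (1 + x) powr (1 - \<alpha>) + (1 - y) powr \<alpha> * (1 - x) powr (1 - \<alpha>)"
      by linarith
    moreover have "a \<le> s / 2" if "2 * a \<le> s" for a s :: real using that by simp
    ultimately have "B / nu \<le> aff \<alpha> y x" unfolding aff_def by blast
    then have "B \<le> nu * aff \<alpha> y x" using nu by (simp add: pos_divide_le_eq mult.commute)
    moreover have "- 1 \<le> dis \<alpha> x y" by (rule dis_ge[OF \<alpha> that(1,2)])
    ultimately show ?thesis using F unfolding J_def B_def by linarith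
  qed
  have b0: "0 < J x x" if "\<bar>x\<bar> < 1" for x
    using \<iota> that by (simp add: J_def dis_diag aff_diag \<iota>_def)
  \<comment> \<open>A compact triangle. By \<open>b0\<close>, \<open>b1\<close>, \<open>b2\<close>
    and \<open>b3\<close> every point where \<open>J\<close> is negative lies in its interior, so a
    negative minimum is an interior critical point.\<close>
  define C where "C = {p :: real \<times> real. e1 - 1 \<le> snd p \<and> snd p \<le> fst p \<and> fst p \<le> 1 - e3}"
  have Cabs: "\<bar>fst p\<bar> < 1 \<and> \<bar>snd p\<bar> < 1" if "p \<in> C" for p
    using that e1 e3 by (auto simp: C_def)
  have inC: "(x, y) \<in> C \<and> e1 - 1 < y \<and> y < x \<and> x < 1 - e3"
    if "\<bar>x\<bar> < 1" "\<bar>y\<bar> < 1" "y \<le> x" "J x y < 0" for x y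
  proof -
    have "e1 - 1 < y" using b1[OF that(1-3)] that(4) by linarith
    moreover have "y < ym" using b2[OF that(1-3)] that(4) by linarith
    ultimately have "x < 1 - e3" using b3[OF that(1-3)] that(4) by linarith
    moreover have "y \<noteq> x" using b0 that by fastforce
    ultimately show ?thesis using \<open>e1 - 1 < y\<close> that by (simp add: C_def)
  qed
  have "closed C" unfolding C_def
    by (intro closed_Collect_conj closed_Collect_le continuous_intros)
  moreover have "bounded C"
  proof (rule bounded_subset)
    show "bounded (cbox (-1, -1) (1, 1) :: (real \<times> real) set)" by simp
    show "C \<subseteq> cbox (-1, -1) (1, 1)" using Cabs by (force simp: cbox_Pair_eq)
  qed
  ultimately have cpt: "compact C" by (simp add: compact_eq_bounded_closed)
  have cont: "continuous_on C (\<lambda>p. J (fst p) (snd p))"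
    unfolding J_def aff_def dis_def dis1_def
    by (intro continuous_intros) (use Cabs in \<open>force simp: abs_less_iff\<close>)+
  have "C \<noteq> {}" using inC[OF xy J1] by blast
  from continuous_attains_inf[OF cpt this cont]
  obtain p where p: "p \<in> C" "\<And>q. q \<in> C \<Longrightarrow> J (fst p) (snd p) \<le> J (fst q) (snd q)"
    by blast
  define x where "x = fst p" define y where "y = snd p"
  have abs: "\<bar>x\<bar> < 1" "\<bar>y\<bar> < 1" using Cabs[OF p(1)] by (auto simp: x_def y_def)
  have "J x y \<le> J x1 y1" using p(2)[of "(x1, y1)"] inC[OF xy J1] by (simp add: x_def y_def)
  then have Jn: "J x y < 0" using J1 by simp
  have yx: "y \<le> x" using p(1) by (simp add: C_def x_def y_def)
  note s = inC[OF abs yx Jn]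
  define d where "d = min (min (y - (e1 - 1)) (x - y)) (1 - e3 - x)"
  have d: "0 < d" using s by (simp add: d_def)
  have m1: "J x y \<le> J x' y" if "\<bar>x - x'\<bar> < d" for x'
    using p(2)[of "(x', y)"] that s by (simp add: C_def x_def[symmetric] y_def[symmetric] d_def abs_less_iff)
  have m2: "J x y \<le> J x y'" if "\<bar>y - y'\<bar> < d" for y'
    using p(2)[of "(x, y')"] that s by (simp add: C_def x_def[symmetric] y_def[symmetric] d_def abs_less_iff)
  have "((\<lambda>x. J x y) has_real_derivative (1 * disx \<alpha> x y + 0 * disy \<alpha> x y) - la * (1 * affx \<alpha> x y + 0 * affy \<alpha> x y)
      + nu * (0 * affx \<alpha> y x + 1 * affy \<alpha> y x) + 0) (at x)"
    unfolding J_def by (rule DERIV_add[OF DERIV_add[OF DERIV_diff[OF dis_deriv[where a = "\<lambda>x. x" and b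
        = "\<lambda>_. y"] DERIV_cmult[OF aff_deriv[where a = "\<lambda>x. x" and b = "\<lambda>_. y"]]] DERIV_cmult[OF aff_deriv[where a
        = "\<lambda>_. y" and b = "\<lambda>x. x"]]] DERIV_const[of l1]])
      (use abs in auto)
  from DERIV_local_min[OF this d] m1
  have c1: "disx \<alpha> x y = la * affx \<alpha> x y - nu * affy \<alpha> y x" by simp
  have "((\<lambda>y. J x y) has_real_derivative (0 * disx \<alpha> x y + 1 * disy \<alpha> x y) - la * (0 * affx \<alpha> x y + 1 * affy \<alpha> x y)
      + nu * (1 * affx \<alpha> y x + 0 * affy \<alpha> y x) + 0) (at y)"
    unfolding J_def by (rule DERIV_add[OF DERIV_add[OF DERIV_diff[OF dis_deriv[where a = "\<lambda>_. x" and b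
        = "\<lambda>y. y"] DERIV_cmult[OF aff_deriv[where a = "\<lambda>_. x" and b = "\<lambda>y. y"]]] DERIV_cmult[OF aff_deriv[where a
        = "\<lambda>y. y" and b = "\<lambda>_. x"]]] DERIV_const[of l1]])
      (use abs in auto)
  from DERIV_local_min[OF this d] m2
  have c2: "disy \<alpha> x y = la * affy \<alpha> x y - nu * affx \<alpha> y x" by simp
  obtain U V where UV: "x = tanh U" "y = tanh V" using tanh_surj[OF abs(1)] tanh_surj[OF abs(2)] by metis
  define z where "z = (U - V) / 2" define \<eta> where "\<eta> = (U + V) / 2"
  have xy': "x = tanh (\<eta> + z)" "y = tanh (\<eta> - z)"
    unfolding UV z_def \<eta>_def by (simp_all add: field_simps)
  have "V < U" using s unfolding UV by simp
  then have z: "0 < z" by (simp add: z_def)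
  have "\<eta> = 0 \<and> z = z0"
    by (rule critical_point_unique[OF \<alpha> z0 z])
      (use c1 c2 in \<open>simp_all add: xy' la_def nu_def n_def\<close>)
  then have "x = t" "y = - t" unfolding xy' t_def by simp_all
  then have "J x y = 0"
    using aff_minus[of \<alpha> t "- t"] unfolding J_def l1_def by (simp add: algebra_simps)
  then show False using Jn by simp
qed

lemma lagrangian_nonneg:
  fixes \<alpha> z0 :: real
  assumes \<alpha>: "1 < \<alpha>" and z0: "0 < z0" and xy: "\<bar>x\<bar> < 1" "\<bar>y\<bar> < 1"
  defines "n \<equiv> 2 * \<alpha> - 1" and "t \<equiv> tanh z0"
  defines "la \<equiv> (sgm n z0 + dlt n z0) / 2" and "nu \<equiv> (dlt n z0 - sgm n z0) / 2"
  shows "dis \<alpha> t (- t) + la * (aff \<alpha> x y - aff \<alpha> t (- t)) - nu * (aff \<alpha> y x - aff \<alpha> t (- t)) \<le> dis \<alpha> x y"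
proof (cases "y \<le> x")
  case True
  then show ?thesis using lagrangian_nonneg_le[OF \<alpha> z0 xy] by (simp add: n_def t_def la_def nu_def)
next
  case False
  then have "- y \<le> - x" "\<bar>- x\<bar> < 1" "\<bar>- y\<bar> < 1" using xy by auto
  then show ?thesis using lagrangian_nonneg_le[OF \<alpha> z0, of "- x" "- y"]
    by (simp add: n_def t_def la_def nu_def aff_minus dis_minus)
qed

section \<open>Binary symmetric channels\<close>

text \<open>Integrates the infinitesimal inequality along shrinking segments; \<open>r * N2 n (artanh (r * t))\<close> and
  \<open>r * N1 n (artanh (r * t))\<close> are the integrating factors for the sum and the difference.\<close>
lemma aff_contraction:
  fixes \<alpha> t \<rho> :: real
  assumes \<alpha>: "1 < \<alpha>" and t: "0 < t" "t < 1" and \<rho>: "0 \<le> \<rho>" "\<rho> \<le> 1"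
  shows "\<exists>la\<ge>0. \<exists>mu\<ge>0. \<forall>x y. \<bar>x\<bar> < 1 \<longrightarrow> \<bar>y\<bar> < 1 \<longrightarrow>
    aff \<alpha> (\<rho> * x) (\<rho> * y) \<le> aff \<alpha> (\<rho> * t) (- (\<rho> * t))
      + la * (aff \<alpha> x y - aff \<alpha> t (- t)) + mu * (aff \<alpha> y x - aff \<alpha> t (- t))"
proof (cases "\<rho> = 0")
  case True
  then show ?thesis using aff_diag[of 0 \<alpha>]
    by (rule_tac exI[of _ 0], simp, rule_tac exI[of _ 0], simp)
next
  case False
  then have \<rho>0: "0 < \<rho>" using \<rho> by simp
  define n where "n = 2 * \<alpha> - 1"
  have n: "1 < n" using \<alpha> by (simp add: n_def)
  \<comment> \<open>Shrinking (t, - t) by r gives again a symmetric pair, with hyperbolic parameter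
    \<open>zz r\<close>; the infinitesimal multipliers at scale r are those of
    \<open>zz r\<close>.\<close>
  define zz where "zz r = artanh (r * t)" for r
  have rt: "\<bar>r * t\<bar> < 1" "0 < r * t" if "0 < r" "r \<le> 1" for r
  proof -
    have "r * t \<le> 1 * t" using that t by (intro mult_right_mono) auto
    moreover have "0 < r * t" using that t by simp
    ultimately show "\<bar>r * t\<bar> < 1" "0 < r * t" using t by linarith+
  qed
  have tz: "tanh (zz r) = r * t" "0 < zz r" if "0 < r" "r \<le> 1" for r
  proof -
    note rr = rt[OF that]
    obtain u where u: "r * t = tanh u" by (rule tanh_surj[OF rr(1)])
    then have "zz r = u" by (simp add: zz_def artanh_tanh_real)
    then show "tanh (zz r) = r * t" using u by simp
    then show "0 < zz r" using rt[OF that] tanh_real_pos_iff by metis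
  qed
  have dz: "(zz has_real_derivative sinh (zz r) * cosh (zz r) / r) (at r)" if "0 < r" "r \<le> 1" for r
  proof -
    have "((\<lambda>r. artanh (r * t)) has_real_derivative 1 / (1 - (r * t)^2) * t) (at r)"
    proof (rule DERIV_chain2[where f = artanh])
      show "(artanh has_real_derivative 1 / (1 - (r * t)^2)) (at (r * t))"
        using rt[OF that] by (intro artanh_real_has_field_derivative) (auto simp: abs_less_iff)
      show "((\<lambda>r. r * t) has_real_derivative t) (at r)" by (auto intro!: derivative_eq_intros)
    qed
    moreover have "1 / (1 - (r * t)^2) * t = sinh (zz r) * cosh (zz r) / r"
    proof -
      have "1 - tanh (zz r)^2 = 1 / cosh (zz r)^2" by (rule one_minus_tanh_square)
      then have "1 / (1 - (r * t)^2) = cosh (zz r)^2" using tz[OF that] by simp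
      moreover have "t = sinh (zz r) / cosh (zz r) / r" using tz(1)[OF that] that by (simp add: tanh_def field_simps)
      ultimately show ?thesis by (simp add: power2_eq_square)
    qed
    ultimately show ?thesis by (simp add: zz_def [abs_def])
  qed
  define ws where "ws r = r * N2 n (zz r)" for r
  define wd where "wd r = r * N1 n (zz r)" for r
  define S where "S r = sgm n (zz r)" for r
  define D where "D r = dlt n (zz r)" for r
  have wp: "0 < ws r" "0 < wd r" if "0 < r" "r \<le> 1" for r
    using N1_pos[OF n] N2_pos[OF n] tz[OF that] that by (auto simp: ws_def wd_def)
  have dws: "(ws has_real_derivative ws r * (1 + S r) / r) (at r)" if "0 < r" "r \<le> 1" for r
  proof -
    have "((\<lambda>r. N2 n (zz r)) has_real_derivative (n\<^sup>2
        - 1) * cosh (zz r) * cosh (n * zz r) * (sinh (zz r) * cosh (zz r) / r)) (at r)"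
      by (rule DERIV_chain2[OF N2_deriv dz[OF that]])
    from DERIV_mult[OF DERIV_ident this] show ?thesis unfolding ws_def [abs_def] S_def sgm_def
      by (rule DERIV_cong) (use N2_pos[OF n tz(2)[OF that]] that in \<open>simp add: field_simps power2_eq_square\<close>)
  qed
  have dwd: "(wd has_real_derivative wd r * (1 + D r) / r) (at r)" if "0 < r" "r \<le> 1" for r
  proof -
    have "((\<lambda>r. N1 n (zz r)) has_real_derivative (n\<^sup>2
        - 1) * sinh (zz r) * sinh (n * zz r) * (sinh (zz r) * cosh (zz r) / r)) (at r)"
      by (rule DERIV_chain2[OF N1_deriv dz[OF that]])
    from DERIV_mult[OF DERIV_ident this] show ?thesis unfolding wd_def [abs_def] D_def dlt_def
      by (rule DERIV_cong) (use N1_pos[OF n tz(2)[OF that]] that in \<open>simp add: field_simps power2_eq_square\<close>)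
  qed
  define qs where "qs = ws \<rho> / ws 1"
  define qd where "qd = wd \<rho> / wd 1"
  have q: "0 < qs" "0 < qd" using wp[of \<rho>] wp[of 1] \<rho>0 \<rho> by (auto simp: qs_def qd_def)
  \<comment> \<open>This is the sign of the second multiplier. N1 / N2 grows with z by
    \<open>quotient_strict_mono\<close>, because the derivatives have quotient tanh z tanh (n
    z).\<close>
  have qq: "qd \<le> qs"
  proof (cases "\<rho> = 1")
    case True
    then show ?thesis using wp[of 1] by (simp add: qs_def qd_def)
  next
    case False
    have "zz \<rho> < zz 1"
    proof -
      have "tanh (zz \<rho>) < tanh (zz 1)" using tz(1)[of \<rho>] tz(1)[of 1] \<rho>0 \<rho> False t by simp
      then show ?thesis by simp
    qed
    have "N1 n (zz \<rho>) / N2 n (zz \<rho>) < N1 n (zz 1) / N2 n (zz 1)"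
    proof (rule quotient_strict_mono[OF N1_deriv N2_deriv])
      fix x y :: real assume xy: "0 < x" "x < y"
      have e: "(n\<^sup>2 - 1) * sinh z * sinh (n * z) / ((n\<^sup>2 - 1) * cosh z * cosh (n * z)) = tanh z * tanh (n * z)" for z
        using n2_pos[OF n] by (simp add: tanh_def)
      have "tanh x * tanh (n * x) < tanh y * tanh (n * y)"
        using xy n by (intro mult_strict_mono) auto
      then show "(n\<^sup>2 - 1) * sinh x * sinh (n * x) / ((n\<^sup>2 - 1) * cosh x * cosh (n * x))
         < (n\<^sup>2 - 1) * sinh y * sinh (n * y) / ((n\<^sup>2 - 1) * cosh y * cosh (n * y))" unfolding e .
    qed (use \<open>zz \<rho> < zz 1\<close> tz(2)[of \<rho>] \<rho>0 \<rho> n n2_pos[OF n] in \<open>auto simp: N2_def\<close>)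
    then show ?thesis using N1_pos[OF n] N2_pos[OF n] tz(2)[of \<rho>] tz(2)[of 1] \<rho>0 \<rho>
      by (simp add: qs_def qd_def ws_def wd_def divide_simps mult.commute)
  qed
  have main: "aff \<alpha> (\<rho> * x) (\<rho> * y) - aff \<alpha> (\<rho> * t) (- (\<rho> * t)) \<le>
      (qs + qd) / 2 * (aff \<alpha> x y - aff \<alpha> t (- t)) + (qs - qd) / 2 * (aff \<alpha> y x - aff \<alpha> t (- t))"
    if xy: "\<bar>x\<bar> < 1" "\<bar>y\<bar> < 1" for x y
  proof -
    \<comment> \<open>The excess over the symmetric pair at scale r. By \<open>aff_euler\<close>, r
      times its derivative is the excess plus the corresponding difference of \<open>dis\<close>,
      which \<open>lagrangian_nonneg\<close> at \<open>zz r\<close> bounds from below.\<close>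
    define e where "e x y r = aff \<alpha> (r * x) (r * y) - aff \<alpha> (r * t) (- (r * t))" for x y r
    have "\<exists>d. (e x y has_real_derivative d) (at r) \<and>
        (1 + (S r + D r) / 2) * e x y r - (D r - S r) / 2 * e y x r \<le> r * d"
      if xy: "\<bar>x\<bar> < 1" "\<bar>y\<bar> < 1" and r: "0 < r" "r \<le> 1" for x y r
    proof -
      have rx: "\<bar>r * x\<bar> < 1" "\<bar>r * y\<bar> < 1" "\<bar>- (r * t)\<bar> < 1"
      proof -
        have "\<bar>r * w\<bar> < 1" if "\<bar>w\<bar> < 1" for w
        proof -
          have "r * \<bar>w\<bar> \<le> 1 * \<bar>w\<bar>" using r by (intro mult_right_mono) auto
          then show ?thesis using that r by (simp add: abs_mult)
        qed
        then show "\<bar>r * x\<bar> < 1" "\<bar>r * y\<bar> < 1" "\<bar>- (r * t)\<bar> < 1" using xy rt(1)[OF r] by auto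
      qed
      note rt' = rt(1)[OF r]
      let ?d = "x * affx \<alpha> (r * x) (r * y) + y * affy \<alpha> (r * x) (r * y)
        - (t * affx \<alpha> (r * t) (- (r * t)) + (- t) * affy \<alpha> (r * t) (- (r * t)))"
      have "(e x y has_real_derivative ?d) (at r)"
        unfolding e_def [abs_def]
        by (intro DERIV_diff aff_deriv rx rt') (auto intro!: derivative_eq_intros)
      moreover have "r * ?d = e x y r + (dis \<alpha> (r * x) (r * y) - dis \<alpha> (r * t) (- (r * t)))"
        using aff_euler[OF rx(1,2), of \<alpha>] aff_euler[OF rt' rx(3), of \<alpha>] unfolding e_def by (simp add: algebra_simps)
      moreover have "dis \<alpha> (r * t) (- (r * t)) + (S r + D r) / 2 * e x y r - (D r - S r) / 2 * e y x r
          \<le> dis \<alpha> (r * x) (r * y)"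
        using lagrangian_nonneg[OF \<alpha> tz(2)[OF r] rx(1,2)] unfolding e_def S_def D_def tz(1)[OF r] n_def .
      ultimately show ?thesis by (intro exI[of _ ?d]) (simp add: algebra_simps)
    qed
    note step = this
    have step1: "\<exists>d. (e x y has_real_derivative d) (at r) \<and>
        (1 + (S r + D r) / 2) * e x y r - (D r - S r) / 2 * e y x r \<le> r * d" if "0 < r" "r \<le> 1" for r
      by (rule step[OF xy that])
    have step2: "\<exists>d. (e y x has_real_derivative d) (at r) \<and>
        (1 + (S r + D r) / 2) * e y x r - (D r - S r) / 2 * e x y r \<le> r * d" if "0 < r" "r \<le> 1" for r
      by (rule step[OF xy(2,1) that])
    \<comment> \<open>In the sum of the two excesses the coefficients combine to 1 + S, so the sum
      over \<open>ws\<close> is nondecreasing in r. This bounds the reversed excess at every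
      scale.\<close>
    define s where "s r = (e x y r + e y x r) / ws r" for r
    have s_le: "s r \<le> s 1" if r: "0 < r" "r \<le> 1" for r
    proof (rule DERIV_nonneg_imp_nondecreasing[where f = s])
      fix v assume v: "r \<le> v" "v \<le> 1"
      then have v0: "0 < v" using r by simp
      obtain d1 where d1: "(e x y has_real_derivative d1) (at v)"
        "(1 + (S v + D v) / 2) * e x y v - (D v - S v) / 2 * e y x v \<le> v * d1" using step1[OF v0 v(2)] by blast
      obtain d2 where d2: "(e y x has_real_derivative d2) (at v)"
        "(1 + (S v + D v) / 2) * e y x v - (D v - S v) / 2 * e x y v \<le> v * d2" using step2[OF v0 v(2)] by blast
      note w = wp(1)[OF v0 v(2)]
      let ?d = "((d1 + d2) * ws v - (e x y v + e y x v) * (ws v * (1 + S v) / v)) / (ws v * ws v)"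
      have "(s has_real_derivative ?d) (at v)" unfolding s_def [abs_def]
        by (intro DERIV_divide DERIV_add d1 d2 dws v0 v) (use w in simp)
      moreover have "0 \<le> ?d"
      proof -
        have "(e x y v + e y x v) * (1 + S v) \<le> v * (d1 + d2)"
          using d1(2) d2(2) by (simp add: field_simps)
        then have "ws v / v * ((e x y v + e y x v) * (1 + S v)) \<le> ws v / v * (v * (d1 + d2))"
          using w v0 by (intro mult_left_mono) auto
        then have "(e x y v + e y x v) * (ws v * (1 + S v) / v) \<le> (d1 + d2) * ws v"
          using v0 by (simp add: mult_ac)
        then show ?thesis by simp
      qed
      ultimately show "\<exists>d. (s has_real_derivative d) (at v) \<and> 0 \<le> d" by blast
    qed (use r in simp)
    \<comment> \<open>Replacing the reversed excess by its bound leaves a scalar inequality with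
      rate 1 + D, of which \<open>s 1 / 2 * ws\<close> is a particular solution; after subtracting
      it, \<open>wd\<close> is the integrating factor.\<close>
    define f where "f r = (e x y r - s 1 / 2 * ws r) / wd r" for r
    have "f \<rho> \<le> f 1"
    proof (rule DERIV_nonneg_imp_nondecreasing[where f = f])
      fix v assume v: "\<rho> \<le> v" "v \<le> 1"
      then have v0: "0 < v" using \<rho>0 by simp
      obtain d1 where d1: "(e x y has_real_derivative d1) (at v)"
        "(1 + (S v + D v) / 2) * e x y v - (D v - S v) / 2 * e y x v \<le> v * d1" using step1[OF v0 v(2)] by blast
      note w = wp[OF v0 v(2)]
      let ?d = "((d1 - s 1 / 2 * (ws v * (1 + S v) / v)) * wd v - (e x y v - s 1 / 2 * ws v) * (wd v * (1
          + D v) / v)) / (wd v * wd v)"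
      have "(f has_real_derivative ?d) (at v)" unfolding f_def [abs_def]
        by (intro DERIV_divide DERIV_diff DERIV_cmult d1 dws dwd v0 v) (use w in simp)
      moreover have "0 \<le> ?d"
      proof -
        have "e x y v + e y x v \<le> s 1 * ws v"
          using s_le[OF v0 v(2)] w by (simp add: s_def[of v] pos_divide_le_eq)
        moreover have "0 \<le> (D v - S v) / 2"
          using sgm_less_dlt[OF n tz(2)[OF v0 v(2)]] by (simp add: S_def D_def)
        ultimately have "(D v - S v) / 2 * (e x y v + e y x v) \<le> (D v - S v) / 2 * (s 1 * ws v)"
          by (rule mult_left_mono)
        then have ineq: "s 1 / 2 * ws v * (1 + S v) + (e x y v - s 1 / 2 * ws v) * (1 + D v) \<le> v * d1"
          using d1(2) by (simp add: field_simps)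
        define k where "k = wd v / v"
        have k: "wd v * (1 + D v) / v = k * (1 + D v)" "ws v * (1 + S v) / v * wd v
            = k * (ws v * (1 + S v))" "d1 * wd v = k * (v * d1)"
          using v0 by (simp_all add: k_def)
        have "0 \<le> k" using w v0 by (simp add: k_def)
        with ineq have "k * (s 1 / 2 * ws v * (1 + S v) + (e x y v - s 1 / 2 * ws v) * (1 + D v)) \<le> k * (v * d1)"
          by (rule mult_left_mono)
        then have "(e x y v - s 1 / 2 * ws v) * (wd v * (1 + D v) / v) + s 1 / 2 * (ws v * (1 + S v) / v * wd v) \<le> d1 * wd v"
          unfolding k by (simp add: algebra_simps add_divide_distrib)
        then have "0 \<le> (d1 - s 1 / 2 * (ws v * (1 + S v) / v)) * wd v - (e x y v - s 1 / 2 * ws v) * (wd v * (1 + D v) / v)"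
          by (simp only: left_diff_distrib[of d1] mult.assoc)
        then show ?thesis by (intro divide_nonneg_nonneg) auto
      qed
      ultimately show "\<exists>d. (f has_real_derivative d) (at v) \<and> 0 \<le> d" by blast
    qed (use \<rho> in simp)
    then have "e x y \<rho> - s 1 / 2 * ws \<rho> \<le> wd \<rho> * ((e x y 1 - s 1 / 2 * ws 1) / wd 1)"
      using wp(2)[OF \<rho>0 \<rho>(2)] by (simp add: f_def pos_divide_le_eq mult.commute)
    moreover have "s 1 * ws 1 = e x y 1 + e y x 1" using wp(1)[of 1] by (simp add: s_def)
    moreover have "s 1 * ws \<rho> = qs * (e x y 1 + e y x 1)" by (simp add: s_def qs_def)
    ultimately have "e x y \<rho> - qs * (e x y 1 + e y x 1) / 2 \<le> qd * (e x y 1 - (e x y 1 + e y x 1) / 2)"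
      by (simp add: qd_def)
    then show ?thesis by (simp add: e_def field_simps)
  qed
  show ?thesis
    using main q qq by (intro exI[of _ "(qs + qd) / 2"] conjI exI[of _ "(qs - qd) / 2"]) (auto simp: algebra_simps)
qed

section \<open>Bernoulli vectors and the two corners\<close>

lemma sum_prod_fun:
  fixes f :: "'k::finite \<Rightarrow> 'n::finite \<Rightarrow> bool \<Rightarrow> real"
  shows "(\<Sum>\<omega>\<in>UNIV. \<Prod>j\<in>UNIV. \<Prod>i\<in>UNIV. f j i (\<omega> j i)) = (\<Prod>j\<in>UNIV. \<Prod>i\<in>UNIV. f j i True + f j i False)"
proof -
  have pi: "PiE UNIV (\<lambda>_. UNIV) = (UNIV :: ('a \<Rightarrow> 'b) set)"
    by (auto simp: PiE_def extensional_def)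
  have 1: "(\<Prod>i\<in>UNIV. f j i True + f j i False) = (\<Sum>\<eta>\<in>UNIV. \<Prod>i\<in>UNIV. f j i (\<eta> i))" for j
  proof -
    have "(\<Prod>i\<in>UNIV. f j i True + f j i False) = (\<Prod>i\<in>UNIV. \<Sum>b\<in>UNIV. f j i b)"
      by (simp add: UNIV_bool add.commute)
    also have "\<dots> = (\<Sum>\<eta>\<in>UNIV. \<Prod>i\<in>UNIV. f j i (\<eta> i))"
      by (subst prod_sum_PiE) (simp_all add: pi)
    finally show ?thesis .
  qed
  show ?thesis
    unfolding 1 by (subst prod_sum_PiE) (simp_all add: pi)
qed

section \<open>Likelihoods of bit matrices\<close>

definition bern :: "real^'n \<Rightarrow> ('k::finite \<Rightarrow> 'n \<Rightarrow> bool) \<Rightarrow> real" where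
  "bern x \<omega> = (\<Prod>j\<in>UNIV. \<Prod>i\<in>UNIV. if \<omega> j i then x $ i else 1 - x $ i)"

abbreviation corner :: "real \<Rightarrow> ('k::finite \<Rightarrow> 'n::finite \<Rightarrow> bool) \<Rightarrow> real" where
  "corner c \<equiv> bern (\<chi> i. c)"

lemma bern_nonneg: "(\<And>i. 0 \<le> x $ i \<and> x $ i \<le> 1) \<Longrightarrow> 0 \<le> bern x \<omega>"
  unfolding bern_def by (intro prod_nonneg) auto

lemma bern_le_1: "(\<And>i. 0 \<le> x $ i \<and> x $ i \<le> 1) \<Longrightarrow> bern x \<omega> \<le> 1"
  unfolding bern_def by (intro prod_le_1 conjI prod_nonneg) auto

lemma bern_sum: "(\<Sum>\<omega>\<in>UNIV. bern x \<omega>) = 1"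
  unfolding bern_def using sum_prod_fun[of "\<lambda>j i b. if b then x $ i else 1 - x $ i"] by simp

lemma corner_flip: "corner c (\<lambda>j i. \<not> \<omega> j i) = corner (1 - c) \<omega>"
  unfolding bern_def by (intro prod.cong) auto

text \<open>Both rows \<open>bern x\<close>, \<open>bern x'\<close> arise from the two opposite corners through one channel, which acts
  on every bit separately.\<close>
lemma corner_channel:
  fixes x x' :: "real^'n"
  assumes c: "0 \<le> c" "c < 1/2" and x: "\<And>i. c \<le> x $ i \<and> x $ i \<le> 1 - c" and x': "\<And>i. c \<le> x' $ i \<and> x' $ i \<le> 1 - c"
  obtains T :: "('k::finite \<Rightarrow> 'n \<Rightarrow> bool) \<Rightarrow> ('k \<Rightarrow> 'n \<Rightarrow> bool) \<Rightarrow> real" where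
    "\<And>\<omega> \<zeta>. 0 \<le> T \<omega> \<zeta>" "\<And>\<zeta>. (\<Sum>\<omega>\<in>UNIV. T \<omega> \<zeta>) = 1"
    "\<And>\<omega>. (\<Sum>\<zeta>\<in>UNIV. T \<omega> \<zeta> * corner (1 - c) \<zeta>) = bern x \<omega>"
    "\<And>\<omega>. (\<Sum>\<zeta>\<in>UNIV. T \<omega> \<zeta> * corner c \<zeta>) = bern x' \<omega>"
proof -
  \<comment> \<open>The channel sends a bit 1 to 1 with probability \<open>s i\<close> and a bit 0
    to 1 with probability \<open>r i\<close>. These solve s (1 - c) + r c = x and s c + r (1 - c) =
    x'; the box bounds put them in [0, 1].\<close>
  define s where "s i = ((1 - c) * x $ i - c * x' $ i) / (1 - 2 * c)" for i
  define r where "r i = ((1 - c) * x' $ i - c * x $ i) / (1 - 2 * c)" for i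
  have d: "0 < 1 - 2 * c" using c by simp
  have num: "0 \<le> (1 - c) * a - c * b \<and> (1 - c) * a - c * b \<le> 1 - 2 * c" if "c \<le> a" "a \<le> 1 - c" "c \<le> b" "b \<le> 1 - c" for a b
  proof -
    have "(1 - c) * c \<le> (1 - c) * a" "c * b \<le> c * (1 - c)" "(1 - c) * a \<le> (1 - c) * (1 - c)" "c * c \<le> c * b"
      using that c by (auto intro!: mult_left_mono)
    then show ?thesis by (simp add: algebra_simps)
  qed
  have sr: "0 \<le> s i" "s i \<le> 1" "0 \<le> r i" "r i \<le> 1" for i
    using num[of "x $ i" "x' $ i"] num[of "x' $ i" "x $ i"] x[of i] x'[of i] d by (auto simp: s_def r_def)
  have srx: "s i * (1 - c) + r i * c = x $ i" "s i * c + r i * (1 - c) = x' $ i" for i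
  proof -
    have S: "s i * (1 - 2 * c) = (1 - c) * x $ i - c * x' $ i" "r i * (1 - 2 * c) = (1 - c) * x' $ i - c * x $ i"
      using d by (simp_all add: s_def r_def)
    have gen: "(s' * u + r' * v) * e = u * (s' * e) + v * (r' * e)" for s' u r' v e :: real
      by (simp add: algebra_simps)
    have "(s i * (1 - c) + r i * c) * (1 - 2 * c) = (1 - c) * (s i * (1 - 2 * c)) + c * (r i * (1 - 2 * c))"
      "(s i * c + r i * (1 - c)) * (1 - 2 * c) = c * (s i * (1 - 2 * c)) + (1 - c) * (r i * (1 - 2 * c))"
      using gen[of "s i" "1 - c" "r i" c] gen[of "s i" c "r i" "1 - c"] by simp_all
    then have "(s i * (1 - c) + r i * c) * (1 - 2 * c) = x $ i * (1 - 2 * c)"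
      "(s i * c + r i * (1 - c)) * (1 - 2 * c) = x' $ i * (1 - 2 * c)"
      unfolding S by (simp_all add: algebra_simps)
    then show "s i * (1 - c) + r i * c = x $ i" "s i * c + r i * (1 - c) = x' $ i" using d by simp_all
  qed
  define u where "u i b b0 = (if b0 then (if b then s i else 1 - s i) else (if b then r i else 1
      - r i))" for i and b b0 :: bool
  define T where "T \<omega> \<zeta> = (\<Prod>j\<in>UNIV. \<Prod>i\<in>UNIV. u i (\<omega> j i) (\<zeta> j i))" for \<omega> \<zeta> :: "'k \<Rightarrow> 'n \<Rightarrow> bool"
  show ?thesis
  proof (rule that[of T])
    show "0 \<le> T \<omega> \<zeta>" for \<omega> \<zeta> unfolding T_def u_def using sr by (intro prod_nonneg) auto
    show "(\<Sum>\<omega>\<in>UNIV. T \<omega> \<zeta>) = 1" for \<zeta>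
    proof -
      have "u i True b0 + u i False b0 = 1" for i b0 by (simp add: u_def)
      then show ?thesis unfolding T_def using sum_prod_fun[of "\<lambda>j i b. u i b (\<zeta> j i)"] by simp
    qed
    have e: "(\<Sum>\<zeta>\<in>UNIV. T \<omega> \<zeta> * corner a \<zeta>) = (\<Prod>j\<in>UNIV. \<Prod>i\<in>UNIV. u i (\<omega> j i) True * a + u i (\<omega> j i) False * (1 - a))" for a \<omega>
      unfolding T_def bern_def vec_lambda_beta prod.distrib[symmetric]
      using sum_prod_fun[of "\<lambda>j i b. u i (\<omega> j i) b * (if b then a else 1 - a)"] by simp
    show "(\<Sum>\<zeta>\<in>UNIV. T \<omega> \<zeta> * corner (1 - c) \<zeta>) = bern x \<omega>" for \<omega>
      by (subst e, subst bern_def, intro prod.cong refl) (use srx(1) in \<open>auto simp: u_def algebra_simps\<close>)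
    show "(\<Sum>\<zeta>\<in>UNIV. T \<omega> \<zeta> * corner c \<zeta>) = bern x' \<omega>" for \<omega>
      by (subst e, subst bern_def, intro prod.cong refl) (use srx(2) in \<open>auto simp: u_def algebra_simps\<close>)
  qed
qed

text \<open>The contribution of one outcome to exp ((\<alpha> - 1) R_\<alpha>). At b = 0 the
  convention for \<open>powr\<close> makes it 0, the right value as long as a = 0 there too.\<close>

definition hel :: "real \<Rightarrow> real \<Rightarrow> real \<Rightarrow> real" where
  "hel \<alpha> a b = a powr \<alpha> * b powr (1 - \<alpha>)"

definition mix :: "real \<Rightarrow> real \<Rightarrow> real \<Rightarrow> real" where
  "mix p a b = p * a + (1 - p) * b"

text \<open>Data processing: the tangent inequality is applied at each corner outcome and averaged
  over the channel \<open>T\<close>, whose columns sum to 1. The ratios h are arbitrary because they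
  will be the output ratios of the whole pair of laws, not those of the two points.\<close>

lemma bern_pair_le_corner:
  fixes x x' :: "real^'n" and h :: "('k::finite \<Rightarrow> 'n \<Rightarrow> bool) \<Rightarrow> real"
  assumes \<alpha>: "1 < \<alpha>" and c: "0 \<le> c" "c < 1/2"
    and x: "\<And>i. c \<le> x $ i \<and> x $ i \<le> 1 - c" and x': "\<And>i. c \<le> x' $ i \<and> x' $ i \<le> 1 - c"
    and pq: "0 < p" "p < 1" "0 < q" "q < 1" and h: "\<And>\<omega>. 0 \<le> h \<omega>"
  shows "(\<Sum>\<omega>\<in>UNIV. \<alpha> * h \<omega> powr (\<alpha> - 1) * mix p (bern x \<omega>) (bern x' \<omega>) - (\<alpha> - 1) * h \<omega> powr \<alpha> * mix q (bern x \<omega>) (bern x' \<omega>))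
    \<le> (\<Sum>\<zeta>\<in>(UNIV :: ('k \<Rightarrow> 'n \<Rightarrow> bool) set). hel \<alpha> (mix p (corner (1 - c) \<zeta>) (corner c \<zeta>)) (mix q (corner (1
        - c) \<zeta>) (corner c \<zeta>)))"
proof -
  obtain T :: "('k \<Rightarrow> 'n \<Rightarrow> bool) \<Rightarrow> ('k \<Rightarrow> 'n \<Rightarrow> bool) \<Rightarrow> real" where T:
    "\<And>\<omega> \<zeta>. 0 \<le> T \<omega> \<zeta>" "\<And>\<zeta>. (\<Sum>\<omega>\<in>UNIV. T \<omega> \<zeta>) = 1"
    "\<And>\<omega>. (\<Sum>\<zeta>\<in>UNIV. T \<omega> \<zeta> * corner (1 - c) \<zeta>) = bern x \<omega>"
    "\<And>\<omega>. (\<Sum>\<zeta>\<in>UNIV. T \<omega> \<zeta> * corner c \<zeta>) = bern x' \<omega>"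
    by (rule corner_channel[OF c x x']) (rule that; assumption)
  define A where "A r \<zeta> = mix r (corner (1 - c) \<zeta>) (corner c \<zeta>)" for r and \<zeta> :: "'k \<Rightarrow> 'n \<Rightarrow> bool"
  have TA: "mix r (bern x \<omega>) (bern x' \<omega>) = (\<Sum>\<zeta>\<in>UNIV. T \<omega> \<zeta> * A r \<zeta>)" for r \<omega>
    unfolding T(3,4)[symmetric] A_def mix_def
    by (simp add: distrib_left sum.distrib sum_distrib_left mult.left_commute)
  have cn: "0 \<le> corner (1 - c) \<zeta>" "0 \<le> corner c \<zeta>" for \<zeta> :: "'k \<Rightarrow> 'n \<Rightarrow> bool"
    using c by (auto intro!: bern_nonneg)
  have young: "\<alpha> * h \<omega> powr (\<alpha> - 1) * A p \<zeta> - (\<alpha> - 1) * h \<omega> powr \<alpha> * A q \<zeta> \<le> hel \<alpha> (A p \<zeta>) (A q \<zeta>)" for \<omega> \<zeta>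
  \<comment> \<open>For c = 0 an outcome can be impossible at both corners; then both sides
    vanish.\<close>
  proof (cases "corner (1 - c) \<zeta> = 0 \<and> corner c \<zeta> = 0")
    case True
    then show ?thesis using \<alpha> by (simp add: A_def mix_def hel_def)
  next
    case False
    have m: "0 < A r \<zeta>" if "0 < r" "r < 1" for r
      using False cn[of \<zeta>] that unfolding A_def mix_def
      by (cases "corner (1 - c) \<zeta> = 0") (auto intro!: add_nonneg_pos add_pos_nonneg)
    show ?thesis unfolding hel_def using m[of p] m[of q] pq h \<alpha> by (intro Young_powr) auto
  qed
  have "(\<Sum>\<omega>\<in>UNIV. \<alpha> * h \<omega> powr (\<alpha> - 1) * mix p (bern x \<omega>) (bern x' \<omega>) - (\<alpha> - 1) * h \<omega> powr \<alpha> * mix q (bern x \<omega>) (bern x' \<omega>))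
    = (\<Sum>\<omega>\<in>UNIV. \<Sum>\<zeta>\<in>UNIV. T \<omega> \<zeta> * (\<alpha> * h \<omega> powr (\<alpha> - 1) * A p \<zeta> - (\<alpha> - 1) * h \<omega> powr \<alpha> * A q \<zeta>))"
    unfolding TA by (simp add: sum_distrib_left sum_subtractf right_diff_distrib mult_ac)
  also have "\<dots> \<le> (\<Sum>\<omega>\<in>UNIV. \<Sum>\<zeta>\<in>UNIV. T \<omega> \<zeta> * hel \<alpha> (A p \<zeta>) (A q \<zeta>))"
    by (intro sum_mono mult_left_mono young T)
  also have "\<dots> = (\<Sum>\<zeta>\<in>UNIV. (\<Sum>\<omega>\<in>UNIV. T \<omega> \<zeta>) * hel \<alpha> (A p \<zeta>) (A q \<zeta>))"
    by (subst sum.swap) (simp add: sum_distrib_right)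
  finally show ?thesis by (simp add: T(2) A_def)
qed

text \<open>An outcome and its complement together have mass a + b under either corner, with a and b
  the two corner likelihoods; each of them receives half of it. Given this pair of outcomes, the
  corners act as a binary symmetric channel with factor \<bar>a - b\<bar> / (a + b).\<close>

definition corner_weight :: "real \<Rightarrow> ('k::finite \<Rightarrow> 'n::finite \<Rightarrow> bool) \<Rightarrow> real" where
  "corner_weight c \<zeta> = (corner (1 - c) \<zeta> + corner c \<zeta>) / 2"
definition corner_bias :: "real \<Rightarrow> ('k::finite \<Rightarrow> 'n::finite \<Rightarrow> bool) \<Rightarrow> real" where
  "corner_bias c \<zeta> = (corner (1 - c) \<zeta> - corner c \<zeta>) / (corner (1 - c) \<zeta> + corner c \<zeta>)"

text \<open>Pairing each outcome with its complement turns the two corners into a mixture of binary symmetric channels.\<close>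
lemma corner_hel_sum:
  fixes c :: real
  assumes \<alpha>: "1 < \<alpha>" and c: "0 \<le> c" "c < 1/2" and xy: "\<bar>x\<bar> < 1" "\<bar>y\<bar> < 1"
  shows "(\<Sum>\<zeta>\<in>(UNIV :: ('k::finite \<Rightarrow> 'n::finite \<Rightarrow> bool) set).
       hel \<alpha> (mix ((1 + x) / 2) (corner (1 - c) \<zeta>) (corner c \<zeta>)) (mix ((1 + y) / 2) (corner (1 - c) \<zeta>) (corner c \<zeta>)))
     = (\<Sum>\<zeta>\<in>(UNIV :: ('k \<Rightarrow> 'n \<Rightarrow> bool) set). corner_weight c \<zeta> * aff \<alpha> (\<bar>corner_bias c \<zeta>\<bar> * x) (\<bar>corner_bias c \<zeta>\<bar> * y))"
proof -
  define H where "H \<zeta> = hel \<alpha> (mix ((1 + x) / 2) (corner (1 - c) \<zeta>) (corner c \<zeta>)) (mix ((1 + y) / 2) (corner (1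
      - c) \<zeta>) (corner c \<zeta>))"
    for \<zeta> :: "'k \<Rightarrow> 'n \<Rightarrow> bool"
  have "bij (\<lambda>(\<zeta> :: 'k \<Rightarrow> 'n \<Rightarrow> bool) j i. \<not> \<zeta> j i)"
    by (rule involuntory_imp_bij) simp
  then have "sum H UNIV = (\<Sum>\<zeta>\<in>UNIV. H (\<lambda>j i. \<not> \<zeta> j i))"
    by (intro sum.reindex_bij_betw[symmetric])
  then have "sum H UNIV = (\<Sum>\<zeta>\<in>UNIV. (H \<zeta> + H (\<lambda>j i. \<not> \<zeta> j i)) / 2)"
    by (simp add: sum.distrib flip: sum_divide_distrib)
  also have "\<dots> = (\<Sum>\<zeta>\<in>(UNIV :: ('k \<Rightarrow> 'n \<Rightarrow> bool) set). corner_weight c \<zeta> * aff \<alpha> (\<bar>corner_bias c \<zeta>\<bar> * x)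
      (\<bar>corner_bias c \<zeta>\<bar> * y))"
  proof (rule sum.cong[OF refl])
    fix \<zeta> :: "'k \<Rightarrow> 'n \<Rightarrow> bool"
    define a where "a = corner (1 - c) \<zeta>"
    define b where "b = corner c \<zeta>"
    define r where "r = (a - b) / (a + b)"
    have ab: "0 \<le> a" "0 \<le> b" using c by (auto simp: a_def b_def intro!: bern_nonneg)
    have fl: "corner c (\<lambda>j i. \<not> \<zeta> j i) = a" "corner (1 - c) (\<lambda>j i. \<not> \<zeta> j i) = b"
      unfolding corner_flip a_def b_def by simp_all
    have H: "H \<zeta> = hel \<alpha> (mix ((1 + x) / 2) a b) (mix ((1 + y) / 2) a b)"
      "H (\<lambda>j i. \<not> \<zeta> j i) = hel \<alpha> (mix ((1 + x) / 2) b a) (mix ((1 + y) / 2) b a)"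
      unfolding H_def fl a_def b_def by simp_all
    have "(H \<zeta> + H (\<lambda>j i. \<not> \<zeta> j i)) / 2 = (a + b) / 2 * aff \<alpha> (r * x) (r * y)"
    proof (cases "a + b = 0")
      case True
      then have "a = 0" "b = 0" using ab by auto
      then show ?thesis using \<alpha> unfolding H by (simp add: mix_def hel_def)
    next
      case False
      then have w: "0 < (a + b) / 2" using ab by simp
      have hom: "hel \<alpha> (k * u) (k * v) = k * hel \<alpha> u v" if "0 < k" "0 \<le> u" "0 \<le> v" for k u v
      proof -
        have "k powr \<alpha> * k powr (1 - \<alpha>) = k" using that by (simp flip: powr_add)
        then show ?thesis using that unfolding hel_def by (simp add: powr_mult mult_ac)
      qed
      have m: "mix ((1 + z) / 2) a b = (a + b) / 2 * (1 + r * z)" "mix ((1 + z) / 2) b a = (a + b) / 2 * (1 - r * z)" for z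
        using False by (simp_all add: mix_def r_def field_simps)
      have "\<bar>r\<bar> \<le> 1" using ab False by (simp add: r_def abs_le_iff divide_le_eq_1 le_divide_eq)
      then have rz: "\<bar>r * z\<bar> \<le> 1" if "\<bar>z\<bar> < 1" for z using that by (simp add: abs_mult mult_le_one)
      have e1: "hel \<alpha> ((a + b) / 2 * (1 + r * x)) ((a + b) / 2 * (1 + r * y)) = (a + b) / 2 * hel \<alpha> (1 + r * x) (1 + r * y)"
        by (rule hom[OF w]) (use rz[OF xy(1)] rz[OF xy(2)] in \<open>simp_all add: abs_le_iff\<close>)
      have e2: "hel \<alpha> ((a + b) / 2 * (1 - r * x)) ((a + b) / 2 * (1 - r * y)) = (a + b) / 2 * hel \<alpha> (1 - r * x) (1 - r * y)"
        by (rule hom[OF w]) (use rz[OF xy(1)] rz[OF xy(2)] in \<open>simp_all add: abs_le_iff\<close>)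
      have "(W * X + W * Y) / 2 = W * ((X + Y) / 2)" for W X Y :: real by (simp add: distrib_left)
      then show ?thesis unfolding H m e1 e2 unfolding hel_def aff_def .
    qed
    \<comment> \<open>The sign of the bias only exchanges the two outcomes of the coin.\<close>
    also have "aff \<alpha> (r * x) (r * y) = aff \<alpha> (\<bar>r\<bar> * x) (\<bar>r\<bar> * y)"
      using aff_minus[of \<alpha> "r * x" "r * y"] by (simp add: abs_if)
    finally show "(H \<zeta> + H (\<lambda>j i. \<not> \<zeta> j i)) / 2 = corner_weight c \<zeta> * aff \<alpha> (\<bar>corner_bias c \<zeta>\<bar> * x) (\<bar>corner_bias c \<zeta>\<bar> * y)"
      by (simp add: corner_weight_def corner_bias_def r_def a_def b_def)
  qed
  finally show ?thesis unfolding H_def .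
qed

text \<open>By \<open>corner_hel_sum\<close> this is exp ((\<alpha> - 1) R_\<alpha>) of the outputs
  for corner mixtures of biases x and y. The first argument only fixes the type of the outcomes,
  which the real arguments do not determine.\<close>

definition corner_aff :: "('k::finite \<Rightarrow> 'n::finite \<Rightarrow> bool) itself \<Rightarrow> real \<Rightarrow> real \<Rightarrow> real \<Rightarrow> real \<Rightarrow> real" where
  "corner_aff _ c \<alpha> x y = (\<Sum>\<zeta>\<in>(UNIV :: ('k \<Rightarrow> 'n \<Rightarrow> bool) set). corner_weight c \<zeta> * aff \<alpha> (\<bar>corner_bias c \<zeta>\<bar> * x)
      (\<bar>corner_bias c \<zeta>\<bar> * y))"

lemma corner_weight_nonneg: "0 \<le> c \<Longrightarrow> c < 1/2 \<Longrightarrow> 0 \<le> corner_weight c \<zeta>"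
  unfolding corner_weight_def using bern_nonneg[of "\<chi> i. c" \<zeta>] bern_nonneg[of "\<chi> i. 1 - c" \<zeta>] by simp

lemma corner_bias_le: assumes "0 \<le> c" "c < 1/2" shows "\<bar>corner_bias c \<zeta>\<bar> \<le> 1"
proof -
  have "\<bar>(a - b) / (a + b)\<bar> \<le> 1" if "0 \<le> a" "0 \<le> b" for a b :: real
    using that by (cases "a + b = 0") (auto simp: abs_le_iff divide_le_eq_1 le_divide_eq)
  then show ?thesis unfolding corner_bias_def using assms by (simp add: bern_nonneg)
qed

lemma corner_aff_contraction:
  assumes \<alpha>: "1 < \<alpha>" and t: "0 < t" "t < 1" and c: "0 \<le> c" "c < 1/2"
  shows "\<exists>la\<ge>0. \<exists>mu\<ge>0. \<forall>x y. \<bar>x\<bar> < 1 \<longrightarrow> \<bar>y\<bar> < 1 \<longrightarrow>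
    corner_aff (ty :: ('k::finite \<Rightarrow> 'n::finite \<Rightarrow> bool) itself) c \<alpha> x y \<le> corner_aff ty c \<alpha> t (- t)
      + la * (aff \<alpha> x y - aff \<alpha> t (- t)) + mu * (aff \<alpha> y x - aff \<alpha> t (- t))"
proof -
  have "\<forall>\<zeta> :: 'k \<Rightarrow> 'n \<Rightarrow> bool. \<exists>la mu. 0 \<le> la \<and> 0 \<le> mu \<and> (\<forall>x y. \<bar>x\<bar> < 1 \<longrightarrow> \<bar>y\<bar> < 1 \<longrightarrow>
    aff \<alpha> (\<bar>corner_bias c \<zeta>\<bar> * x) (\<bar>corner_bias c \<zeta>\<bar> * y) \<le> aff \<alpha> (\<bar>corner_bias c \<zeta>\<bar> * t) (- (\<bar>corner_bias c \<zeta>\<bar> * t))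
      + la * (aff \<alpha> x y - aff \<alpha> t (- t)) + mu * (aff \<alpha> y x - aff \<alpha> t (- t)))"
    using aff_contraction[OF \<alpha> t abs_ge_zero corner_bias_le[OF c]] by blast
  then obtain l m :: "('k \<Rightarrow> 'n \<Rightarrow> bool) \<Rightarrow> real" where lm: "\<And>\<zeta>. 0 \<le> l \<zeta>" "\<And>\<zeta>. 0 \<le> m \<zeta>"
    "\<And>\<zeta> x y. \<bar>x\<bar> < 1 \<Longrightarrow> \<bar>y\<bar> < 1 \<Longrightarrow> 
    aff \<alpha> (\<bar>corner_bias c \<zeta>\<bar> * x) (\<bar>corner_bias c \<zeta>\<bar> * y) \<le> aff \<alpha> (\<bar>corner_bias c \<zeta>\<bar> * t) (- (\<bar>corner_bias c \<zeta>\<bar> * t))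
      + l \<zeta> * (aff \<alpha> x y - aff \<alpha> t (- t)) + m \<zeta> * (aff \<alpha> y x - aff \<alpha> t (- t))"
    by metis
  let ?w = "\<lambda>\<zeta> :: 'k \<Rightarrow> 'n \<Rightarrow> bool. corner_weight c \<zeta>"
  have "corner_aff ty c \<alpha> x y \<le> corner_aff ty c \<alpha> t (- t)
      + (\<Sum>\<zeta>\<in>UNIV. ?w \<zeta> * l \<zeta>) * (aff \<alpha> x y - aff \<alpha> t (- t)) + (\<Sum>\<zeta>\<in>UNIV. ?w \<zeta> * m \<zeta>) * (aff \<alpha> y x - aff \<alpha> t (- t))"
    if xy: "\<bar>x\<bar> < 1" "\<bar>y\<bar> < 1" for x y
  proof -
    have "corner_aff ty c \<alpha> x y \<le> (\<Sum>\<zeta>\<in>UNIV. ?w \<zeta> * (aff \<alpha> (\<bar>corner_bias c \<zeta>\<bar> * t) (- (\<bar>corner_bias c \<zeta>\<bar> * t))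
      + l \<zeta> * (aff \<alpha> x y - aff \<alpha> t (- t)) + m \<zeta> * (aff \<alpha> y x - aff \<alpha> t (- t))))"
      unfolding corner_aff_def by (intro sum_mono mult_left_mono lm xy corner_weight_nonneg c)
    then show ?thesis
      by (simp add: corner_aff_def distrib_left sum.distrib sum_distrib_right mult.assoc)
  qed
  moreover have "0 \<le> (\<Sum>\<zeta>\<in>UNIV. ?w \<zeta> * l \<zeta>)" "0 \<le> (\<Sum>\<zeta>\<in>UNIV. ?w \<zeta> * m \<zeta>)"
    by (intro sum_nonneg mult_nonneg_nonneg lm corner_weight_nonneg c)+
  ultimately show ?thesis by blast
qed

lemma corner_aff_0: "corner_aff (ty :: ('k::finite \<Rightarrow> 'n::finite \<Rightarrow> bool) itself) c \<alpha> 0 0 = 1"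
proof -
  have "(\<Sum>\<zeta>\<in>(UNIV :: ('k \<Rightarrow> 'n \<Rightarrow> bool) set). corner_weight c \<zeta>) = 1"
    unfolding corner_weight_def by (simp add: sum.distrib bern_sum flip: sum_divide_distrib)
  then show ?thesis by (simp add: corner_aff_def aff_diag)
qed

section \<open>Reduction to pairs of points\<close>

text \<open>The two-point inequalities leave room for a common slope \<open>r\<close> with \<open>D x \<le> r * (g x - 1)\<close>.\<close>
lemma integral_le_0_two_point:
  fixes g D :: "'a \<Rightarrow> real"
  assumes "prob_space Q" and g: "integrable Q g" "(\<integral>x. g x \<partial>Q) = 1" and D: "integrable Q D"
    and S: "AE x in Q. x \<in> S"
    and pair: "\<And>x x'. x \<in> S \<Longrightarrow> x' \<in> S \<Longrightarrow> 1 < g x \<Longrightarrow> g x' < 1 \<Longrightarrow> (1 - g x') * D x + (g x - 1) * D x' \<le> 0"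
    and one: "\<And>x. x \<in> S \<Longrightarrow> g x = 1 \<Longrightarrow> D x \<le> 0"
  shows "(\<integral>x. D x \<partial>Q) \<le> 0"
proof -
  interpret prob_space Q by fact
  have const: "(\<integral>x. D x \<partial>Q) \<le> 0" if "AE x in Q. g x = 1"
  proof -
    have "AE x in Q. D x \<le> 0" using that S by eventually_elim (rule one)
    then have "(\<integral>x. D x \<partial>Q) \<le> (\<integral>x. 0 \<partial>Q)" by (intro integral_mono_AE D) auto
    then show ?thesis by simp
  qed
  have int1: "integrable Q (\<lambda>x. 1 - g x)" "(\<integral>x. 1 - g x \<partial>Q) = 0"
    "integrable Q (\<lambda>x. g x - 1)" "(\<integral>x. g x - 1 \<partial>Q) = 0"
    using g by (auto simp: prob_space)
  \<comment> \<open>If g stays on one side of 1, its integral 1 forces g = 1 almost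
    everywhere.\<close>
  consider "\<forall>x\<in>S. g x \<le> 1" | "\<forall>x\<in>S. 1 \<le> g x" | "\<exists>x\<in>S. 1 < g x" "\<exists>x\<in>S. g x < 1"
    by (meson not_le)
  then show ?thesis
  proof cases
    case 1
    then have "AE x in Q. 0 \<le> 1 - g x" using S by auto
    then have "AE x in Q. 1 - g x = 0" using integral_nonneg_eq_0_iff_AE[OF int1(1)] int1(2) by blast
    then show ?thesis by (intro const) auto
  next
    case 2
    then have "AE x in Q. 0 \<le> g x - 1" using S by auto
    then have "AE x in Q. g x - 1 = 0" using integral_nonneg_eq_0_iff_AE[OF int1(3)] int1(4) by blast
    then show ?thesis by (intro const) auto
  next
    case 3
    \<comment> \<open>The slopes D / (g - 1) at points with g > 1. By \<open>pair\<close> each of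
      them is at most each slope at points with g < 1, so the supremum separates the two
      families.\<close>
    define R where "R = (\<lambda>x. D x / (g x - 1)) ` {x \<in> S. 1 < g x}"
    have ub: "r \<le> - D x' / (1 - g x')" if r: "r \<in> R" "x' \<in> S" "g x' < 1" for r x'
    proof -
      obtain x where x: "x \<in> S" "1 < g x" "r = D x / (g x - 1)" using r by (auto simp: R_def)
      have "D x = r * (g x - 1)" using x by simp
      then have "(g x - 1) * ((1 - g x') * r + D x') = (1 - g x') * D x + (g x - 1) * D x'"
        by (simp only: distrib_left mult_ac)
      then have "(g x - 1) * ((1 - g x') * r + D x') \<le> 0"
        using pair[OF x(1) r(2) x(2) r(3)] by simp
      then have "(1 - g x') * r + D x' \<le> 0" using x by (simp add: mult_le_0_iff)
      then have "r * (1 - g x') \<le> - D x'" by (simp add: mult.commute)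
      then show ?thesis using r(3) by (subst pos_le_divide_eq) auto
    qed
    have R: "R \<noteq> {}" using 3 by (auto simp: R_def)
    have bdd: "bdd_above R"
    proof -
      obtain x' where "x' \<in> S" "g x' < 1" using 3(2) by blast
      then show ?thesis using ub by (intro bdd_aboveI[of R "- D x' / (1 - g x')"]) blast
    qed
    have le: "D x \<le> Sup R * (g x - 1)" if x: "x \<in> S" for x
    proof (cases "g x" "1 :: real" rule: linorder_cases)
      case less
      then have "Sup R \<le> - D x / (1 - g x)" using ub[OF _ x] by (intro cSup_least R) auto
      then show ?thesis using less by (simp add: field_simps)
    next
      case equal
      then show ?thesis using one[OF x] by simp
    next
      case greater
      then have "D x / (g x - 1) \<le> Sup R" using x by (intro cSup_upper bdd) (auto simp: R_def)
      then show ?thesis using greater by (simp add: field_simps)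
    qed
    have "(\<integral>x. D x \<partial>Q) \<le> (\<integral>x. Sup R * (g x - 1) \<partial>Q)"
      by (rule integral_mono_AE) (use D int1 S le in auto)
    then show ?thesis using int1 by simp
  qed
qed

lemma bern_measurable [measurable]:
  fixes \<omega> :: "'k::finite \<Rightarrow> 'n::finite \<Rightarrow> bool"
  shows "(\<lambda>x. bern x \<omega>) \<in> borel_measurable borel"
proof -
  have "continuous_on UNIV (\<lambda>x :: real^'n. if \<omega> j i then x $ i else 1 - x $ i)" for j i
    by (cases "\<omega> j i") (auto intro!: continuous_intros)
  then have "continuous_on UNIV (\<lambda>x. bern x \<omega>)"
    unfolding bern_def by (intro continuous_on_prod)
  then show ?thesis by (rule borel_measurable_continuous_onI)
qed

text \<open>The two laws are \<open>density Q g\<close> and \<open>Q\<close>. Only the moment of the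
  forward direction is part of the locale; the reversed moment is assumed where both constraints
  enter.\<close>

locale bern_pair =
  fixes Q :: "(real^'n) measure" and g :: "real^'n \<Rightarrow> real" and \<alpha> c :: real
  assumes \<alpha>: "1 < \<alpha>" and c: "0 \<le> c" "c < 1/2"
    and Q: "prob_space Q" and sQ: "sets Q = sets borel"
    and box: "AE x in Q. \<forall>i. c \<le> x $ i \<and> x $ i \<le> 1 - c"
    and gm [measurable]: "g \<in> borel_measurable borel"
    and gpos: "AE x in Q. 0 < g x"
    and g: "integrable Q g" "(\<integral>x. g x \<partial>Q) = 1"
    and ga: "integrable Q (\<lambda>x. g x powr \<alpha>)"
begin

section \<open>Output laws, their likelihood ratios and the linearised functional\<close>

sublocale prob_space Q by (rule Q)

definition out :: "('k::finite \<Rightarrow> 'n \<Rightarrow> bool) \<Rightarrow> real" where "out \<omega> = (\<integral>x. bern x \<omega> \<partial>Q)"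
definition outg :: "('k::finite \<Rightarrow> 'n \<Rightarrow> bool) \<Rightarrow> real" where "outg \<omega> = (\<integral>x. g x * bern x \<omega> \<partial>Q)"

lemma box01: "AE x in Q. \<forall>i. 0 \<le> x $ i \<and> x $ i \<le> 1"
  using box
proof eventually_elim
  case (elim x)
  show ?case
  proof
    fix i
    show "0 \<le> x $ i \<and> x $ i \<le> 1" using elim[rule_format, of i] c by linarith
  qed
qed

lemma bern_bound: "AE x in Q. 0 \<le> bern x \<omega> \<and> bern x \<omega> \<le> 1"
  using box01 by eventually_elim (auto intro!: bern_nonneg bern_le_1)

lemma bern_measurableQ [measurable]: "(\<lambda>x. bern x \<omega>) \<in> borel_measurable Q"
  using bern_measurable measurable_cong_sets[OF sQ refl] by blast

lemma gmQ [measurable]: "g \<in> borel_measurable Q"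
  using gm measurable_cong_sets[OF sQ refl] by blast

lemma bern_int [simp]: "integrable Q (\<lambda>x. bern x \<omega>)"
  by (rule integrable_const_bound[where B = 1]) (use bern_bound[of \<omega>] in auto)

lemma gbern_int [simp]: "integrable Q (\<lambda>x. g x * bern x \<omega>)"
proof (rule Bochner_Integration.integrable_bound[OF g(1)])
  show "AE x in Q. norm (g x * bern x \<omega>) \<le> norm (g x)"
    using bern_bound[of \<omega>]
  proof eventually_elim
    case (elim x)
    then show ?case using mult_left_mono[of "\<bar>bern x \<omega>\<bar>" 1 "\<bar>g x\<bar>"] by (simp add: abs_mult)
  qed
qed simp

lemma out_nonneg: "0 \<le> out \<omega>" and outg_nonneg: "0 \<le> outg \<omega>"
proof -
  show "0 \<le> out \<omega>" unfolding out_def by (intro integral_nonneg_AE) (use bern_bound[of \<omega>] in auto)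
  have "AE x in Q. 0 \<le> g x * bern x \<omega>" using bern_bound[of \<omega>] gpos by eventually_elim auto
  then show "0 \<le> outg \<omega>" unfolding outg_def by (rule integral_nonneg_AE)
qed

text \<open>Absolute continuity of the outputs: \<open>bern x \<omega>\<close> is nonnegative and
  vanishes almost everywhere when its mean does.\<close>

lemma out_0: assumes "out \<omega> = 0" shows "outg \<omega> = 0"
proof -
  have "AE x in Q. bern x \<omega> = 0"
    using integral_nonneg_eq_0_iff_AE[OF bern_int, of \<omega>] bern_bound[of \<omega>] assms by (auto simp: out_def)
  then have "AE x in Q. g x * bern x \<omega> = 0" by eventually_elim auto
  then show ?thesis unfolding outg_def by (rule integral_eq_zero_AE)
qed

definition lik :: "('k::finite \<Rightarrow> 'n \<Rightarrow> bool) \<Rightarrow> real" where "lik \<omega> = outg \<omega> / out \<omega>"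

lemma lik_nonneg: "0 \<le> lik \<omega>"
  by (simp add: lik_def out_nonneg outg_nonneg)

text \<open>The integrand of the linearisation: the tangent planes of \<open>Young_powr\<close> at
  the output ratios \<open>lik\<close>, evaluated at (u, 1) and weighted by the likelihoods of the
  outcomes.\<close>

definition score :: "('k::finite \<Rightarrow> 'n \<Rightarrow> bool) itself \<Rightarrow> real^'n \<Rightarrow> real \<Rightarrow> real" where
  "score _ x u = (\<Sum>\<omega>\<in>(UNIV :: ('k \<Rightarrow> 'n \<Rightarrow> bool) set). bern x \<omega> * (\<alpha> * lik \<omega> powr (\<alpha> - 1) * u - (\<alpha> - 1) * lik \<omega> powr \<alpha>))"

text \<open>A tangent plane taken at the actual output ratio is exact there. With \<open>lik\<close>
  held fixed, the sum over outcomes thus becomes an integral over Q of an integrand that is affine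
  in \<open>g x\<close>.\<close>

lemma hel_eq_score:
  fixes ty :: "('k::finite \<Rightarrow> 'n \<Rightarrow> bool) itself"
  shows "integrable Q (\<lambda>x. score ty x (g x))"
    and "(\<Sum>\<omega>\<in>(UNIV :: ('k \<Rightarrow> 'n \<Rightarrow> bool) set). hel \<alpha> (outg \<omega>) (out \<omega>)) = (\<integral>x. score ty x (g x) \<partial>Q)"
proof -
  have e: "score ty x (g x) = (\<Sum>\<omega>\<in>(UNIV :: ('k \<Rightarrow> 'n \<Rightarrow> bool) set).
     \<alpha> * lik \<omega> powr (\<alpha> - 1) * (g x * bern x \<omega>) - (\<alpha> - 1) * lik \<omega> powr \<alpha> * bern x \<omega>)" for x
    unfolding score_def by (intro sum.cong refl) (simp add: algebra_simps)
  show "integrable Q (\<lambda>x. score ty x (g x))" unfolding e by simp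
  have "(\<integral>x. score ty x (g x) \<partial>Q) = (\<Sum>\<omega>\<in>(UNIV :: ('k \<Rightarrow> 'n \<Rightarrow> bool) set).
     \<alpha> * lik \<omega> powr (\<alpha> - 1) * outg \<omega> - (\<alpha> - 1) * lik \<omega> powr \<alpha> * out \<omega>)"
    unfolding e by (simp add: outg_def out_def)
  also have "\<dots> = (\<Sum>\<omega>\<in>(UNIV :: ('k \<Rightarrow> 'n \<Rightarrow> bool) set). hel \<alpha> (outg \<omega>) (out \<omega>))"
  proof (intro sum.cong refl)
    fix \<omega> :: "'k \<Rightarrow> 'n \<Rightarrow> bool"
    show "\<alpha> * lik \<omega> powr (\<alpha> - 1) * outg \<omega> - (\<alpha> - 1) * lik \<omega> powr \<alpha> * out \<omega> = hel \<alpha> (outg \<omega>) (out \<omega>)"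
    proof (cases "out \<omega> = 0")
      case True
      then show ?thesis using out_0[OF True] \<alpha> by (simp add: hel_def)
    next
      case False
      then have o: "0 < out \<omega>" using out_nonneg[of \<omega>] by simp
      define l where "l = lik \<omega>"
      have l: "outg \<omega> = l * out \<omega>" "0 \<le> l" using o lik_nonneg by (auto simp: lik_def l_def)
      have "l powr (\<alpha> - 1) * l = l powr \<alpha>" using l(2) \<alpha> by (simp add: powr_mult_base mult.commute)
      moreover have "out \<omega> powr \<alpha> * out \<omega> powr (1 - \<alpha>) = out \<omega>" using o by (simp flip: powr_add)
      moreover have "hel \<alpha> (l * out \<omega>) (out \<omega>) = l powr \<alpha> * (out \<omega> powr \<alpha> * out \<omega> powr (1 - \<alpha>))"
        using l(2) o by (simp add: hel_def powr_mult)
      moreover have "\<alpha> * l powr (\<alpha> - 1) * (l * out \<omega>) = \<alpha> * (l powr (\<alpha> - 1) * l) * out \<omega>" by simp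
      ultimately show ?thesis unfolding l(1) l_def[symmetric] by (simp add: left_diff_distrib)
    qed
  qed
  finally show "(\<Sum>\<omega>\<in>(UNIV :: ('k \<Rightarrow> 'n \<Rightarrow> bool) set). hel \<alpha> (outg \<omega>) (out \<omega>)) = (\<integral>x. score ty x (g x) \<partial>Q)" by simp
qed

lemma score_le_powr:
  assumes x: "\<And>i. 0 \<le> x $ i \<and> x $ i \<le> 1" and u: "0 \<le> u"
  shows "score (ty :: ('k::finite \<Rightarrow> 'n \<Rightarrow> bool) itself) x u \<le> u powr \<alpha>"
proof -
  have "\<alpha> * lik \<omega> powr (\<alpha> - 1) * u - (\<alpha> - 1) * lik \<omega> powr \<alpha> \<le> u powr \<alpha>" for \<omega> :: "'k \<Rightarrow> 'n \<Rightarrow> bool"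
    using Young_powr[OF \<alpha> u, of 1 "lik \<omega>"] lik_nonneg[of \<omega>] by simp
  then have "score ty x u \<le> (\<Sum>\<omega>\<in>(UNIV :: ('k \<Rightarrow> 'n \<Rightarrow> bool) set). bern x \<omega> * u powr \<alpha>)"
    unfolding score_def by (intro sum_mono mult_left_mono bern_nonneg x)
  then show ?thesis by (simp add: bern_sum flip: sum_distrib_right)
qed

text \<open>Data processing in one direction. It settles the case \<epsilon> = 0, where the
  symmetric pair degenerates.\<close>

lemma hel_le_integral:
  "(\<Sum>\<omega>\<in>(UNIV :: ('k::finite \<Rightarrow> 'n \<Rightarrow> bool) set). hel \<alpha> (outg \<omega>) (out \<omega>)) \<le> (\<integral>x. g x powr \<alpha> \<partial>Q)"
  unfolding hel_eq_score(2)[where ty = "TYPE('k \<Rightarrow> 'n \<Rightarrow> bool)"]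
proof (rule integral_mono_AE)
  show "AE x in Q. score TYPE('k \<Rightarrow> 'n \<Rightarrow> bool) x (g x) \<le> g x powr \<alpha>"
    using box01 gpos by eventually_elim (rule score_le_powr, auto)
qed (use ga hel_eq_score(1) in auto)

text \<open>Weak duality. \<open>D\<close> is the integrand of the Lagrangian minus its claimed
  bound; once its integral is at most 0, the two moment constraints and the signs of the multipliers
  give the result. \<open>integral_le_0_two_point\<close> reduces this to points x, x' with g x > 1
  > g x', which behave like a pair of coins.\<close>

lemma hel_le_corner:
  assumes t: "0 < t" "t < 1"
    and gb: "integrable Q (\<lambda>x. g x powr (1 - \<alpha>))"
    and M: "(\<integral>x. g x powr \<alpha> \<partial>Q) \<le> aff \<alpha> t (- t)" "(\<integral>x. g x powr (1 - \<alpha>) \<partial>Q) \<le> aff \<alpha> t (- t)"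
  shows "(\<Sum>\<omega>\<in>(UNIV :: ('k::finite \<Rightarrow> 'n \<Rightarrow> bool) set). hel \<alpha> (outg \<omega>) (out \<omega>))
     \<le> corner_aff TYPE('k \<Rightarrow> 'n \<Rightarrow> bool) c \<alpha> t (- t)"
proof -
  let ?ty = "TYPE('k \<Rightarrow> 'n \<Rightarrow> bool)"
  let ?M = "aff \<alpha> t (- t)"
  let ?K = "corner_aff ?ty c \<alpha> t (- t)"
  obtain la mu where lm: "0 \<le> la" "0 \<le> mu" and
    tan: "\<And>x y. \<bar>x\<bar> < 1 \<Longrightarrow> \<bar>y\<bar> < 1 \<Longrightarrow> corner_aff ?ty c \<alpha> x y \<le> ?K + la * (aff \<alpha> x y - ?M) + mu * (aff \<alpha> y x - ?M)"
    using corner_aff_contraction[OF \<alpha> t c, of ?ty] by blast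
  define D where "D x = score ?ty x (g x) - la * g x powr \<alpha> - mu * g x powr (1 - \<alpha>) - (?K - (la + mu) * ?M)" for x
  define S where "S = {x :: real^'n. (\<forall>i. c \<le> x $ i \<and> x $ i \<le> 1 - c) \<and> 0 < g x}"
  have DI: "integrable Q D" unfolding D_def using hel_eq_score(1)[of ?ty] ga gb by simp
  have "(\<integral>x. D x \<partial>Q) \<le> 0"
  proof (rule integral_le_0_two_point[OF Q g DI])
    show "AE x in Q. x \<in> S" using box gpos by eventually_elim (auto simp: S_def)
  next
    \<comment> \<open>A point with ratio 1 corresponds to the trivial pair of coins, biases 0 and
      0.\<close>
    fix x assume x: "x \<in> S" "g x = 1"
    have "0 \<le> x $ i \<and> x $ i \<le> 1" for i using x c by (auto simp: S_def intro: order_trans)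
    then have "score ?ty x (g x) \<le> 1" using score_le_powr[of x 1 ?ty] x by simp
    moreover have "1 \<le> ?K + la * (1 - ?M) + mu * (1 - ?M)"
      using tan[of 0 0] by (simp add: corner_aff_0 aff_diag)
    ultimately show "D x \<le> 0" using x by (simp add: D_def algebra_simps)
  next
    fix x x' assume x: "x \<in> S" "x' \<in> S" "1 < g x" "g x' < 1"
    define u where "u = g x"
    define v where "v = g x'"
    have uv: "1 < u" "0 < v" "v < 1" using x by (auto simp: u_def v_def S_def)
    \<comment> \<open>The weight q makes the mean of g equal to 1: q u + (1 - q) v = 1. Then p = q u
      is the tilted weight, and X, Y are the biases of coins with success probabilities p and q,
      whose likelihood ratios are u and v.\<close>
    define q where "q = (1 - v) / (u - v)"
    define p where "p = u * q"
    have q: "0 < q" "q < 1" using uv by (auto simp: q_def)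
    have q1: "1 - q = (u - 1) / (u - v)" using uv by (simp add: q_def field_simps)
    have p1: "1 - p = v * (1 - q)" unfolding q1 p_def unfolding q_def using uv by (simp add: field_simps)
    have "0 < v * (1 - q)" using uv q by simp
    then have p: "0 < p" "p < 1" using p1 uv q by (simp add: p_def, linarith)
    define X where "X = 2 * p - 1"
    define Y where "Y = 2 * q - 1"
    have XY: "\<bar>X\<bar> < 1" "\<bar>Y\<bar> < 1" using p q by (auto simp: X_def Y_def)
    have r: "(1 + X) / (1 + Y) = u" "(1 - X) / (1 - Y) = v" "(1 + Y) / (1 + X) = 1 / u" "(1 - Y) / (1 - X) = 1 / v"
    proof -
      have w: "2 * (v * w) / (2 * w) = v" "2 * w / (2 * (v * w)) = 1 / v" if "w \<noteq> 0" for w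
        using that uv by simp_all
      have e: "1 + X = 2 * p" "1 - X = 2 * (1 - p)" "1 + Y = 2 * q" "1 - Y = 2 * (1 - q)" by (auto simp: X_def Y_def)
      show "(1 + X) / (1 + Y) = u" "(1 + Y) / (1 + X) = 1 / u" unfolding e p_def using q uv by simp_all
      show "(1 - X) / (1 - Y) = v" "(1 - Y) / (1 - X) = 1 / v" 
        unfolding e p1 using w[of "1 - q"] q by simp_all
    qed
    have a1: "aff \<alpha> X Y = q * u powr \<alpha> + (1 - q) * v powr \<alpha>"
      unfolding aff_ratio[OF XY] r by (simp add: Y_def field_simps)
    have iu: "w * (1 / w) powr \<alpha> = w powr (1 - \<alpha>)" if "0 < w" for w :: real
      using that by (simp add: powr_divide powr_diff)
    have a2: "aff \<alpha> Y X = q * u powr (1 - \<alpha>) + (1 - q) * v powr (1 - \<alpha>)"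
    proof -
      have "aff \<alpha> Y X = q * (u * (1 / u) powr \<alpha>) + (1 - q) * (v * (1 / v) powr \<alpha>)"
      proof -
        have e: "1 + X = 2 * (u * q)" "1 - X = 2 * (v * (1 - q))" using p1 by (auto simp: X_def p_def)
        have "(2 * (u * q) * A + 2 * (v * w) * B) / 2 = q * (u * A) + w * (v * B)" for A B w :: real by simp
        then show ?thesis unfolding aff_ratio[OF XY(2,1)] unfolding r unfolding e .
      qed
      then show ?thesis using iu[of u] iu[of v] uv by simp
    qed
    have "q * score ?ty x u + (1 - q) * score ?ty x' v
        = (\<Sum>\<omega>\<in>(UNIV :: ('k \<Rightarrow> 'n \<Rightarrow> bool) set). \<alpha> * lik \<omega> powr (\<alpha> - 1) * mix p (bern x \<omega>) (bern x' \<omega>)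
         - (\<alpha> - 1) * lik \<omega> powr \<alpha> * mix q (bern x \<omega>) (bern x' \<omega>))"
      unfolding score_def sum_distrib_left sum.distrib[symmetric] mix_def p1 unfolding p_def
      by (intro sum.cong refl) (simp add: algebra_simps)
    also have "\<dots> \<le> (\<Sum>\<zeta>\<in>(UNIV :: ('k \<Rightarrow> 'n \<Rightarrow> bool) set). hel \<alpha> (mix p (corner (1 - c) \<zeta>) (corner c \<zeta>)) (mix q (corner (1
        - c) \<zeta>) (corner c \<zeta>)))"
      by (rule bern_pair_le_corner[OF \<alpha> c]) (use x p q lik_nonneg in \<open>auto simp: S_def\<close>)
    also have "\<dots> = corner_aff ?ty c \<alpha> X Y"
      using corner_hel_sum[OF \<alpha> c XY, where 'k = 'k and 'n = 'n] by (simp add: corner_aff_def X_def Y_def)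
    also have "\<dots> \<le> ?K + la * (aff \<alpha> X Y - ?M) + mu * (aff \<alpha> Y X - ?M)" by (rule tan[OF XY])
    finally have "q * D x + (1 - q) * D x' \<le> 0"
      unfolding D_def u_def[symmetric] v_def[symmetric] a1 a2 by (simp add: algebra_simps)
    then have "(u - v) * (q * D x + (1 - q) * D x') \<le> 0" using uv by (simp add: mult_le_0_iff)
    moreover have "(u - v) * (q * D x + (1 - q) * D x') = ((u - v) * q) * D x + ((u - v) * (1 - q)) * D x'"
      by (simp add: algebra_simps)
    moreover have "(u - v) * q = 1 - v" "(u - v) * (1 - q) = u - 1" unfolding q1 unfolding q_def using uv by simp_all
    ultimately show "(1 - g x') * D x + (g x - 1) * D x' \<le> 0" unfolding u_def v_def by simp
  qed
  moreover have "(\<integral>x. D x \<partial>Q) = (\<integral>x. score ?ty x (g x) \<partial>Q) - la * (\<integral>x. g x powr \<alpha> \<partial>Q) - mu * (\<integral>x. g x powr (1 - \<alpha>) \<partial>Q)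
      - (?K - (la + mu) * ?M)"
    unfolding D_def using hel_eq_score(1)[of ?ty] ga gb by (simp add: prob_space)
  moreover have "la * (\<integral>x. g x powr \<alpha> \<partial>Q) \<le> la * ?M" "mu * (\<integral>x. g x powr (1 - \<alpha>) \<partial>Q) \<le> mu * ?M"
    using lm M by (auto intro: mult_left_mono)
  ultimately show ?thesis unfolding hel_eq_score(2)[where ty = ?ty] by (simp add: algebra_simps)
qed

end

section \<open>Renyi divergences of densities\<close>

lemma renyi_density:
  assumes "prob_space Q" and G: "G \<in> borel_measurable Q" "AE x in Q. 0 \<le> G x"
  shows "renyi \<alpha> (density Q (\<lambda>x. ennreal (G x))) Q =
    (if (\<integral>\<^sup>+ x. ennreal (G x powr \<alpha>) \<partial>Q) = \<infinity> then \<infinity>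
     else ereal (ln (enn2real (\<integral>\<^sup>+ x. ennreal (G x powr \<alpha>) \<partial>Q)) / (\<alpha> - 1)))"
proof -
  interpret prob_space Q by fact
  let ?P = "density Q (\<lambda>x. ennreal (G x))"
  have ac: "absolutely_continuous Q ?P" using G by (intro absolutely_continuousI_density) simp
  have "AE x in Q. ennreal (G x) = RN_deriv Q ?P x" using G by (intro RN_deriv_unique) auto
  then have "AE x in Q. ennreal ((enn2real (RN_deriv Q ?P x)) powr \<alpha>) = ennreal (G x powr \<alpha>)"
    using G(2)
  proof eventually_elim
    case (elim x)
    then show ?case by (simp flip: elim(1))
  qed
  then have "(\<integral>\<^sup>+ x. ennreal ((enn2real (RN_deriv Q ?P x)) powr \<alpha>) \<partial>Q) = (\<integral>\<^sup>+ x. ennreal (G x powr \<alpha>) \<partial>Q)"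
    by (rule nn_integral_cong_AE)
  then show ?thesis unfolding renyi_def using ac by (simp add: Let_def)
qed

lemma renyi_density_integrable:
  assumes "prob_space Q" "G \<in> borel_measurable Q" "AE x in Q. 0 \<le> G x"
    and "integrable Q (\<lambda>x. G x powr \<alpha>)"
  shows "renyi \<alpha> (density Q (\<lambda>x. ennreal (G x))) Q = ereal (ln (\<integral>x. G x powr \<alpha> \<partial>Q) / (\<alpha> - 1))"
proof -
  have "(\<integral>\<^sup>+ x. ennreal (G x powr \<alpha>) \<partial>Q) = ennreal (\<integral>x. G x powr \<alpha> \<partial>Q)"
    using assms by (intro nn_integral_eq_integral) auto
  moreover have "0 \<le> (\<integral>x. G x powr \<alpha> \<partial>Q)" by (intro integral_nonneg_AE) auto
  ultimately show ?thesis using renyi_density[OF assms(1-3), of \<alpha>] by simp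
qed

lemma renyi_self: assumes "prob_space P" shows "renyi \<alpha> P P = 0"
proof -
  interpret prob_space P by fact
  have "density P (\<lambda>x. ennreal 1) = P" by (simp add: density_1)
  then show ?thesis using renyi_density_integrable[OF assms, of "\<lambda>_. 1" \<alpha>]
    by (simp add: prob_space zero_ereal_def)
qed

lemma renyi_finite:
  fixes f g :: "'b::finite \<Rightarrow> real"
  assumes \<alpha>: "1 < \<alpha>" and f: "\<And>w. 0 \<le> f w" and g: "\<And>w. 0 \<le> g w" and g1: "(\<Sum>w\<in>UNIV. g w) = 1"
    and ac: "\<And>w. g w = 0 \<Longrightarrow> f w = 0"
  shows "renyi \<alpha> (density (count_space UNIV) (\<lambda>w. ennreal (f w))) (density (count_space UNIV) (\<lambda>w. ennreal (g w)))
    = ereal (ln (\<Sum>w\<in>UNIV. hel \<alpha> (f w) (g w)) / (\<alpha> - 1))"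
proof -
  let ?C = "count_space UNIV :: 'b measure"
  let ?Q = "density ?C (\<lambda>w. ennreal (g w))"
  \<comment> \<open>Division by zero gives \<open>G\<close> the value 0 where g vanishes, in
    agreement with f = 0 there.\<close>
  define G where "G w = f w / g w" for w
  have pr: "prob_space ?Q"
    by (rule prob_spaceI) (simp add: emeasure_density nn_integral_count_space_finite sum_ennreal g g1)
  have "density ?Q (\<lambda>w. ennreal (G w)) = density ?C (\<lambda>w. ennreal (g w) * ennreal (G w))"
    by (rule density_density_eq) auto
  also have "(\<lambda>w. ennreal (g w) * ennreal (G w)) = (\<lambda>w. ennreal (f w))"
  proof
    fix w
    show "ennreal (g w) * ennreal (G w) = ennreal (f w)"
      using g[of w] f[of w] ac[of w] by (cases "g w = 0") (auto simp: G_def ennreal_mult[symmetric])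
  qed
  finally have P: "density ?Q (\<lambda>w. ennreal (G w)) = density ?C (\<lambda>w. ennreal (f w))" .
  interpret prob_space ?Q by (rule pr)
  have "integrable ?Q (\<lambda>w. G w powr \<alpha>)"
    by (rule integrable_const_bound[where B = "\<Sum>w\<in>UNIV. G w powr \<alpha>"]) (auto intro!: member_le_sum AE_I2)
  moreover have "(\<integral>w. G w powr \<alpha> \<partial>?Q) = (\<Sum>w\<in>UNIV. hel \<alpha> (f w) (g w))"
  proof -
    have "(\<integral>w. G w powr \<alpha> \<partial>?Q) = (\<Sum>w\<in>UNIV. g w * G w powr \<alpha>)"
      by (subst integral_density) (auto simp: g lebesgue_integral_count_space_finite AE_count_space)
    also have "\<dots> = (\<Sum>w\<in>UNIV. hel \<alpha> (f w) (g w))"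
    proof (intro sum.cong refl)
      fix w
      show "g w * G w powr \<alpha> = hel \<alpha> (f w) (g w)"
        using f[of w] g[of w] ac[of w] by (cases "g w = 0") (auto simp: G_def hel_def powr_divide powr_diff)
    qed
    finally show ?thesis .
  qed
  ultimately show ?thesis
    using renyi_density_integrable[OF pr, of G \<alpha>] f g unfolding P by (simp add: G_def)
qed

section \<open>The divergence of the output laws as a finite sum\<close>

context bern_pair
begin

lemma bern_k_Q: "(bern_k Q :: ('k::finite \<Rightarrow> 'n \<Rightarrow> bool) measure) = density (count_space UNIV) (\<lambda>\<omega>. ennreal (out \<omega>))"
proof -
  have "(\<integral>\<^sup>+ x. ennreal (bern x \<omega>) \<partial>Q) = ennreal (out \<omega>)" for \<omega> :: "'k \<Rightarrow> 'n \<Rightarrow> bool"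
    unfolding out_def using bern_bound[of \<omega>] by (intro nn_integral_eq_integral) auto
  then show ?thesis unfolding bern_k_def bern_def[symmetric] by simp
qed

lemma bern_k_P: "(bern_k (density Q (\<lambda>x. ennreal (g x))) :: ('k::finite \<Rightarrow> 'n \<Rightarrow> bool) measure)
    = density (count_space UNIV) (\<lambda>\<omega>. ennreal (outg \<omega>))"
proof -
  have "(\<integral>\<^sup>+ x. ennreal (bern x \<omega>) \<partial>density Q (\<lambda>x. ennreal (g x))) = ennreal (outg \<omega>)" for \<omega> :: "'k \<Rightarrow> 'n \<Rightarrow> bool"
  proof -
    have "(\<integral>\<^sup>+ x. ennreal (bern x \<omega>) \<partial>density Q (\<lambda>x. ennreal (g x))) = (\<integral>\<^sup>+ x. ennreal (g x) * ennreal (bern x \<omega>) \<partial>Q)"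
      by (rule nn_integral_density) auto
    also have "\<dots> = (\<integral>\<^sup>+ x. ennreal (g x * bern x \<omega>) \<partial>Q)"
      by (rule nn_integral_cong_AE) (use bern_bound[of \<omega>] gpos in eventually_elim, simp add: ennreal_mult)
    also have "\<dots> = ennreal (outg \<omega>)" unfolding outg_def
    proof (rule nn_integral_eq_integral)
      show "AE x in Q. 0 \<le> g x * bern x \<omega>" using bern_bound[of \<omega>] gpos by eventually_elim auto
    qed simp
    finally show ?thesis .
  qed
  then show ?thesis unfolding bern_k_def bern_def[symmetric] by simp
qed

lemma renyi_bern:
  "renyi \<alpha> (bern_k (density Q (\<lambda>x. ennreal (g x))) :: ('k::finite \<Rightarrow> 'n \<Rightarrow> bool) measure) (bern_k Q)
     = ereal (ln (\<Sum>\<omega>\<in>(UNIV :: ('k \<Rightarrow> 'n \<Rightarrow> bool) set). hel \<alpha> (outg \<omega>) (out \<omega>)) / (\<alpha> - 1))"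
proof -
  have "(\<Sum>\<omega>\<in>(UNIV :: ('k \<Rightarrow> 'n \<Rightarrow> bool) set). out \<omega>) = (\<integral>x. (\<Sum>\<omega>\<in>(UNIV :: ('k \<Rightarrow> 'n \<Rightarrow> bool) set). bern x \<omega>) \<partial>Q)"
    unfolding out_def by simp
  then have "(\<Sum>\<omega>\<in>(UNIV :: ('k \<Rightarrow> 'n \<Rightarrow> bool) set). out \<omega>) = 1" by (simp add: bern_sum prob_space)
  then show ?thesis unfolding bern_k_Q bern_k_P
    by (intro renyi_finite \<alpha> outg_nonneg out_nonneg out_0)
qed

end

lemma renyi_le_integral_le:
  assumes \<alpha>: "1 < \<alpha>" and le: "renyi \<alpha> (density Q (\<lambda>x. ennreal (G x))) Q \<le> ereal \<epsilon>"
    and Q: "prob_space Q" and G: "G \<in> borel_measurable Q" "AE x in Q. 0 \<le> G x"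
  shows "(\<integral>\<^sup>+ x. ennreal (G x powr \<alpha>) \<partial>Q) \<le> ennreal (exp ((\<alpha> - 1) * \<epsilon>))"
proof -
  let ?I = "\<integral>\<^sup>+ x. ennreal (G x powr \<alpha>) \<partial>Q"
  have fin: "?I \<noteq> \<infinity>" and le': "ln (enn2real ?I) / (\<alpha> - 1) \<le> \<epsilon>"
    using le unfolding renyi_density[OF Q G] by (auto split: if_splits)
  \<comment> \<open>Since \<open>ln 0 = 0\<close>, the logarithmic bound says nothing when the
    integral is 0, but then the claim is immediate.\<close>
  have "enn2real ?I \<le> exp ((\<alpha> - 1) * \<epsilon>)"
  proof (cases "enn2real ?I = 0")
    case False
    then have p: "0 < enn2real ?I" by (simp add: less_le)
    have "ln (enn2real ?I) \<le> (\<alpha> - 1) * \<epsilon>" using le' \<alpha> by (simp add: pos_divide_le_eq mult.commute)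
    then have "exp (ln (enn2real ?I)) \<le> exp ((\<alpha> - 1) * \<epsilon>)" by simp
    then show ?thesis using p by simp
  qed simp
  moreover have "?I = ennreal (enn2real ?I)" using fin by (simp add: top.not_eq_extremum)
  ultimately show ?thesis by (metis ennreal_leI)
qed

text \<open>Finiteness in both directions makes P and Q mutually absolutely continuous, so g is
  positive and the density of Q with respect to P is 1 / g. Changing the measure turns the reversed
  constraint into a moment of g under Q.\<close>

lemma renyi_le_density:
  assumes \<alpha>: "1 < \<alpha>" and P: "prob_space P" and Q: "prob_space Q" and s: "sets P = sets Q"
    and PQ: "renyi \<alpha> P Q \<le> ereal \<epsilon>" and QP: "renyi \<alpha> Q P \<le> ereal \<epsilon>"
  obtains g where "g \<in> borel_measurable Q" "P = density Q (\<lambda>x. ennreal (g x))" "AE x in Q. 0 < g x"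
    "integrable Q g" "(\<integral>x. g x \<partial>Q) = 1"
    "integrable Q (\<lambda>x. g x powr \<alpha>)" "(\<integral>x. g x powr \<alpha> \<partial>Q) \<le> exp ((\<alpha> - 1) * \<epsilon>)"
    "integrable Q (\<lambda>x. g x powr (1 - \<alpha>))" "(\<integral>x. g x powr (1 - \<alpha>) \<partial>Q) \<le> exp ((\<alpha> - 1) * \<epsilon>)"
proof -
  interpret P: prob_space P by fact
  interpret Q: prob_space Q by fact
  have acs: "absolutely_continuous Q P" "absolutely_continuous P Q"
    using PQ QP by (auto simp: renyi_def split: if_splits)
  define g where "g x = enn2real (RN_deriv Q P x)" for x
  define h where "h x = enn2real (RN_deriv P Q x)" for x
  have gm [measurable]: "g \<in> borel_measurable Q" unfolding g_def [abs_def] by measurable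
  have hmP: "h \<in> borel_measurable P" unfolding h_def [abs_def] by measurable
  have hm [measurable]: "h \<in> borel_measurable Q" using hmP measurable_cong_sets[OF s refl] by blast
  have g0: "0 \<le> g x" and h0: "0 \<le> h x" for x by (auto simp: g_def h_def)
  have dens: "A = density B (\<lambda>x. ennreal (enn2real (RN_deriv B A x)))"
    if "prob_space A" "prob_space B" "sets A = sets B" "absolutely_continuous B A" for A B :: "'a measure"
  proof -
    interpret A: prob_space A by fact
    interpret B: prob_space B by fact
    have "AE x in B. RN_deriv B A x \<noteq> \<infinity>"
      by (rule B.RN_deriv_finite) (use that A.sigma_finite_measure_axioms in auto)
    then have "AE x in B. ennreal (enn2real (RN_deriv B A x)) = RN_deriv B A x"
      by eventually_elim (simp add: top.not_eq_extremum)
    then have "density B (\<lambda>x. ennreal (enn2real (RN_deriv B A x))) = density B (RN_deriv B A)"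
      by (intro density_cong) auto
    then show ?thesis using B.density_RN_deriv[OF that(4,3)] by simp
  qed
  have Pg: "P = density Q (\<lambda>x. ennreal (g x))" unfolding g_def by (rule dens[OF P Q s acs(1)])
  have Qh: "Q = density P (\<lambda>x. ennreal (h x))" unfolding h_def by (rule dens[OF Q P s[symmetric] acs(2)])
  have PQg: "renyi \<alpha> (density Q (\<lambda>x. ennreal (g x))) Q \<le> ereal \<epsilon>"
    by (subst Pg[symmetric]) (rule PQ)
  have QPh: "renyi \<alpha> (density P (\<lambda>x. ennreal (h x))) P \<le> ereal \<epsilon>"
    by (subst Qh[symmetric]) (rule QP)
  \<comment> \<open>Two successive changes of measure return to Q, so uniqueness of densities makes
    the product of g and h equal to 1.\<close>
  have "density Q (\<lambda>x. ennreal (g x) * ennreal (h x)) = density P (\<lambda>x. ennreal (h x))"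
    by (subst Pg, rule density_density_eq[symmetric]) auto
  also have "\<dots> = density Q (\<lambda>_. 1)" unfolding density_1 by (rule Qh[symmetric])
  finally have "AE x in Q. ennreal (g x) * ennreal (h x) = 1"
    by (subst (asm) Q.density_unique_iff) auto
  then have gh: "AE x in Q. g x * h x = 1"
    by eventually_elim (use g0 h0 in \<open>simp add: ennreal_mult[symmetric] flip: ennreal_1\<close>)
  have gpos: "AE x in Q. 0 < g x"
    using gh
  proof eventually_elim
    case (elim x)
    then have "g x \<noteq> 0" by auto
    then show ?case using g0[of x] by simp
  qed
  have "(\<integral>\<^sup>+ x. ennreal (g x) \<partial>Q) = 1"
  proof -
    have "emeasure P (space P) = (\<integral>\<^sup>+ x. ennreal (g x) * indicator (space Q) x \<partial>Q)"
      by (subst (1) Pg, subst emeasure_density) (use sets_eq_imp_space_eq[OF s] in auto)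
    also have "\<dots> = (\<integral>\<^sup>+ x. ennreal (g x) \<partial>Q)" by (intro nn_integral_cong) auto
    finally show ?thesis using P.emeasure_space_1 by simp
  qed
  then have g1: "integrable Q g" "(\<integral>x. g x \<partial>Q) = 1"
    using integrableI_nn_integral_finite[of g Q 1] integral_eq_nn_integral[of g Q] g0 by auto
  have from_nn: "integrable Q f \<and> (\<integral>x. f x \<partial>Q) \<le> exp ((\<alpha> - 1) * \<epsilon>)"
    if "f \<in> borel_measurable Q" "\<And>x. 0 \<le> f x" "(\<integral>\<^sup>+ x. ennreal (f x) \<partial>Q) \<le> ennreal (exp ((\<alpha> - 1) * \<epsilon>))" for f
  proof -
    have i: "integrable Q f"
      by (rule integrableI_bounded) (use that in \<open>auto intro: le_less_trans\<close>)
    then have "ennreal (\<integral>x. f x \<partial>Q) \<le> ennreal (exp ((\<alpha> - 1) * \<epsilon>))"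
      using nn_integral_eq_integral[OF i] that by simp
    then show ?thesis using i by (simp add: ennreal_le_iff)
  qed
  have I1: "(\<integral>\<^sup>+ x. ennreal (g x powr \<alpha>) \<partial>Q) \<le> ennreal (exp ((\<alpha> - 1) * \<epsilon>))"
    by (rule renyi_le_integral_le[OF \<alpha> PQg Q gm]) (simp add: g0)
  have I2: "(\<integral>\<^sup>+ x. ennreal (g x powr (1 - \<alpha>)) \<partial>Q) \<le> ennreal (exp ((\<alpha> - 1) * \<epsilon>))"
  proof -
    have "(\<integral>\<^sup>+ x. ennreal (h x powr \<alpha>) \<partial>P) \<le> ennreal (exp ((\<alpha> - 1) * \<epsilon>))"
      by (rule renyi_le_integral_le[OF \<alpha> QPh P hmP]) (simp add: h0)
    also have "(\<integral>\<^sup>+ x. ennreal (h x powr \<alpha>) \<partial>P) = (\<integral>\<^sup>+ x. ennreal (g x) * ennreal (h x powr \<alpha>) \<partial>Q)"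
      by (subst Pg, rule nn_integral_density) auto
    also have "\<dots> = (\<integral>\<^sup>+ x. ennreal (g x powr (1 - \<alpha>)) \<partial>Q)"
    proof (rule nn_integral_cong_AE)
      show "AE x in Q. ennreal (g x) * ennreal (h x powr \<alpha>) = ennreal (g x powr (1 - \<alpha>))"
        using gh gpos
      proof eventually_elim
        case (elim x)
        then have "h x = 1 / g x" by (simp add: field_simps)
        then have "g x * h x powr \<alpha> = g x powr (1 - \<alpha>)" using elim by (simp add: powr_divide powr_diff)
        then show ?case using g0[of x] by (simp flip: ennreal_mult)
      qed
    qed
    finally show ?thesis .
  qed
  show ?thesis
    by (rule that[OF gm Pg gpos g1]) (use from_nn[OF _ _ I1] from_nn[OF _ _ I2] in auto)
qed

section \<open>Measures on the two corners\<close>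

definition corner_measure :: "real \<Rightarrow> real \<Rightarrow> (real^'n) measure" where
  "corner_measure c p = distr (density (count_space UNIV) (\<lambda>b. ennreal (if b then p else 1
      - p))) borel (\<lambda>b. \<chi> i. if b then 1 - c else c)"

lemma corner_measure:
  assumes p: "0 < p" "p < 1"
  shows "prob_space (corner_measure c p :: (real^'n) measure)"
    and "sets (corner_measure c p :: (real^'n) measure) = sets borel"
    and "AE x in corner_measure c p. x = (\<chi> i :: 'n. 1 - c) \<or> x = (\<chi> i. c)"
    and "f \<in> borel_measurable borel \<Longrightarrow> (\<integral>x. f x \<partial>corner_measure c p)
        = p * f (\<chi> i :: 'n. 1 - c) + (1 - p) * (f (\<chi> i. c) :: real)"
proof -
  let ?B = "density (count_space UNIV) (\<lambda>b. ennreal (if b then p else 1 - p))"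
  let ?v = "\<lambda>b. (\<chi> i. if b then 1 - c else c) :: real^'n"
  have "prob_space ?B"
    using p by (intro prob_spaceI) (simp add: emeasure_density nn_integral_count_space_finite UNIV_bool flip: ennreal_plus)
  then show "prob_space (corner_measure c p :: (real^'n) measure)"
    unfolding corner_measure_def by (rule prob_space.prob_space_distr) simp
  show "sets (corner_measure c p :: (real^'n) measure) = sets borel" by (simp add: corner_measure_def)
  have "?v b = (\<chi> i. 1 - c) \<or> ?v b = (\<chi> i. c)" for b by (cases b) simp_all
  then show "AE x in corner_measure c p. x = (\<chi> i :: 'n. 1 - c) \<or> x = (\<chi> i. c)"
    unfolding corner_measure_def by (subst AE_distr_iff) simp_all
  show "(\<integral>x. f x \<partial>corner_measure c p) = p * f (\<chi> i :: 'n. 1 - c) + (1 - p) * (f (\<chi> i. c) :: real)"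
    if [measurable]: "f \<in> borel_measurable borel"
  proof -
    have "(\<integral>x. f x \<partial>corner_measure c p) = (\<integral>b. f (?v b) \<partial>?B)"
      unfolding corner_measure_def by (rule integral_distr) auto
    also have "\<dots> = (\<Sum>b\<in>UNIV. (if b then p else 1 - p) * f (?v b))"
      using p by (subst integral_density) (auto simp: lebesgue_integral_count_space_finite AE_count_space)
    finally show ?thesis by (simp add: UNIV_bool)
  qed
qed

text \<open>All points other than the upper corner receive the ratio of the lower corner, so the
  function is positive and bounded everywhere and not just on the support.\<close>

definition corner_dens :: "real \<Rightarrow> real \<Rightarrow> real \<Rightarrow> real^'n \<Rightarrow> real" where
  "corner_dens c p q x = (if x = (\<chi> i. 1 - c) then p / q else (1 - p) / (1 - q))"

lemma corner_dens_measurable [measurable]: "(corner_dens c p q :: real^'n \<Rightarrow> real) \<in> borel_measurable borel"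
  unfolding corner_dens_def [abs_def]
  by (intro measurable_If) simp_all

section \<open>Divergences of two corner measures and of their outputs\<close>

context
  fixes c p q \<alpha> :: real
  assumes c: "0 \<le> c" "c < 1/2" and pq: "0 < p" "p < 1" "0 < q" "q < 1" and \<alpha>: "1 < \<alpha>"
begin

lemma corner_dens_simps: "corner_dens c p q (\<chi> i. 1 - c) = p / q" "corner_dens c p q (\<chi> i :: 'n::finite. c)
    = (1 - p) / (1 - q)"
proof -
  have "(\<chi> i :: 'n. c) \<noteq> (\<chi> i. 1 - c)" using c by (simp add: vec_eq_iff)
  then show "corner_dens c p q (\<chi> i. 1 - c) = p / q" "corner_dens c p q (\<chi> i :: 'n. c)
      = (1 - p) / (1 - q)" by (simp_all add: corner_dens_def)
qed

lemma corner_dens_pos: "0 < corner_dens c p q x"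
  using pq by (simp add: corner_dens_def)

lemma corner_measure_density:
  "corner_measure c p = density (corner_measure c q :: (real^'n) measure) (\<lambda>x. ennreal (corner_dens c p q x))"
proof -
  let ?v = "\<lambda>b. (\<chi> i. if b then 1 - c else c) :: real^'n"
  let ?C = "count_space (UNIV :: bool set)"
  have e: "ennreal (if b then q else 1 - q) * ennreal (corner_dens c p q (?v b)) = ennreal (if b then p else 1 - p)" for b
    using pq by (cases b) (simp_all add: corner_dens_simps flip: ennreal_mult)
  have "density (corner_measure c q :: (real^'n) measure) (\<lambda>x. ennreal (corner_dens c p q x))
     = distr (density (density ?C (\<lambda>b. ennreal (if b then q else 1 - q))) (\<lambda>b. ennreal (corner_dens c p q (?v b)))) borel ?v"
    unfolding corner_measure_def by (rule density_distr) auto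
  also have "density (density ?C (\<lambda>b. ennreal (if b then q else 1 - q))) (\<lambda>b. ennreal (corner_dens c p q (?v b)))
     = density ?C (\<lambda>b. ennreal (if b then q else 1 - q) * ennreal (corner_dens c p q (?v b)))"
    by (rule density_density_eq) auto
  also have "\<dots> = density ?C (\<lambda>b. ennreal (if b then p else 1 - p))" by (simp only: e)
  finally show ?thesis unfolding corner_measure_def[of c p] by (rule sym)
qed

lemma bern_pair_corner: "bern_pair (corner_measure c q :: (real^'n) measure) (corner_dens c p q) \<alpha> c"
proof -
  note cm = corner_measure[OF pq(3,4), where c = c and 'n = 'n]
  interpret prob_space "corner_measure c q :: (real^'n) measure" by (rule cm(1))
  have m: "f \<in> borel_measurable (corner_measure c q ::
      (real^'n) measure)" if "f \<in> borel_measurable borel" for f :: "real^'n \<Rightarrow> real"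
    using that measurable_cong_sets[OF cm(2) refl] by blast
  have bd: "integrable (corner_measure c q) (f :: real^'n \<Rightarrow> real)" if "f \<in> borel_measurable borel" "\<And>x. \<bar>f x\<bar> \<le> b" for f b
    using that by (intro integrable_const_bound[where B = b] m) auto
  have b: "\<bar>corner_dens c p q x\<bar> \<le> p / q + (1 - p) / (1 - q)" for x :: "real^'n"
    using pq by (simp add: corner_dens_def)
  show ?thesis
  proof
    show "AE x in corner_measure c q. \<forall>i :: 'n. c \<le> x $ i \<and> x $ i \<le> 1 - c"
      using cm(3) by eventually_elim (use c in auto)
    show "integrable (corner_measure c q) (corner_dens c p q :: real^'n \<Rightarrow> real)" by (rule bd[OF _ b]) simp
    show "(\<integral>x. corner_dens c p q x \<partial>(corner_measure c q :: (real^'n) measure)) = 1"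
      using pq by (subst cm(4)) (simp_all add: corner_dens_simps)
    show "integrable (corner_measure c q) (\<lambda>x :: real^'n. corner_dens c p q x powr \<alpha>)"
    proof (rule bd)
      show "\<bar>corner_dens c p q x powr \<alpha>\<bar> \<le> (p / q + (1 - p) / (1 - q)) powr \<alpha>" for x :: "real^'n"
        using b[of x] corner_dens_pos[of x] \<alpha> by (simp add: powr_mono2)
    qed simp
  qed (use \<alpha> c cm(1,2) in \<open>simp_all add: corner_dens_pos\<close>)
qed

lemma renyi_corner:
  "renyi \<alpha> (corner_measure c p :: (real^'n) measure) (corner_measure c q)
      = ereal (ln (aff \<alpha> (2 * p - 1) (2 * q - 1)) / (\<alpha> - 1))"
proof -
  interpret B: bern_pair "corner_measure c q :: (real^'n) measure" "corner_dens c p q" \<alpha> c by (rule bern_pair_corner)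
  have "(\<integral>x. corner_dens c p q x powr \<alpha> \<partial>(corner_measure c q :: (real^'n) measure))
      = q * (p / q) powr \<alpha> + (1 - q) * ((1 - p) / (1 - q)) powr \<alpha>"
    using pq by (subst corner_measure(4)) (simp_all add: corner_dens_simps)
  also have "\<dots> = aff \<alpha> (2 * p - 1) (2 * q - 1)"
  proof -
    have "aff \<alpha> (2 * p - 1) (2 * q - 1) = (2 * q * (2 * p / (2 * q)) powr \<alpha> + 2 * (1 - q) * (2 * (1 - p) / (2 * (1
        - q))) powr \<alpha>) / 2"
      using pq by (subst aff_ratio) (simp_all add: abs_less_iff right_diff_distrib)
    also have "2 * p / (2 * q) = p / q" by (rule mult_divide_mult_cancel_left) simp
    also have "2 * (1 - p) / (2 * (1 - q)) = (1 - p) / (1 - q)" by (rule mult_divide_mult_cancel_left) simp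
    also have "(2 * q * A + 2 * (1 - q) * B) / 2 = q * A + (1 - q) * B" for A B :: real by simp
    finally show ?thesis by (rule sym)
  qed
  finally show ?thesis
    unfolding corner_measure_density
    by (subst renyi_density_integrable[OF B.Q B.gmQ AE_I2 B.ga]) (simp_all only: less_imp_le[OF corner_dens_pos])
qed

lemma renyi_bern_corner:
  "renyi \<alpha> (bern_k (corner_measure c p :: (real^'n) measure) :: ('k::finite \<Rightarrow> 'n \<Rightarrow> bool) measure) (bern_k
      (corner_measure c q))
    = ereal (ln (corner_aff TYPE('k \<Rightarrow> 'n \<Rightarrow> bool) c \<alpha> (2 * p - 1) (2 * q - 1)) / (\<alpha> - 1))"
proof -
  interpret B: bern_pair "corner_measure c q :: (real^'n) measure" "corner_dens c p q" \<alpha> c by (rule bern_pair_corner)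
  have o: "B.out \<omega> = mix q (corner (1 - c) \<omega>) (corner c \<omega>)" for \<omega> :: "'k \<Rightarrow> 'n \<Rightarrow> bool"
    unfolding B.out_def by (subst corner_measure(4)[OF pq(3,4)]) (auto simp: mix_def)
  have og: "B.outg \<omega> = mix p (corner (1 - c) \<omega>) (corner c \<omega>)" for \<omega> :: "'k \<Rightarrow> 'n \<Rightarrow> bool"
    unfolding B.outg_def using pq by (subst corner_measure(4)[OF pq(3,4)]) (auto simp: mix_def corner_dens_simps)
  have "(\<Sum>\<omega>\<in>(UNIV :: ('k \<Rightarrow> 'n \<Rightarrow> bool) set). hel \<alpha> (B.outg \<omega>) (B.out \<omega>))
      = corner_aff TYPE('k \<Rightarrow> 'n \<Rightarrow> bool) c \<alpha> (2 * p - 1) (2 * q - 1)"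
    unfolding o og corner_aff_def
    using corner_hel_sum[OF \<alpha> c, of "2 * p - 1" "2 * q - 1", where 'k = 'k and 'n = 'n] pq by (simp add: abs_less_iff)
  then show ?thesis 
    using B.renyi_bern[where 'k = 'k] unfolding corner_measure_density[symmetric] by (simp only:)
qed

end

lemma in_C_corner: assumes "0 < p" "p < 1" shows "in_C c (corner_measure c p :: (real^'n) measure)"
proof -
  have "AE x in corner_measure c p. \<forall>i :: 'n. x $ i = c \<or> x $ i = 1 - c"
    using corner_measure(3)[OF assms, of c, where 'n = 'n] by eventually_elim auto
  then show ?thesis using corner_measure(1,2)[OF assms, of c, where 'n = 'n] by (simp add: in_C_def)
qed

text \<open>At (tanh z, - tanh z) the value is cosh (n z) / cosh z, which is 1 at z = 0 and
  unbounded, so a symmetric pair can exhaust every budget above 1.\<close>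

lemma aff_sym_surj:
  assumes \<alpha>: "1 < \<alpha>" and M: "1 < M"
  obtains t where "0 < t" "t < 1" "aff \<alpha> t (- t) = M"
proof -
  define n where "n = 2 * \<alpha> - 1"
  have n: "1 < n" using \<alpha> by (simp add: n_def)
  \<comment> \<open>Because cosh (n b) \<ge> exp (n b) / 2 and cosh b \<le> exp b, it suffices that
    exp ((n - 1) b) = 2 M.\<close>
  define b where "b = ln (2 * M) / (n - 1)"
  have b: "0 < b" using M n by (simp add: b_def)
  let ?f = "\<lambda>z. cosh (n * z) / cosh z"
  have Me: "M = exp ((n - 1) * b) / 2" using M n by (simp add: b_def)
  have "cosh b \<le> exp b" using b by (simp add: cosh_def)
  then have "M * cosh b \<le> M * exp b" using M by simp
  also have "\<dots> = exp (n * b) / 2" unfolding Me by (simp add: left_diff_distrib flip: exp_add)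
  also have "\<dots> \<le> cosh (n * b)" by (simp add: cosh_def)
  finally have "M \<le> ?f b" by (simp add: pos_le_divide_eq)
  moreover have "continuous_on {0..b} ?f" by (intro continuous_intros) simp_all
  ultimately obtain z where z: "0 \<le> z" "?f z = M"
    using IVT'[of ?f 0 M b] M b by auto
  have "z \<noteq> 0" using z(2) M by auto
  then have "0 < tanh z" using z(1) by simp
  moreover have "aff \<alpha> (tanh z) (- tanh z) = M" using z(2) unfolding aff_sym n_def .
  ultimately show ?thesis using tanh_real_lt_1[of z] by (intro that)
qed

section \<open>The worst pair\<close>

text \<open>Lets a bound on the sum pass through the logarithm.\<close>

lemma (in bern_pair) hel_sum_pos: "0 < (\<Sum>\<omega>\<in>(UNIV :: ('k::finite \<Rightarrow> 'n \<Rightarrow> bool) set). hel \<alpha> (outg \<omega>) (out \<omega>))"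
proof -
  have "(\<Sum>\<omega>\<in>(UNIV :: ('k \<Rightarrow> 'n \<Rightarrow> bool) set). outg \<omega>) = (\<integral>x. (\<Sum>\<omega>\<in>(UNIV :: ('k \<Rightarrow> 'n \<Rightarrow> bool) set). g x * bern x \<omega>) \<partial>Q)"
    unfolding outg_def by simp
  also have "\<dots> = 1" by (simp add: bern_sum g flip: sum_distrib_left)
  finally obtain \<omega> :: "'k \<Rightarrow> 'n \<Rightarrow> bool" where "outg \<omega> \<noteq> 0" by (metis sum.neutral zero_neq_one)
  then have "0 < outg \<omega>" "0 < out \<omega>" using outg_nonneg[of \<omega>] out_nonneg[of \<omega>] out_0[of \<omega>] by (auto simp: less_le)
  then have "0 < hel \<alpha> (outg \<omega>) (out \<omega>)" by (simp add: hel_def)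
  then show ?thesis by (intro sum_pos2[of _ \<omega>]) (auto simp: hel_def)
qed

text \<open>The witnesses are the corner measures of biases t and - t, with t chosen so that both
  constraints are tight at once. The reversal costs nothing because \<open>aff\<close> is unchanged
  when both biases change sign.\<close>

lemma renyi_bern_le_corner:
  fixes P Q :: "(real^'n) measure"
  assumes c: "0 \<le> c" "c < 1/2" and \<alpha>: "1 < \<alpha>" and \<epsilon>: "0 \<le> \<epsilon>"
    and P: "prob_space P" "sets P = sets borel" and Q: "prob_space Q" "sets Q = sets borel"
    and box: "AE x in Q. \<forall>i. c \<le> x $ i \<and> x $ i \<le> 1 - c"
    and PQ: "renyi \<alpha> P Q \<le> ereal \<epsilon>" and QP: "renyi \<alpha> Q P \<le> ereal \<epsilon>"
  obtains P' Q' :: "(real^'n) measure" where "in_C c P'" "in_C c Q'" "renyi \<alpha> P' Q' \<le> ereal \<epsilon>" "renyi \<alpha> Q' P' \<le> ereal \<epsilon>"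
    "renyi \<alpha> (bern_k P :: ('k::finite \<Rightarrow> 'n \<Rightarrow> bool) measure) (bern_k Q)
       \<le> renyi \<alpha> (bern_k P' :: ('k \<Rightarrow> 'n \<Rightarrow> bool) measure) (bern_k Q')"
proof -
  note witness = that
  obtain g where g: "g \<in> borel_measurable Q" "P = density Q (\<lambda>x. ennreal (g x))" "AE x in Q. 0 < g x"
    "integrable Q g" "(\<integral>x. g x \<partial>Q) = 1"
    "integrable Q (\<lambda>x. g x powr \<alpha>)" "(\<integral>x. g x powr \<alpha> \<partial>Q) \<le> exp ((\<alpha> - 1) * \<epsilon>)"
    "integrable Q (\<lambda>x. g x powr (1 - \<alpha>))" "(\<integral>x. g x powr (1 - \<alpha>) \<partial>Q) \<le> exp ((\<alpha> - 1) * \<epsilon>)"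
    using renyi_le_density[OF \<alpha> P(1) Q(1) _ PQ QP] P(2) Q(2) by metis
  have "g \<in> borel_measurable borel" using g(1) measurable_cong_sets[OF Q(2) refl] by blast
  then interpret B: bern_pair Q g \<alpha> c
    using \<alpha> c Q box g(3-6) by (simp add: bern_pair_def)
  let ?H = "\<Sum>\<omega>\<in>(UNIV :: ('k \<Rightarrow> 'n \<Rightarrow> bool) set). hel \<alpha> (B.outg \<omega>) (B.out \<omega>)"
  have H: "renyi \<alpha> (bern_k P :: ('k \<Rightarrow> 'n \<Rightarrow> bool) measure) (bern_k Q) = ereal (ln ?H / (\<alpha> - 1))"
    unfolding g(2) by (rule B.renyi_bern)
  have corner: thesis if t: "0 \<le> t" "t < 1" and M: "aff \<alpha> t (- t) = exp ((\<alpha> - 1) * \<epsilon>)"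
    and le: "?H \<le> corner_aff TYPE('k \<Rightarrow> 'n \<Rightarrow> bool) c \<alpha> t (- t)" for t
  proof -
    define p where "p = (1 + t) / 2"
    define q where "q = (1 - t) / 2"
    have pq: "0 < p" "p < 1" "0 < q" "q < 1" "2 * p - 1 = t" "2 * q - 1 = - t"
      using t by (auto simp: p_def q_def field_simps)
    have M': "aff \<alpha> (- t) t = exp ((\<alpha> - 1) * \<epsilon>)" using M aff_minus[of \<alpha> t "- t"] by simp
    show thesis
    proof (rule witness)
      show "in_C c (corner_measure c p :: (real^'n) measure)" "in_C c (corner_measure c q :: (real^'n) measure)"
        using pq by (intro in_C_corner; simp)+
      show "renyi \<alpha> (corner_measure c p :: (real^'n) measure) (corner_measure c q) \<le> ereal \<epsilon>"
        using \<alpha> by (subst renyi_corner[OF c pq(1-4) \<alpha>]) (simp add: pq M)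
      show "renyi \<alpha> (corner_measure c q :: (real^'n) measure) (corner_measure c p) \<le> ereal \<epsilon>"
        using \<alpha> by (subst renyi_corner[OF c pq(3,4,1,2) \<alpha>]) (simp add: pq M')
      have "ln ?H \<le> ln (corner_aff TYPE('k \<Rightarrow> 'n \<Rightarrow> bool) c \<alpha> t (- t))"
        using le B.hel_sum_pos[where 'k = 'k] by simp
      then show "renyi \<alpha> (bern_k P :: ('k \<Rightarrow> 'n \<Rightarrow> bool) measure) (bern_k Q)
        \<le> renyi \<alpha> (bern_k (corner_measure c p :: (real^'n) measure) :: ('k \<Rightarrow> 'n \<Rightarrow> bool) measure) (bern_k
            (corner_measure c q))"
        using \<alpha> unfolding H renyi_bern_corner[OF c pq(1-4) \<alpha>] pq(5,6) by (simp add: divide_right_mono)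
    qed
  qed
  show thesis
  proof (cases "\<epsilon> = 0")
    case True
    \<comment> \<open>The budget is 1 and only t = 0 attains it, outside the range of
      \<open>hel_le_corner\<close>; data processing alone suffices.\<close>
    have "?H \<le> 1" using B.hel_le_integral[where 'k = 'k] g(7) True by simp
    then show thesis using corner[of 0] True by (simp add: aff_diag corner_aff_0)
  next
    case False
    then have "1 < exp ((\<alpha> - 1) * \<epsilon>)" using \<epsilon> \<alpha> by simp
    then obtain t where t: "0 < t" "t < 1" "aff \<alpha> t (- t) = exp ((\<alpha> - 1) * \<epsilon>)"
      using aff_sym_surj[OF \<alpha>] by blast
    have "?H \<le> corner_aff TYPE('k \<Rightarrow> 'n \<Rightarrow> bool) c \<alpha> t (- t)"
      using g(7-9) unfolding t(3)[symmetric] by (intro B.hel_le_corner t(1,2))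
    then show thesis using corner[of t] t by simp
  qed
qed

section \<open>Equality of the two suprema\<close>

lemma renyi_le_eps_alg: "nb D D' \<Longrightarrow> renyi \<alpha> (A D) (A D') \<le> eps_alg nb \<alpha> A"
  unfolding eps_alg_def by (rule SUP_upper2[of "(D, D')"]) auto

theorem theorem3:
  fixes nb :: "'d \<Rightarrow> 'd \<Rightarrow> bool" and c \<alpha> \<epsilon> :: real
  assumes "symp nb" and "\<exists>D D'. nb D D' \<and> D \<noteq> D'"
    and "0 \<le> c" and "c < 1/2" and "\<alpha> > 1" and "\<epsilon> \<ge> 0"
  shows "(SUP A \<in> {A :: 'd \<Rightarrow> (real^'n) measure. box_alg c A \<and> eps_alg nb \<alpha> A \<le> ereal \<epsilon>}.
            eps_alg nb \<alpha> (\<lambda>D. (bern_k (A D) :: ('k::finite \<Rightarrow> 'n \<Rightarrow> bool) measure)))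
       = (SUP PQ \<in> {(P, Q). in_C c P \<and> in_C c Q \<and> renyi \<alpha> P Q \<le> ereal \<epsilon> \<and> renyi \<alpha> Q P \<le> ereal \<epsilon>}.
            renyi \<alpha> (bern_k (fst PQ) :: ('k \<Rightarrow> 'n \<Rightarrow> bool) measure) (bern_k (snd PQ)))"
    (is "(SUP A \<in> ?\<A>. ?L A) = (SUP PQ \<in> ?\<C>. ?R PQ)")
proof (rule antisym)
  show "(SUP A \<in> ?\<A>. ?L A) \<le> (SUP PQ \<in> ?\<C>. ?R PQ)"
  proof (rule SUP_least)
    fix A assume A: "A \<in> ?\<A>"
    show "?L A \<le> (SUP PQ \<in> ?\<C>. ?R PQ)"
      unfolding eps_alg_def
    proof (rule SUP_least)
      fix DD' assume "DD' \<in> {(D, D'). nb D D'}"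
      then obtain D D' where D: "DD' = (D, D')" "nb D D'" by auto
      \<comment> \<open>Symmetry of the relation turns the single supremum into constraints in both
        directions.\<close>
      have "nb D' D" using D(2) assms(1) by (auto dest: sympD)
      then have eps: "renyi \<alpha> (A D) (A D') \<le> ereal \<epsilon>" "renyi \<alpha> (A D') (A D) \<le> ereal \<epsilon>"
        using A D(2) by (auto intro: order_trans[OF renyi_le_eps_alg])
      have box: "prob_space (A D)" "sets (A D) = sets borel" "AE x in A D. \<forall>i. c \<le> x $ i \<and> x $ i \<le> 1 - c" for D
        using A by (auto simp: box_alg_def)
      obtain P Q where "(P, Q) \<in> ?\<C>" "?R (A D, A D') \<le> ?R (P, Q)"
        using renyi_bern_le_corner[OF assms(3-6) box(1,2) box(1-3) eps, where 'k = 'k]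
        by (metis (mono_tags, lifting) case_prodI fst_conv mem_Collect_eq snd_conv)
      then show "renyi \<alpha> (bern_k (A (fst DD')) :: ('k \<Rightarrow> 'n \<Rightarrow> bool) measure) (bern_k (A (snd DD'))) \<le> (SUP PQ \<in> ?\<C>. ?R PQ)"
        unfolding D(1) by (intro SUP_upper2[of "(P, Q)"]) auto
    qed
  qed
  show "(SUP PQ \<in> ?\<C>. ?R PQ) \<le> (SUP A \<in> ?\<A>. ?L A)"
  proof (rule SUP_least)
    fix PQ assume "PQ \<in> ?\<C>"
    then obtain P Q where PQ: "PQ = (P, Q)" "in_C c P" "in_C c Q" "renyi \<alpha> P Q \<le> ereal \<epsilon>" "renyi \<alpha> Q P \<le> ereal \<epsilon>"
      by auto
    obtain D1 D2 where D: "nb D1 D2" "D1 \<noteq> D2" using assms(2) by blast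
    \<comment> \<open>An algorithm with the values P and Q that separates one neighbouring pair. Any
      other two datasets see P and Q in some order, or two equal laws of divergence 0.\<close>
    define A where "A D = (if D = D1 then P else Q)" for D
    have in_box: "prob_space R \<and> sets R = sets borel \<and> (AE x in R. \<forall>i. c \<le> x $ i \<and> x $ i
        \<le> 1 - c)" if "in_C c R" for R :: "(real^'n) measure"
    proof -
      have "AE x in R. \<forall>i. x $ i = c \<or> x $ i = 1 - c" using that by (simp add: in_C_def)
      then have "AE x in R. \<forall>i. c \<le> x $ i \<and> x $ i \<le> 1 - c"
      proof eventually_elim
        case (elim x)
        show ?case
        proof
          fix i
          show "c \<le> x $ i \<and> x $ i \<le> 1 - c" using elim[rule_format, of i] assms(4) by auto
        qed
      qed
      then show ?thesis using that by (simp add: in_C_def)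
    qed
    have "renyi \<alpha> (A D) (A D') \<le> ereal \<epsilon>" for D D'
      using PQ(4,5) assms(6) renyi_self[of P \<alpha>] renyi_self[of Q \<alpha>] PQ(2,3)
      by (auto simp: A_def in_C_def)
    then have "A \<in> ?\<A>" using in_box PQ(2,3) by (auto simp: box_alg_def A_def eps_alg_def intro!: SUP_least)
    moreover have "?R PQ \<le> ?L A"
      using renyi_le_eps_alg[of nb D1 D2 \<alpha> "\<lambda>D. bern_k (A D) :: ('k \<Rightarrow> 'n \<Rightarrow> bool) measure"] D PQ(1)
      by (simp add: A_def)
    ultimately show "?R PQ \<le> (SUP A \<in> ?\<A>. ?L A)" by (intro SUP_upper2[of A])
  qed
qed

end
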